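(* Let $n$ be a positive integer and let $G_1,\dots,G_n$ be nontrivial compactly generated totally disconnected locally compact groups, such that for each $G_i$ there is a compact open subgroup $U_i$ such that $G_i=\langle gU_ig^{-1}\mid g\in G_i\rangle$ and $\bigcap_{g\in G_i}gU_ig^{-1}=\{1\}$. (For example, we can take $G_i\in\mathscr S$ and $U_i$ to be any compact open subgroup.) Then there exists a local action diagram $\Delta$ with $\mathbf U(\Delta)\in\mathscr S$ acting continuously on a countable tree $T$, vertex stabilisers $O_1,\dots,O_n$ of $\mathbf U(\Delta)$ and compact normal subgroups $K_i$ of $O_i$, such that $O_i\cong K_i\rtimes G_i$ for $1\le i\le n$.
   Context: $\mathscr S$ is the class of nondiscrete, compactly generated, topologically simple, totally disconnected locally compact groups. A topological group is compactly generated if it is generated as an abstract group by a compact subset. Graphs. A graph $\Gamma$ has a vertex set $V\Gamma$, an arc set $A\Gamma$, an origin map $o:A\Gamma\to V\Gamma$ and a reversal map $a\mapsto\overline a$ on $A\Gamma$ with $\overline{\overline a}=a$; $t(a):=o(\overline a)$. Loops are allowed, and for a loop $a$ both $\overline a=a$ and $\overline a\neq a$ are allowed. $o^{-1}(v)$ is the set of arcs with origin $v$. A tree is a nonempty connected graph without loops, multiple edges or cycles. Permutation groups carry the permutation topology (pointwise stabilisers of finite sets form a base of neighbourhoods of the identity), and $\mathrm{Aut}(T)\le\mathrm{Sym}(VT)$ the subspace topology. Local action diagrams. A local action diagram $\Delta=(\Gamma,(X_a),(G(v)))$ consists of a connected graph $\Gamma$; nonempty pairwise disjoint sets $X_a$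 $(a\in A\Gamma)$; and for each $v\in V\Gamma$ a closed subgroup $G(v)\le\mathrm{Sym}(X_v)$, $X_v=\bigsqcup_{a\in o^{-1}(v)}X_a$, whose orbits are the sets $X_a$, $a\in o^{-1}(v)$. Universal group. A $\Delta$-tree is a tree $T$ with a surjective graph homomorphism $\pi:T\to\Gamma$ and a map $\mathcal L:AT\to\bigsqcup_{a\in A\Gamma}X_a$ such that for all $v\in VT$ and $a\in o^{-1}(\pi(v))$, $\mathcal L$ restricts to a bijection $\{b\in o^{-1}(v):\pi(b)=a\}\to X_a$ (such a tree exists). Let $\mathcal L_v:o^{-1}(v)\to X_{\pi(v)}$ be the resulting bijection. For $g\in\mathrm{Aut}(T)$ with $\pi\circ g=\pi$ let $\sigma_{\mathcal L,v}(g)=\mathcal L_{gv}\circ g\circ\mathcal L_v^{-1}\in\mathrm{Sym}(X_{\pi(v)})$. $\mathbf U(\Delta)$ is the group of all $g\in\mathrm{Aut}(T)$ with $\pi\circ g=\pi$ and $\sigma_{\mathcal L,v}(g)\in G(\pi(v))$ for all $v\in VT$, with the subspace topology from $\mathrm{Aut}(T)$; as a group acting on a tree it is independent of the $\Delta$-tree up to isomorphism of trees. *)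

theory Defs
  imports
    "HOL-Analysis.Analysis"
    "HOL-Algebra.Bij"
    "HOL-Algebra.Coset"
    "HOL-Algebra.Generated_Groups"
    "HOL-Algebra.Group_Action"
begin

section \<open>Topological groups\<close>

text \<open>A topological group is a group \<open>G\<close> together with a topology whose underlying set is
  \<open>carrier G\<close>.\<close>

definition topological_group :: "('g, 'm) monoid_scheme \<Rightarrow> 'g topology \<Rightarrow> bool" where
  "topological_group G \<tau> \<longleftrightarrow>
     group G \<and> topspace \<tau> = carrier G \<and>
     continuous_map (prod_topology \<tau> \<tau>) \<tau> (\<lambda>(x, y). x \<otimes>\<^bsub>G\<^esub> y) \<and>
     continuous_map \<tau> \<tau> (\<lambda>x. inv\<^bsub>G\<^esub> x)"

definition totally_disconnected :: "'g topology \<Rightarrow> bool" where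
  "totally_disconnected \<tau> \<longleftrightarrow> (\<forall>S. connectedin \<tau> S \<longrightarrow> (\<exists>x. S \<subseteq> {x}))"

text \<open>A totally disconnected topological group is automatically Hausdorff; the Hausdorff
  condition is stated because it is part of the usual meaning of local compactness.\<close>

definition tdlc_group :: "('g, 'm) monoid_scheme \<Rightarrow> 'g topology \<Rightarrow> bool" where
  "tdlc_group G \<tau> \<longleftrightarrow>
     topological_group G \<tau> \<and> Hausdorff_space \<tau> \<and>
     totally_disconnected \<tau> \<and> locally_compact_space \<tau>"

definition compactly_generated :: "('g, 'm) monoid_scheme \<Rightarrow> 'g topology \<Rightarrow> bool" where
  "compactly_generated G \<tau> \<longleftrightarrow> (\<exists>C. compactin \<tau> C \<and> generate G C = carrier G)"

definition topologically_simple :: "('g, 'm) monoid_scheme \<Rightarrow> 'g topology \<Rightarrow> bool" where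
  "topologically_simple G \<tau> \<longleftrightarrow>
     carrier G \<noteq> {\<one>\<^bsub>G\<^esub>} \<and>
     (\<forall>N. N \<lhd> G \<and> closedin \<tau> N \<longrightarrow> N = {\<one>\<^bsub>G\<^esub>} \<or> N = carrier G)"

definition class_S :: "('g, 'm) monoid_scheme \<Rightarrow> 'g topology \<Rightarrow> bool" where
  "class_S G \<tau> \<longleftrightarrow>
     tdlc_group G \<tau> \<and> \<tau> \<noteq> discrete_topology (carrier G) \<and>
     compactly_generated G \<tau> \<and> topologically_simple G \<tau>"

definition compact_open_subgroup ::
    "('g, 'm) monoid_scheme \<Rightarrow> 'g topology \<Rightarrow> 'g set \<Rightarrow> bool" where
  "compact_open_subgroup G \<tau> U \<longleftrightarrow> subgroup U G \<and> compactin \<tau> U \<and> openin \<tau> U"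

definition conjugate_set :: "('g, 'm) monoid_scheme \<Rightarrow> 'g set \<Rightarrow> 'g \<Rightarrow> 'g set" where
  "conjugate_set G U g = g <#\<^bsub>G\<^esub> U #>\<^bsub>G\<^esub> (inv\<^bsub>G\<^esub> g)"

definition topological_group_iso ::
    "('g, 'm) monoid_scheme \<Rightarrow> 'g topology \<Rightarrow> ('h, 'n) monoid_scheme \<Rightarrow> 'h topology \<Rightarrow>
     ('g \<Rightarrow> 'h) \<Rightarrow> bool" where
  "topological_group_iso G \<tau> H \<sigma> f \<longleftrightarrow> f \<in> iso G H \<and> homeomorphic_map \<tau> \<sigma> f"

definition continuous_automorphic_action ::
    "('h, 'n) monoid_scheme \<Rightarrow> 'h topology \<Rightarrow> ('k, 'm) monoid_scheme \<Rightarrow> 'k topology \<Rightarrow>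
     ('h \<Rightarrow> 'k \<Rightarrow> 'k) \<Rightarrow> bool" where
  "continuous_automorphic_action H \<sigma> K \<kappa> \<theta> \<longleftrightarrow>
     \<theta> \<in> hom H (AutoGroup K) \<and>
     continuous_map (prod_topology \<sigma> \<kappa>) \<kappa> (\<lambda>(h, k). \<theta> h k)"

definition semidirect_product ::
    "('k, 'm) monoid_scheme \<Rightarrow> ('h, 'n) monoid_scheme \<Rightarrow> ('h \<Rightarrow> 'k \<Rightarrow> 'k) \<Rightarrow> ('k \<times> 'h) monoid" where
  "semidirect_product K H \<theta> =
     \<lparr>carrier = carrier K \<times> carrier H,
      mult = \<lambda>(k, h) (k', h'). (k \<otimes>\<^bsub>K\<^esub> \<theta> h k', h \<otimes>\<^bsub>H\<^esub> h'),
      one = (\<one>\<^bsub>K\<^esub>, \<one>\<^bsub>H\<^esub>)\<rparr>"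

text \<open>For a subgroup \<open>K\<close> of a topological group \<open>(A, \<alpha>)\<close>: \<open>A\<close> is isomorphic, as a topological
  group, to \<open>K \<rtimes> H\<close> for some continuous action of \<open>H\<close> on \<open>K\<close>, in such a way that
  the given subgroup \<open>K\<close> corresponds to the first factor.\<close>

definition splits_as_semidirect_product ::
    "('a, 'l) monoid_scheme \<Rightarrow> 'a topology \<Rightarrow> 'a set \<Rightarrow>
     ('h, 'n) monoid_scheme \<Rightarrow> 'h topology \<Rightarrow> bool" where
  "splits_as_semidirect_product A \<alpha> K H \<sigma> \<longleftrightarrow>
     (\<exists>\<theta> f. continuous_automorphic_action H \<sigma> (A\<lparr>carrier := K\<rparr>) (subtopology \<alpha> K) \<theta> \<and>
            topological_group_iso A \<alpha>
              (semidirect_product (A\<lparr>carrier := K\<rparr>) H \<theta>)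
              (prod_topology (subtopology \<alpha> K) \<sigma>) f \<and>
            (\<forall>k\<in>K. f k = (k, \<one>\<^bsub>H\<^esub>)))"


section \<open>Permutation topology\<close>

text \<open>The base of open sets consists of the left cosets of the pointwise stabilisers of finite
  subsets. Permutations are extensional functions, as in \<^const>\<open>BijGroup\<close>.\<close>

definition perm_topology :: "'x set \<Rightarrow> ('x \<Rightarrow> 'x) topology" where
  "perm_topology S =
     topology_generated_by
       {{h \<in> Bij S. \<forall>x\<in>F. h x = g x} |g F. g \<in> Bij S \<and> finite F \<and> F \<subseteq> S}"


section \<open>Graphs and trees\<close>

text \<open>No condition excludes arcs with \<open>arev a = a\<close> (which are necessarily loops).\<close>

record ('v, 'a) agraph =
  verts :: "'v set"
  arcs :: "'a set"
  orig :: "'a \<Rightarrow> 'v"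
  arev :: "'a \<Rightarrow> 'a"

definition targ :: "('v, 'a, 'z) agraph_scheme \<Rightarrow> 'a \<Rightarrow> 'v" where
  "targ \<Gamma> a = orig \<Gamma> (arev \<Gamma> a)"

definition is_graph :: "('v, 'a, 'z) agraph_scheme \<Rightarrow> bool" where
  "is_graph \<Gamma> \<longleftrightarrow>
     (\<forall>a\<in>arcs \<Gamma>. orig \<Gamma> a \<in> verts \<Gamma> \<and> arev \<Gamma> a \<in> arcs \<Gamma> \<and> arev \<Gamma> (arev \<Gamma> a) = a)"

definition arcs_at :: "('v, 'a, 'z) agraph_scheme \<Rightarrow> 'v \<Rightarrow> 'a set" where
  "arcs_at \<Gamma> v = {a \<in> arcs \<Gamma>. orig \<Gamma> a = v}"

primrec walk :: "('v, 'a, 'z) agraph_scheme \<Rightarrow> 'v \<Rightarrow> 'a list \<Rightarrow> 'v \<Rightarrow> bool" where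
  "walk \<Gamma> u [] w \<longleftrightarrow> u \<in> verts \<Gamma> \<and> u = w"
| "walk \<Gamma> u (a # as) w \<longleftrightarrow> a \<in> arcs_at \<Gamma> u \<and> walk \<Gamma> (targ \<Gamma> a) as w"

definition graph_connected :: "('v, 'a, 'z) agraph_scheme \<Rightarrow> bool" where
  "graph_connected \<Gamma> \<longleftrightarrow> (\<forall>u\<in>verts \<Gamma>. \<forall>w\<in>verts \<Gamma>. \<exists>as. walk \<Gamma> u as w)"

definition has_loop :: "('v, 'a, 'z) agraph_scheme \<Rightarrow> bool" where
  "has_loop \<Gamma> \<longleftrightarrow> (\<exists>a\<in>arcs \<Gamma>. orig \<Gamma> a = targ \<Gamma> a)"

definition has_multiple_edges :: "('v, 'a, 'z) agraph_scheme \<Rightarrow> bool" where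
  "has_multiple_edges \<Gamma> \<longleftrightarrow>
     (\<exists>a\<in>arcs \<Gamma>. \<exists>b\<in>arcs \<Gamma>. a \<noteq> b \<and> orig \<Gamma> a = orig \<Gamma> b \<and> targ \<Gamma> a = targ \<Gamma> b)"

definition has_cycle :: "('v, 'a, 'z) agraph_scheme \<Rightarrow> bool" where
  "has_cycle \<Gamma> \<longleftrightarrow> (\<exists>u as. 3 \<le> length as \<and> walk \<Gamma> u as u \<and> distinct (map (orig \<Gamma>) as))"

definition is_tree :: "('v, 'a, 'z) agraph_scheme \<Rightarrow> bool" where
  "is_tree T \<longleftrightarrow>
     is_graph T \<and> verts T \<noteq> {} \<and> graph_connected T \<and>
     \<not> has_loop T \<and> \<not> has_multiple_edges T \<and> \<not> has_cycle T"

definition graph_hom ::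
    "('v, 'a, 'z) agraph_scheme \<Rightarrow> ('w, 'b, 'y) agraph_scheme \<Rightarrow> ('v \<Rightarrow> 'w) \<Rightarrow> ('a \<Rightarrow> 'b) \<Rightarrow> bool" where
  "graph_hom \<Gamma> \<Gamma>' f h \<longleftrightarrow>
     f \<in> verts \<Gamma> \<rightarrow> verts \<Gamma>' \<and> h \<in> arcs \<Gamma> \<rightarrow> arcs \<Gamma>' \<and>
     (\<forall>a\<in>arcs \<Gamma>. orig \<Gamma>' (h a) = f (orig \<Gamma> a) \<and> arev \<Gamma>' (h a) = h (arev \<Gamma> a))"

definition surjective_graph_hom ::
    "('v, 'a, 'z) agraph_scheme \<Rightarrow> ('w, 'b, 'y) agraph_scheme \<Rightarrow> ('v \<Rightarrow> 'w) \<Rightarrow> ('a \<Rightarrow> 'b) \<Rightarrow> bool" where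
  "surjective_graph_hom \<Gamma> \<Gamma>' f h \<longleftrightarrow>
     graph_hom \<Gamma> \<Gamma>' f h \<and> f ` verts \<Gamma> = verts \<Gamma>' \<and> h ` arcs \<Gamma> = arcs \<Gamma>'"

text \<open>\<open>Aut(T)\<close> is taken as a subset of \<open>Sym(VT)\<close>: since a tree has no multiple edges, an
  automorphism is determined by its action on the vertices, and its action on the arcs is
  recovered by \<open>arc_image\<close>.\<close>

definition tree_auts :: "('v, 'a, 'z) agraph_scheme \<Rightarrow> ('v \<Rightarrow> 'v) set" where
  "tree_auts T =
     {g \<in> Bij (verts T). \<exists>h. graph_hom T T g h \<and> bij_betw h (arcs T) (arcs T)}"

definition arc_image :: "('v, 'a, 'z) agraph_scheme \<Rightarrow> ('v \<Rightarrow> 'v) \<Rightarrow> 'a \<Rightarrow> 'a" where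
  "arc_image T g a =
     (THE b. b \<in> arcs T \<and> orig T b = g (orig T a) \<and> targ T b = g (targ T a))"

lemma arc_image_eq:
  assumes "is_tree T" "graph_hom T T g h" "a \<in> arcs T"
  shows "arc_image T g a = h a"
  unfolding arc_image_def
proof (rule the_equality)
  have "arev T a \<in> arcs T"
    using assms by (auto simp: is_tree_def is_graph_def)
  then show *: "h a \<in> arcs T \<and> orig T (h a) = g (orig T a) \<and> targ T (h a) = g (targ T a)"
    using assms by (auto simp: graph_hom_def targ_def)
  show "b = h a" if "b \<in> arcs T \<and> orig T b = g (orig T a) \<and> targ T b = g (targ T a)" for b
    using * that assms(1) by (metis is_tree_def has_multiple_edges_def)
qed


section \<open>Local action diagrams and universal groups\<close>

text \<open>A local action diagram is a graph carrying a colour set \<open>X\<^sub>a\<close> for each arc \<open>a\<close> and a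
  permutation group \<open>G(v)\<close> for each vertex \<open>v\<close>.\<close>

record ('v, 'a, 'x) action_diagram = "('v, 'a) agraph" +
  colours :: "'a \<Rightarrow> 'x set"
  local_group :: "'v \<Rightarrow> ('x \<Rightarrow> 'x) set"

definition vertex_colours :: "('v, 'a, 'x) action_diagram \<Rightarrow> 'v \<Rightarrow> 'x set" where
  "vertex_colours \<Delta> v = (\<Union>a\<in>arcs_at \<Delta> v. colours \<Delta> a)"

definition local_action_diagram :: "('v, 'a, 'x) action_diagram \<Rightarrow> bool" where
  "local_action_diagram \<Delta> \<longleftrightarrow>
     is_graph \<Delta> \<and> graph_connected \<Delta> \<and>
     (\<forall>a\<in>arcs \<Delta>. colours \<Delta> a \<noteq> {}) \<and>
     disjoint_family_on (colours \<Delta>) (arcs \<Delta>) \<and>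
     (\<forall>v\<in>verts \<Delta>.
        subgroup (local_group \<Delta> v) (BijGroup (vertex_colours \<Delta> v)) \<and>
        closedin (perm_topology (vertex_colours \<Delta> v)) (local_group \<Delta> v) \<and>
        orbits (BijGroup (vertex_colours \<Delta> v)\<lparr>carrier := local_group \<Delta> v\<rparr>)
          (vertex_colours \<Delta> v) (\<lambda>g. g) = colours \<Delta> ` arcs_at \<Delta> v)"

text \<open>A \<open>\<Delta>\<close>-tree is recorded as a graph together with its projection to the diagram (on vertices
  and on arcs) and its labelling of the arcs.\<close>

record ('t, 'e, 'v, 'a, 'x) labelled_tree = "('t, 'e) agraph" +
  vproj :: "'t \<Rightarrow> 'v"
  aproj :: "'e \<Rightarrow> 'a"
  label :: "'e \<Rightarrow> 'x"

definition diagram_tree ::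
    "('v, 'a, 'x) action_diagram \<Rightarrow> ('t, 'e, 'v, 'a, 'x) labelled_tree \<Rightarrow> bool" where
  "diagram_tree \<Delta> T \<longleftrightarrow>
     is_tree T \<and>
     surjective_graph_hom T \<Delta> (vproj T) (aproj T) \<and>
     label T \<in> arcs T \<rightarrow> (\<Union>a\<in>arcs \<Delta>. colours \<Delta> a) \<and>
     (\<forall>v\<in>verts T. \<forall>a\<in>arcs_at \<Delta> (vproj T v).
        bij_betw (label T) {b \<in> arcs_at T v. aproj T b = a} (colours \<Delta> a))"

definition local_action ::
    "('v, 'a, 'x) action_diagram \<Rightarrow> ('t, 'e, 'v, 'a, 'x) labelled_tree \<Rightarrow> 't \<Rightarrow> ('t \<Rightarrow> 't) \<Rightarrow>
     ('x \<Rightarrow> 'x)" where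
  "local_action \<Delta> T v g =
     (\<lambda>x\<in>vertex_colours \<Delta> (vproj T v).
        label T (arc_image T g (inv_into (arcs_at T v) (label T) x)))"

definition universal_set ::
    "('v, 'a, 'x) action_diagram \<Rightarrow> ('t, 'e, 'v, 'a, 'x) labelled_tree \<Rightarrow> ('t \<Rightarrow> 't) set" where
  "universal_set \<Delta> T =
     {g \<in> tree_auts T.
        (\<forall>v\<in>verts T. vproj T (g v) = vproj T v) \<and>
        (\<forall>b\<in>arcs T. aproj T (arc_image T g b) = aproj T b) \<and>
        (\<forall>v\<in>verts T. local_action \<Delta> T v g \<in> local_group \<Delta> (vproj T v))}"

definition universal_group ::
    "('v, 'a, 'x) action_diagram \<Rightarrow> ('t, 'e, 'v, 'a, 'x) labelled_tree \<Rightarrow> ('t \<Rightarrow> 't) monoid" where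
  "universal_group \<Delta> T = BijGroup (verts T)\<lparr>carrier := universal_set \<Delta> T\<rparr>"

definition universal_topology ::
    "('v, 'a, 'x) action_diagram \<Rightarrow> ('t, 'e, 'v, 'a, 'x) labelled_tree \<Rightarrow> ('t \<Rightarrow> 't) topology" where
  "universal_topology \<Delta> T = subtopology (perm_topology (verts T)) (universal_set \<Delta> T)"

text \<open>Continuity of an action of a topological group of permutations on a discrete set.\<close>

definition acts_continuously :: "('t \<Rightarrow> 't) topology \<Rightarrow> 't set \<Rightarrow> bool" where
  "acts_continuously \<tau> V \<longleftrightarrow>
     continuous_map (prod_topology \<tau> (discrete_topology V)) (discrete_topology V) (\<lambda>(g, v). g v)"

end

(*
A group G with a compact open subgroup U of trivial core acts faithfully, properly and with closed
image on X = G/U, and the conjugates of U become the point stabilisers. Choose such permutation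
groups P_i on X_i for at least two indices i, and let the diagram be a star with trivial local
group and one-element colour sets at the centre and with local groups P_i at the leaves.

The vertices of the tree over the centre form the free product Y of the pointed sets X_i (reduced
words), and the universal group becomes the group U of permutations of Y that act on every class of
words with a common base through P_i. Letting P_i act on first letters gives a homomorphic section
P_i -> U, which splits the action of a leaf stabiliser on its star; the kernel of that action is
compact because the stabiliser of a word has finite orbits.

Simplicity is Tits' argument, simplified by closedness. A nontrivial normal subgroup N contains a
hyperbolic element t whose powers move some branch off every finite set, so if g is supported on
that branch then the commutators [g, t^m] in N converge to g. Hence a closed N contains all branch
groups, thus all word stabilisers, and these generate U because P_i is generated by its point
stabilisers.

For a group H in class S and a compact open subgroup W, the core of W is a closed normal subgroup,
so it is trivial unless W = H. But then H is compact and has a proper open subgroup, whose core is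
open, normal and proper, hence trivial, so H would be discrete.
*)
theory Submission
  imports Defs
begin

section \<open>Permutation topologies\<close>

text \<open>A single leaf would not do in general: with one type every reduced word has at most one
  letter, the tree is bounded and the group is the local group itself. With two types words grow
  without bound, and an element is hyperbolic as soon as it moves the empty word to one whose first
  and last letters differ in type. Branching comes from the generation hypothesis. Trivial point
  stabilisers would generate only the trivial group, so some stabiliser is nontrivial, and with the
  base point chosen there each \<open>X i\<close> has at least two further letters. The trivial
  local group at the centre makes every element preserve types. Hence, unless it folds back at the
  first letter, an element extends words letter by letter (\<open>U_extend\<close>). This replaces
  geodesics, so the whole simplicity argument runs on words, and the tree enters only afterwards
  through the isomorphism \<open>lift\<close>. Compact generation makes the coset spaces countable,
  so letters, vertices and arcs can all be natural numbers.\<close>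

lemma Bij_apply: "f \<in> Bij S \<Longrightarrow> x \<in> S \<Longrightarrow> f x \<in> S"
  using Bij_imp_funcset by blast

lemma Bij_inj: "f \<in> Bij S \<Longrightarrow> inj_on f S"
  by (simp add: Bij_def bij_betw_def)

lemma Bij_bij_betw: "f \<in> Bij S \<Longrightarrow> bij_betw f S S"
  by (simp add: Bij_def)

lemma Bij_ext: "f \<in> Bij S \<Longrightarrow> g \<in> Bij S \<Longrightarrow> (\<And>x. x \<in> S \<Longrightarrow> f x = g x) \<Longrightarrow> f = g"
  by (meson Bij_imp_extensional extensionalityI)

lemma BijI:
  assumes "f \<in> extensional S" "\<And>x. x \<in> S \<Longrightarrow> f x \<in> S" "\<And>x. x \<in> S \<Longrightarrow> f' x \<in> S"
    "\<And>x. x \<in> S \<Longrightarrow> f' (f x) = x" "\<And>x. x \<in> S \<Longrightarrow> f (f' x) = x"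
  shows "f \<in> Bij S"
  unfolding Bij_def using assms by (auto intro: bij_betwI[where g = f'])

lemma carrier_BijGroup [simp]: "carrier (BijGroup S) = Bij S"
  by (simp add: BijGroup_def)

lemma mult_BijGroup: "f \<in> Bij S \<Longrightarrow> g \<in> Bij S \<Longrightarrow> f \<otimes>\<^bsub>BijGroup S\<^esub> g = compose S f g"
  by (simp add: BijGroup_def)

lemma one_BijGroup: "\<one>\<^bsub>BijGroup S\<^esub> = (\<lambda>x\<in>S. x)"
  by (simp add: BijGroup_def)

lemma mult_BijGroup_apply:
  "f \<in> Bij S \<Longrightarrow> g \<in> Bij S \<Longrightarrow> x \<in> S \<Longrightarrow> (f \<otimes>\<^bsub>BijGroup S\<^esub> g) x = f (g x)"
  by (simp add: mult_BijGroup compose_def)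

lemma inv_BijGroup_apply:
  assumes "f \<in> Bij S" "x \<in> S"
  shows "(inv\<^bsub>BijGroup S\<^esub> f) (f x) = x" "f ((inv\<^bsub>BijGroup S\<^esub> f) x) = x"
    "(inv\<^bsub>BijGroup S\<^esub> f) x \<in> S"
  using assms Bij_bij_betw[OF assms(1)]
  by (auto simp: inv_BijGroup bij_betw_def f_inv_into_f inv_into_into)

lemma inv_BijGroup_Bij: "f \<in> Bij S \<Longrightarrow> inv\<^bsub>BijGroup S\<^esub> f \<in> Bij S"
  using group.inv_closed[OF group_BijGroup, of f S] by simp

lemma perm_topology_base:
  "openin (perm_topology S) {h \<in> Bij S. \<forall>x\<in>F. h x = g x}"
  if "g \<in> Bij S" "finite F" "F \<subseteq> S"
  unfolding perm_topology_def by (rule topology_generated_by_Basis) (use that in blast)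

lemma topspace_perm_topology [simp]: "topspace (perm_topology S) = Bij S"
  unfolding perm_topology_def topology_generated_by_topspace
proof (intro equalityI subsetI)
  fix g assume "g \<in> Bij S"
  then have "{h \<in> Bij S. \<forall>x\<in>{}. h x = g x} \<in> {{h \<in> Bij S. \<forall>x\<in>F. h x = g x} |g F. g \<in> Bij S \<and> finite F \<and> F \<subseteq> S}"
    by blast
  then show "g \<in> \<Union> {{h \<in> Bij S. \<forall>x\<in>F. h x = g x} |g F. g \<in> Bij S \<and> finite F \<and> F \<subseteq> S}"
    using \<open>g \<in> Bij S\<close> by blast
qed blast

lemma openin_perm_topology_point:
  assumes "x \<in> S"
  shows "openin (perm_topology S) {h \<in> Bij S. h x = y}"
proof (cases "\<exists>g\<in>Bij S. g x = y")
  case True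
  then obtain g where "g \<in> Bij S" "g x = y" by blast
  then show ?thesis using perm_topology_base[of g S "{x}"] assms by simp
next
  case False
  then have "{h \<in> Bij S. h x = y} = {}" by blast
  then show ?thesis by (simp only: openin_empty)
qed

text \<open>Basic open sets are finite intersections of evaluation fibres, so continuity can be
  tested one point at a time. Most continuity proofs below go through this criterion.\<close>

lemma continuous_map_perm_topology_iff:
  "continuous_map \<alpha> (perm_topology S) f \<longleftrightarrow>
     f ` topspace \<alpha> \<subseteq> Bij S \<and> (\<forall>x\<in>S. \<forall>y\<in>S. openin \<alpha> {a \<in> topspace \<alpha>. f a x = y})"
  (is "?L \<longleftrightarrow> ?R")
proof
  assume L: ?L
  then have sub: "f ` topspace \<alpha> \<subseteq> Bij S"
    by (auto simp: continuous_map_def)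
  moreover have "openin \<alpha> {a \<in> topspace \<alpha>. f a x = y}" if "x \<in> S" "y \<in> S" for x y
  proof -
    have "openin \<alpha> {a \<in> topspace \<alpha>. f a \<in> {h \<in> Bij S. h x = y}}"
      by (rule openin_continuous_map_preimage[OF L openin_perm_topology_point[OF that(1)]])
    moreover have "{a \<in> topspace \<alpha>. f a \<in> {h \<in> Bij S. h x = y}} = {a \<in> topspace \<alpha>. f a x = y}"
      using sub by blast
    ultimately show ?thesis by simp
  qed
  ultimately show ?R by blast
next
  assume R: ?R
  show ?L
    unfolding perm_topology_def
  proof (rule continuous_on_generated_topo)
    fix V assume "V \<in> {{h \<in> Bij S. \<forall>x\<in>F. h x = g x} |g F. g \<in> Bij S \<and> finite F \<and> F \<subseteq> S}"
    then obtain g F where V: "V = {h \<in> Bij S. \<forall>x\<in>F. h x = g x}" "g \<in> Bij S" "finite F" "F \<subseteq> S"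
      by blast
    have "f -` V \<inter> topspace \<alpha> = topspace \<alpha> \<inter> (\<Inter>x\<in>F. {a \<in> topspace \<alpha>. f a x = g x})"
      using conjunct1[OF R] V(1) by auto
    moreover have "openin \<alpha> (topspace \<alpha> \<inter> (\<Inter>x\<in>F. {a \<in> topspace \<alpha>. f a x = g x}))"
    proof (cases "F = {}")
      case False
      have "openin \<alpha> (\<Inter>x\<in>F. {a \<in> topspace \<alpha>. f a x = g x})"
      proof (rule openin_INT2)
        fix x assume x: "x \<in> F"
        then have "x \<in> S" using V(4) by blast
        moreover from this have "g x \<in> S" by (rule Bij_apply[OF V(2)])
        ultimately
        show "openin \<alpha> {a \<in> topspace \<alpha>. f a x = g x}" using R by blast
      qed (use V False in auto)
      then show ?thesis by blast
    qed simp
    ultimately show "openin \<alpha> (f -` V \<inter> topspace \<alpha>)" by simp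
  next
    show "f ` topspace \<alpha> \<subseteq> \<Union> {{h \<in> Bij S. \<forall>x\<in>F. h x = g x} |g F. g \<in> Bij S \<and> finite F \<and> F \<subseteq> S}"
      using R topspace_perm_topology[of S] unfolding perm_topology_def topology_generated_by_topspace
      by simp
  qed
qed

lemma continuous_map_perm_eval:
  assumes "x \<in> S"
  shows "continuous_map (perm_topology S) (discrete_topology S) (\<lambda>h. h x)"
proof -
  have "openin (perm_topology S) {h \<in> Bij S. h x \<in> V}" for V
  proof -
    have "{h \<in> Bij S. h x \<in> V} = (\<Union>y\<in>V. {h \<in> Bij S. h x = y})" by blast
    then show ?thesis
      using openin_perm_topology_point[OF assms] by auto
  qed
  then show ?thesis
    using Bij_apply[OF _ assms] unfolding continuous_map_def by auto
qed

text \<open>This is the topology of pointwise convergence; the product form gives access to the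
  Hausdorff property and to Tychonoff's theorem.\<close>

lemma perm_topology_subtopology_product:
  "perm_topology S = subtopology (product_topology (\<lambda>_. discrete_topology S) S) (Bij S)"
    (is "?P = ?Q")
proof -
  have B: "Bij S \<subseteq> S \<rightarrow>\<^sub>E S"
    by (rule subsetI, rule PiE_I) (use Bij_apply Bij_imp_extensional extensional_arb in metis)+
  then have tQ: "topspace ?Q = Bij S"
    by (simp add: topspace_subtopology Int_absorb1)
  have "continuous_map ?P (product_topology (\<lambda>_. discrete_topology S) S) id"
    using B by (auto simp: continuous_map_componentwise continuous_map_perm_eval PiE_def)
  then have 1: "continuous_map ?P ?Q id"
    by (simp add: continuous_map_in_subtopology)
  have "openin ?Q {a \<in> Bij S. id a x = y}" if "x \<in> S" "y \<in> S" for x y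
  proof -
    have c: "continuous_map ?Q (discrete_topology S) (\<lambda>h. h x)"
      by (rule continuous_map_from_subtopology)
        (rule continuous_map_product_projection[OF that(1), where X = "\<lambda>_. discrete_topology S"])
    have "openin ?Q {h \<in> topspace ?Q. h x \<in> {y}}"
      by (rule openin_continuous_map_preimage[OF c]) (use that in simp)
    then show ?thesis unfolding tQ by simp
  qed
  then have 2: "continuous_map ?Q ?P id"
    unfolding continuous_map_perm_topology_iff tQ by simp
  have "openin ?P W \<longleftrightarrow> openin ?Q W" for W
  proof
    assume W: "openin ?P W"
    then have "W \<subseteq> Bij S" using openin_subset by fastforce
    then show "openin ?Q W"
      using openin_continuous_map_preimage[OF 2 W] unfolding tQ by (simp add: Int_absorb1 Collect_conj_eq)
  next
    assume W: "openin ?Q W"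
    then have "W \<subseteq> Bij S" using openin_subset tQ by metis
    then show "openin ?P W"
      using openin_continuous_map_preimage[OF 1 W] by (simp add: Int_absorb1 Collect_conj_eq)
  qed
  then show ?thesis by (simp add: topology_eq)
qed

text \<open>Agreeing with \<open>g\<close> on \<open>F1\<close> and on \<open>F2\<close> is agreeing
  on the union, so around a given point the generating sets are closed under finite intersections
  and form a base.\<close>

lemma openin_perm_topology_iff:
  "openin (perm_topology S) V \<longleftrightarrow>
     V \<subseteq> Bij S \<and> (\<forall>g\<in>V. \<exists>F. finite F \<and> F \<subseteq> S \<and> {h \<in> Bij S. \<forall>x\<in>F. h x = g x} \<subseteq> V)"
proof -
  define N where "N = (\<lambda>g V. \<exists>F. finite F \<and> F \<subseteq> S \<and> {h \<in> Bij S. \<forall>x\<in>F. h x = g x} \<subseteq> V)"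
  have mono: "N g W" if "N g V" "V \<subseteq> W" for g V W
    using that unfolding N_def by (meson subset_trans)
  have Int: "N g (V \<inter> W)" if "N g V" "N g W" for g V W
  proof -
    obtain F1 where F1: "finite F1" "F1 \<subseteq> S" "{h \<in> Bij S. \<forall>x\<in>F1. h x = g x} \<subseteq> V"
      using \<open>N g V\<close> unfolding N_def by blast
    obtain F2 where F2: "finite F2" "F2 \<subseteq> S" "{h \<in> Bij S. \<forall>x\<in>F2. h x = g x} \<subseteq> W"
      using \<open>N g W\<close> unfolding N_def by blast
    have "{h \<in> Bij S. \<forall>x\<in>F1 \<union> F2. h x = g x} \<subseteq> V \<inter> W"
      using F1(3) F2(3) by blast
    then show ?thesis
      unfolding N_def using F1(1,2) F2(1,2) by (intro exI[of _ "F1 \<union> F2"]) simp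
  qed
  have "openin (perm_topology S) V \<longleftrightarrow> V \<subseteq> Bij S \<and> (\<forall>g\<in>V. N g V)"
  proof (intro iffI conjI)
    assume V: "openin (perm_topology S) V"
    then show "V \<subseteq> Bij S" using openin_subset by fastforce
    from V have "generate_topology_on {{h \<in> Bij S. \<forall>x\<in>F. h x = g x} |g F. g \<in> Bij S \<and> finite F \<and> F \<subseteq> S} V"
      unfolding perm_topology_def openin_topology_generated_by_iff .
    then show "\<forall>g\<in>V. N g V"
    proof induction
      case Empty
      show ?case by simp
    next
      case (Int a b)
      then show ?case using \<open>\<And>g V W. N g V \<Longrightarrow> N g W \<Longrightarrow> N g (V \<inter> W)\<close> by simp
    next
      case (UN K)
      show ?case
      proof
        fix g assume "g \<in> \<Union> K"
        then obtain k where k: "k \<in> K" "g \<in> k" by (rule UnionE)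
        from bspec[OF UN.IH[OF k(1)] k(2)] Union_upper[OF k(1)] show "N g (\<Union> K)" by (rule mono)
      qed
    next
      case (Basis s)
      then obtain g F where s: "s = {h \<in> Bij S. \<forall>x\<in>F. h x = g x}" "finite F" "F \<subseteq> S" by blast
      show ?case
        unfolding N_def using s(2,3) by (intro ballI exI[of _ F]) (auto simp: s(1))
    qed
  next
    assume R: "V \<subseteq> Bij S \<and> (\<forall>g\<in>V. N g V)"
    show "openin (perm_topology S) V"
    proof (subst openin_subopen, intro ballI)
      fix g assume g: "g \<in> V"
      then have "N g V" using R by simp
      then obtain F where F: "finite F" "F \<subseteq> S" "{h \<in> Bij S. \<forall>x\<in>F. h x = g x} \<subseteq> V"
        unfolding N_def by blast
      have gB: "g \<in> Bij S" using g R by blast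
      have "g \<in> {h \<in> Bij S. \<forall>x\<in>F. h x = g x}" using gB by simp
      then show "\<exists>T. openin (perm_topology S) T \<and> g \<in> T \<and> T \<subseteq> V"
        using perm_topology_base[OF gB F(1,2)] F(3) by (intro exI conjI)
    qed
  qed
  then show ?thesis unfolding N_def .
qed

text \<open>The complement is open when each outside point has a basic neighbourhood that misses the
  set. In this form a closed set is entered by approximation on finite sets, which is how simplicity
  and closedness are proved below.\<close>

lemma closedin_perm_topology_iff:
  "closedin (perm_topology S) A \<longleftrightarrow>
     A \<subseteq> Bij S \<and>
     (\<forall>f\<in>Bij S. (\<forall>F. finite F \<and> F \<subseteq> S \<longrightarrow> (\<exists>a\<in>A. \<forall>x\<in>F. a x = f x)) \<longrightarrow> f \<in> A)"
proof (cases "A \<subseteq> Bij S")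
  case True
  have *: "{h \<in> Bij S. \<forall>x\<in>F. h x = f x} \<subseteq> Bij S - A \<longleftrightarrow> \<not> (\<exists>a\<in>A. \<forall>x\<in>F. a x = f x)" for F f
    using True by (auto simp: subset_iff)
  have "(\<forall>g\<in>Bij S - A. \<exists>F. finite F \<and> F \<subseteq> S \<and> \<not> Q F g) \<longleftrightarrow>
      (\<forall>f\<in>Bij S. (\<forall>F. finite F \<and> F \<subseteq> S \<longrightarrow> Q F f) \<longrightarrow> f \<in> A)" for Q
    by blast
  from this[of "\<lambda>F f. \<exists>a\<in>A. \<forall>x\<in>F. a x = f x"] show ?thesis
    unfolding closedin_def topspace_perm_topology openin_perm_topology_iff *
    using True by simp
qed (simp add: closedin_def)

lemma Hausdorff_perm_topology: "Hausdorff_space (perm_topology S)"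
  unfolding perm_topology_subtopology_product
  by (intro Hausdorff_space_subtopology) (simp add: Hausdorff_space_product_topology)

text \<open>Evaluations are continuous into discrete spaces, hence constant on connected sets, and
  together they separate permutations.\<close>

lemma totally_disconnected_perm_topology: "totally_disconnected (perm_topology S)"
  unfolding totally_disconnected_def
proof (intro allI impI)
  fix C assume C: "connectedin (perm_topology S) C"
  then have CB: "C \<subseteq> Bij S" using connectedin_subset_topspace by fastforce
  have "f = g" if "f \<in> C" "g \<in> C" for f g
  proof (rule Bij_ext)
    show "f \<in> Bij S" "g \<in> Bij S" using that CB by auto
    fix x assume "x \<in> S"
    from connectedin_continuous_map_image[OF continuous_map_perm_eval[OF this] C]
    have "\<exists>a. (\<lambda>h. h x) ` C \<subseteq> {a}"
      by (auto simp: connectedin_discrete_topology)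
    then show "f x = g x" using that by blast
  qed
  then show "\<exists>x. C \<subseteq> {x}" by blast
qed

lemma totally_disconnected_subtopology:
  "totally_disconnected \<tau> \<Longrightarrow> totally_disconnected (subtopology \<tau> A)"
  by (auto simp: totally_disconnected_def connectedin_subtopology)

text \<open>Evaluation fibres suffice: a product sends \<open>x\<close> to \<open>y\<close> iff the
  right factor sends \<open>x\<close> to some \<open>z\<close> that the left factor sends to
  \<open>y\<close>, and an inverse sends \<open>x\<close> to \<open>y\<close> iff the element sends
  \<open>y\<close> to \<open>x\<close>.\<close>

lemma topological_group_perm:
  assumes V: "subgroup V (BijGroup S)"
  shows "topological_group (BijGroup S\<lparr>carrier := V\<rparr>) (subtopology (perm_topology S) V)"
    (is "topological_group ?G ?\<tau>")
proof -
  have VB: "V \<subseteq> Bij S" using subgroup.subset[OF V] by simp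
  have grp: "group ?G" using subgroup.subgroup_is_group[OF V group_BijGroup] .
  have ts: "topspace ?\<tau> = V" using VB by (simp add: topspace_subtopology Int_absorb1)
  have op: "openin ?\<tau> {g \<in> V. g x = y}" if "x \<in> S" for x y
  proof -
    have "openin ?\<tau> ({h \<in> Bij S. h x = y} \<inter> V)"
      using openin_perm_topology_point[OF that] openin_subtopology by blast
    moreover have "{h \<in> Bij S. h x = y} \<inter> V = {g \<in> V. g x = y}" using VB by auto
    ultimately show ?thesis by simp
  qed
  have m: "continuous_map (prod_topology ?\<tau> ?\<tau>) (perm_topology S) (\<lambda>(x, y). x \<otimes>\<^bsub>?G\<^esub> y)"
    unfolding continuous_map_perm_topology_iff
  proof (intro conjI ballI)
    show "(\<lambda>(x, y). x \<otimes>\<^bsub>?G\<^esub> y) ` topspace (prod_topology ?\<tau> ?\<tau>) \<subseteq> Bij S"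
      using VB subgroup.m_closed[OF V] unfolding topspace_prod_topology ts by auto
    fix x y assume xy: "x \<in> S" "y \<in> S"
    have "{a \<in> topspace (prod_topology ?\<tau> ?\<tau>). (case a of (x, y) \<Rightarrow> x \<otimes>\<^bsub>?G\<^esub> y) x = y} =
      (\<Union>z\<in>S. {g \<in> V. g z = y} \<times> {g \<in> V. g x = z})"
    proof -
      have "(g \<otimes>\<^bsub>?G\<^esub> h) x = y \<longleftrightarrow> (\<exists>z\<in>S. g z = y \<and> h x = z)" if "g \<in> V" "h \<in> V" for g h
      proof -
        have "g \<in> Bij S" "h \<in> Bij S" using that VB by auto
        then show ?thesis using xy Bij_apply[of h S x] by (simp add: mult_BijGroup_apply)
      qed
      then show ?thesis unfolding topspace_prod_topology ts by auto
    qed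
    moreover have "openin (prod_topology ?\<tau> ?\<tau>) (\<Union>z\<in>S. {g \<in> V. g z = y} \<times> {g \<in> V. g x = z})"
    proof (rule openin_Union)
      fix W assume "W \<in> (\<lambda>z. {g \<in> V. g z = y} \<times> {g \<in> V. g x = z}) ` S"
      then obtain z where "z \<in> S" "W = {g \<in> V. g z = y} \<times> {g \<in> V. g x = z}" by blast
      then show "openin (prod_topology ?\<tau> ?\<tau>) W" using op xy(1) by (simp add: openin_prod_Times_iff)
    qed
    ultimately show "openin (prod_topology ?\<tau> ?\<tau>)
        {a \<in> topspace (prod_topology ?\<tau> ?\<tau>). (case a of (x, y) \<Rightarrow> x \<otimes>\<^bsub>?G\<^esub> y) x = y}"
      by (simp only:)
  qed
  have inv: "inv\<^bsub>?G\<^esub> g = inv\<^bsub>BijGroup S\<^esub> g" if "g \<in> V" for g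
    using group.m_inv_consistent[OF group_BijGroup V that] by simp
  have i: "continuous_map ?\<tau> (perm_topology S) (\<lambda>x. inv\<^bsub>?G\<^esub> x)"
    unfolding continuous_map_perm_topology_iff
  proof (intro conjI ballI)
    show "(\<lambda>x. inv\<^bsub>?G\<^esub> x) ` topspace ?\<tau> \<subseteq> Bij S"
    proof (rule image_subsetI)
      fix g assume "g \<in> topspace ?\<tau>"
      then have "g \<in> V" unfolding ts .
      then show "inv\<^bsub>?G\<^esub> g \<in> Bij S"
        unfolding inv[OF \<open>g \<in> V\<close>] using VB inv_BijGroup_Bij by blast
    qed
    fix x y assume xy: "x \<in> S" "y \<in> S"
    have "{a \<in> topspace ?\<tau>. (inv\<^bsub>?G\<^esub> a) x = y} = {g \<in> V. g y = x}"
    proof -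
      have "(inv\<^bsub>?G\<^esub> a) x = y \<longleftrightarrow> a y = x" if "a \<in> V" for a
      proof -
        have "a \<in> Bij S" using that VB by auto
        then show ?thesis using xy inv_BijGroup_apply[of a S] unfolding inv[OF that] by metis
      qed
      then show ?thesis unfolding ts by blast
    qed
    then show "openin ?\<tau> {a \<in> topspace ?\<tau>. (inv\<^bsub>?G\<^esub> a) x = y}" using op[OF xy(2)] by (simp only:)
  qed
  have "(\<lambda>(x, y). x \<otimes>\<^bsub>?G\<^esub> y) \<in> topspace (prod_topology ?\<tau> ?\<tau>) \<rightarrow> V"
    using subgroup.m_closed[OF V] unfolding topspace_prod_topology ts by auto
  moreover have "(\<lambda>x. inv\<^bsub>?G\<^esub> x) \<in> topspace ?\<tau> \<rightarrow> V"
  proof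
    fix g assume "g \<in> topspace ?\<tau>"
    then have g: "g \<in> V" unfolding ts .
    then show "inv\<^bsub>?G\<^esub> g \<in> V" unfolding inv[OF g] by (rule subgroup.m_inv_closed[OF V])
  qed
  ultimately show ?thesis
    unfolding topological_group_def using grp ts m i
    unfolding continuous_map_in_subtopology image_subset_iff_funcset by simp
qed

text \<open>Tychonoff gives compactness of the product of the finite orbits, but a pointwise limit
  of permutations is in general only injective. Finiteness of the orbits repairs this: an injection
  that maps each finite orbit into itself permutes it.\<close>

lemma compactin_perm_topology:
  assumes K: "closedin (perm_topology S) K" "subgroup K (BijGroup S)"
    and fin: "\<And>x. x \<in> S \<Longrightarrow> finite ((\<lambda>k. k x) ` K)"
  shows "compactin (perm_topology S) K"
proof -
  define Ob where "Ob = (\<lambda>x. (\<lambda>k. k x) ` K)"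
  let ?P = "product_topology (\<lambda>_. discrete_topology S) S"
  have KB: "K \<subseteq> Bij S" using subgroup.subset[OF K(2)] by simp
  have ObS: "Ob x \<subseteq> S" if "x \<in> S" for x using Bij_apply[OF _ that] KB unfolding Ob_def by blast
  have self: "x \<in> Ob x" if "x \<in> S" for x
    unfolding Ob_def
    by (rule image_eqI[OF _ subgroup.one_closed[OF K(2)]]) (use that in \<open>simp add: one_BijGroup\<close>)
  have trans: "Ob z \<subseteq> Ob x" if x: "x \<in> S" and z: "z \<in> Ob x" for x z
  proof
    fix w assume "w \<in> Ob z"
    then obtain k k' where k: "k \<in> K" "k' \<in> K" "w = k' z" "z = k x" using z by (auto simp: Ob_def)
    then have "w = (k' \<otimes>\<^bsub>BijGroup S\<^esub> k) x" using KB x by (simp add: mult_BijGroup_apply subset_iff)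
    then show "w \<in> Ob x" using subgroup.m_closed[OF K(2)] k by (auto simp: Ob_def)
  qed
  define B where "B = {f \<in> PiE S Ob. inj_on f S}"
  have "compactin ?P (PiE S Ob)"
    unfolding compactin_PiE compactin_discrete_topology
    using ObS fin unfolding Ob_def by (intro disjI2 ballI conjI)
  moreover have "closedin ?P {f \<in> topspace ?P. inj_on f S}"
  proof -
    \<comment> \<open>A collision is visible on two coordinates, so it persists in a
      neighbourhood.\<close>
    have "openin ?P {f \<in> topspace ?P. \<not> inj_on f S}"
    proof (subst openin_subopen, intro ballI)
      fix f assume "f \<in> {f \<in> topspace ?P. \<not> inj_on f S}"
      then obtain x y where f: "f \<in> topspace ?P" and xy: "x \<in> S" "y \<in> S" "x \<noteq> y" "f x = f y"
        by (auto simp: inj_on_def)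
      have op: "openin ?P {h \<in> topspace ?P. h u \<in> {f x}}" if "u \<in> S" for u
        by (rule openin_continuous_map_preimage[OF continuous_map_product_projection[OF that]])
          (use f xy(1) in auto)
      let ?T = "{h \<in> topspace ?P. h x \<in> {f x}} \<inter> {h \<in> topspace ?P. h y \<in> {f x}}"
      have "openin ?P ?T" using op[OF xy(1)] op[OF xy(2)] by (rule openin_Int)
      moreover have "f \<in> ?T" using f xy(4) by simp
      moreover have "?T \<subseteq> {f \<in> topspace ?P. \<not> inj_on f S}"
      proof
        fix h assume "h \<in> ?T"
        then have "h \<in> topspace ?P" "h x = h y" by auto
        then show "h \<in> {f \<in> topspace ?P. \<not> inj_on f S}" using inj_onD[of h S x y] xy by blast
      qed
      ultimately show "\<exists>T. openin ?P T \<and> f \<in> T \<and> T \<subseteq> {f \<in> topspace ?P. \<not> inj_on f S}"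
        by (intro exI conjI)
    qed
    moreover have "topspace ?P - {f \<in> topspace ?P. inj_on f S} = {f \<in> topspace ?P. \<not> inj_on f S}"
      by blast
    ultimately show ?thesis unfolding closedin_def by simp
  qed
  ultimately have "compactin ?P ({f \<in> topspace ?P. inj_on f S} \<inter> PiE S Ob)"
    by (rule closed_Int_compactin[rotated])
  moreover have "{f \<in> topspace ?P. inj_on f S} \<inter> PiE S Ob = B"
    using PiE_mono[of S Ob "\<lambda>_. S"] ObS by (auto simp: B_def)
  ultimately have "compactin ?P B" by (simp only:)
  moreover have BB: "B \<subseteq> Bij S"
  proof
    fix f assume f: "f \<in> B"
    have "f ` S = S"
    proof (intro equalityI subsetI)
      show "y \<in> S" if "y \<in> f ` S" for y using that f ObS by (auto simp: B_def dest!: PiE_mem)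
      fix y assume y: "y \<in> S"
      have "f ` Ob y \<subseteq> Ob y"
        using f trans[OF y] ObS[OF y] by (auto simp: B_def PiE_def Pi_def subset_iff)
      moreover have "inj_on f (Ob y)" using f ObS[OF y] by (auto simp: B_def intro: inj_on_subset)
      moreover have "finite (Ob y)" using fin[OF y] by (simp add: Ob_def)
      ultimately have "f ` Ob y = Ob y" by (simp add: endo_inj_surj)
      then show "y \<in> f ` S" using self[OF y] ObS[OF y] by blast
    qed
    then show "f \<in> Bij S" using f by (auto simp: B_def Bij_def bij_betw_def PiE_def)
  qed
  ultimately have "compactin (perm_topology S) B"
    by (simp add: perm_topology_subtopology_product compactin_subtopology)
  then have "compactin (perm_topology S) (K \<inter> B)" using closed_Int_compactin[OF K(1)] by blast
  moreover have "K \<subseteq> B"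
  proof
    fix k assume k: "k \<in> K"
    then have "k \<in> Bij S" using KB by blast
    then show "k \<in> B"
      using k by (auto simp: B_def Ob_def PiE_def Bij_inj Bij_imp_extensional)
  qed
  ultimately show ?thesis by (simp add: Int_absorb2)
qed

section \<open>Topological groups\<close>

lemma conjugate_set_eq: "conjugate_set G U g = (\<lambda>u. g \<otimes>\<^bsub>G\<^esub> u \<otimes>\<^bsub>G\<^esub> inv\<^bsub>G\<^esub> g) ` U"
  by (auto simp: conjugate_set_def l_coset_def r_coset_def)

locale topological_grp = group G for G (structure) +
  fixes \<tau>
  assumes topological_group: "topological_group G \<tau>"
begin

lemma topspace_eq [simp]: "topspace \<tau> = carrier G"
  using topological_group by (simp add: topological_group_def)

lemma continuous_map_mult:
  assumes "continuous_map \<alpha> \<tau> f" "continuous_map \<alpha> \<tau> g"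
  shows "continuous_map \<alpha> \<tau> (\<lambda>x. f x \<otimes> g x)"
proof -
  have "continuous_map (prod_topology \<tau> \<tau>) \<tau> (\<lambda>(x, y). x \<otimes> y)"
    using topological_group by (simp add: topological_group_def)
  from continuous_map_compose[OF continuous_map_pairedI[OF assms] this]
  show ?thesis by (simp add: o_def)
qed

lemma continuous_map_inv:
  assumes "continuous_map \<alpha> \<tau> f"
  shows "continuous_map \<alpha> \<tau> (\<lambda>x. inv (f x))"
proof -
  have "continuous_map \<tau> \<tau> (\<lambda>x. inv x)"
    using topological_group by (simp add: topological_group_def)
  from continuous_map_compose[OF assms this] show ?thesis by (simp add: o_def)
qed

lemma continuous_map_id': "continuous_map \<tau> \<tau> (\<lambda>x. x)"
  using continuous_map_id by (simp add: id_def)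

lemma continuous_map_const': "c \<in> carrier G \<Longrightarrow> continuous_map \<alpha> \<tau> (\<lambda>x. c)"
  by (simp add: continuous_map_const)

lemmas continuous_group_ops =
  continuous_map_mult continuous_map_inv continuous_map_id' continuous_map_const'

lemma openin_preimage:
  assumes "continuous_map \<tau> \<tau> f" "openin \<tau> V"
  shows "openin \<tau> {x \<in> carrier G. f x \<in> V}"
  using openin_continuous_map_preimage[OF assms] by simp

lemma l_coset_eq_preimage:
  assumes "g \<in> carrier G" "V \<subseteq> carrier G"
  shows "g <# V = {x \<in> carrier G. inv g \<otimes> x \<in> V}"
proof (intro equalityI subsetI)
  fix x assume "x \<in> g <# V"
  then obtain v where v: "v \<in> V" "x = g \<otimes> v" by (auto simp: l_coset_def)
  then have "v \<in> carrier G" using assms(2) by blast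
  then show "x \<in> {x \<in> carrier G. inv g \<otimes> x \<in> V}"
    using v assms(1) by (simp add: m_assoc[symmetric])
next
  fix x assume "x \<in> {x \<in> carrier G. inv g \<otimes> x \<in> V}"
  then have x: "x \<in> carrier G" "inv g \<otimes> x \<in> V" by auto
  then have "x = g \<otimes> (inv g \<otimes> x)" using assms(1) by (simp add: m_assoc[symmetric])
  then show "x \<in> g <# V" using x(2) unfolding l_coset_def by blast
qed

lemma openin_l_coset:
  assumes "g \<in> carrier G" "openin \<tau> V"
  shows "openin \<tau> (g <# V)"
proof -
  have "V \<subseteq> carrier G" using openin_subset[OF assms(2)] by simp
  then show ?thesis
    unfolding l_coset_eq_preimage[OF assms(1) \<open>V \<subseteq> carrier G\<close>]
    by (intro openin_preimage continuous_group_ops inv_closed assms)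
qed

lemma compactin_l_coset:
  assumes "g \<in> carrier G" "compactin \<tau> V"
  shows "compactin \<tau> (g <# V)"
proof -
  have "g <# V = (\<lambda>x. g \<otimes> x) ` V" by (auto simp: l_coset_def)
  moreover have "continuous_map \<tau> \<tau> (\<lambda>x. g \<otimes> x)" by (intro continuous_group_ops assms)
  ultimately show ?thesis using image_compactin[OF assms(2)] by simp
qed

text \<open>Each point of \<open>N\<close> lies in a translate of \<open>V\<close> by an element of
  \<open>N\<close>.\<close>

lemma openin_superset_subgroup:
  assumes "subgroup N G" "openin \<tau> V" "V \<noteq> {}" "V \<subseteq> N"
  shows "openin \<tau> N"
proof (subst openin_subopen, intro ballI)
  fix x assume x: "x \<in> N"
  obtain v where v: "v \<in> V" "v \<in> N" using assms by blast
  define g where "g = x \<otimes> inv v"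
  have g: "g \<in> N" unfolding g_def using assms(1) x v(2) by (simp add: subgroup.m_closed subgroup.m_inv_closed)
  have gc: "g \<in> carrier G" "x \<in> carrier G" "v \<in> carrier G"
    using g x v(2) subgroup.mem_carrier[OF assms(1)] by blast+
  have "x = g \<otimes> v" unfolding g_def using gc by (simp add: m_assoc)
  then have "x \<in> g <# V" using v(1) unfolding l_coset_def by blast
  moreover have "g <# V \<subseteq> N"
    unfolding l_coset_def using subgroup.m_closed[OF assms(1) g] assms(4) by blast
  ultimately show "\<exists>T. openin \<tau> T \<and> x \<in> T \<and> T \<subseteq> N"
    using openin_l_coset[OF gc(1) assms(2)] by (intro exI conjI)
qed

lemma closedin_open_subgroup:
  assumes "subgroup V G" "openin \<tau> V"
  shows "closedin \<tau> V"
proof -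
  have sub: "V \<subseteq> carrier G" using subgroup.subset[OF assms(1)] .
  have "openin \<tau> (carrier G - V)"
  proof (subst openin_subopen, intro ballI)
    fix x assume x: "x \<in> carrier G - V"
    have "x \<in> x <# V" using subgroup.one_closed[OF assms(1)] x unfolding l_coset_def by force
    moreover have "x <# V \<subseteq> carrier G - V"
    proof
      fix y assume "y \<in> x <# V"
      then obtain v where v: "v \<in> V" "y = x \<otimes> v" by (auto simp: l_coset_def)
      then have vc: "v \<in> carrier G" using sub by blast
      have "x = y \<otimes> inv v" using x v vc by (simp add: m_assoc)
      then have "x \<in> V" if "y \<in> V"
        using subgroup.m_closed[OF assms(1) that subgroup.m_inv_closed[OF assms(1) v(1)]] by (simp only:)
      then show "y \<in> carrier G - V" using x v vc by auto
    qed
    ultimately show "\<exists>T. openin \<tau> T \<and> x \<in> T \<and> T \<subseteq> carrier G - V"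
      using openin_l_coset[of x V] x assms(2) by (intro exI conjI) auto
  qed
  then show ?thesis using sub by (simp add: closedin_def)
qed

lemma discrete_if_one_open:
  assumes "openin \<tau> {\<one>}"
  shows "\<tau> = discrete_topology (carrier G)"
proof -
  have "openin \<tau> {x}" if "x \<in> carrier G" for x
  proof -
    have "x <# {\<one>} = {x}" using that by (simp add: l_coset_def)
    then show ?thesis using openin_l_coset[OF that assms] by simp
  qed
  then show ?thesis by (metis discrete_topology_unique topspace_eq)
qed

lemma locally_compact_if_compact_open:
  assumes "compactin \<tau> U" "openin \<tau> U" "\<one> \<in> U"
  shows "locally_compact_space \<tau>"
  unfolding locally_compact_space_def
proof
  fix x assume "x \<in> topspace \<tau>"
  then have x: "x \<in> carrier G" by simp
  then have "x \<in> x <# U" using assms(3) unfolding l_coset_def by force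
  then show "\<exists>U K. openin \<tau> U \<and> compactin \<tau> K \<and> x \<in> U \<and> U \<subseteq> K"
    using openin_l_coset[OF x assms(2)] compactin_l_coset[OF x assms(1)] by blast
qed

section \<open>Conjugates, core and normal closure of a subgroup\<close>

lemma conjugate_set_subset: "U \<subseteq> carrier G \<Longrightarrow> g \<in> carrier G \<Longrightarrow> conjugate_set G U g \<subseteq> carrier G"
  by (auto simp: conjugate_set_eq)

lemma mem_conjugate_set_iff:
  assumes "U \<subseteq> carrier G" "g \<in> carrier G"
  shows "x \<in> conjugate_set G U g \<longleftrightarrow> x \<in> carrier G \<and> inv g \<otimes> x \<otimes> g \<in> U"
proof
  assume "x \<in> conjugate_set G U g"
  then obtain u where u: "u \<in> U" "x = g \<otimes> u \<otimes> inv g" by (auto simp: conjugate_set_eq)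
  then have "u \<in> carrier G" using assms(1) by blast
  then have "inv g \<otimes> x \<otimes> g = u" unfolding u(2) using assms(2)
    by (simp add: m_assoc) (simp add: m_assoc[symmetric])
  then show "x \<in> carrier G \<and> inv g \<otimes> x \<otimes> g \<in> U" using u assms(2) \<open>u \<in> carrier G\<close> by simp
next
  assume x: "x \<in> carrier G \<and> inv g \<otimes> x \<otimes> g \<in> U"
  then have "x = g \<otimes> (inv g \<otimes> x \<otimes> g) \<otimes> inv g"
    using assms(2) by (simp add: m_assoc) (simp add: m_assoc[symmetric])
  then show "x \<in> conjugate_set G U g" unfolding conjugate_set_eq using x by blast
qed

lemma conjugate_set_one: "U \<subseteq> carrier G \<Longrightarrow> conjugate_set G U \<one> = U"
  by (auto simp: mem_conjugate_set_iff subset_iff)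

text \<open>Conjugating by \<open>h\<close> only replaces the conjugator \<open>g\<close> by
  \<open>inv h \<otimes> g\<close>, so the conjugates of \<open>U\<close> are permuted among
  themselves and their intersection is normal.\<close>

lemma conj_twist:
  assumes "g \<in> carrier G" "x \<in> carrier G" "h \<in> carrier G"
  shows "inv g \<otimes> (h \<otimes> x \<otimes> inv h) \<otimes> g = inv (inv h \<otimes> g) \<otimes> x \<otimes> (inv h \<otimes> g)"
  using assms by (simp add: inv_mult_group m_assoc)

lemma core_normal:
  assumes U: "subgroup U G"
  shows "(\<Inter>g\<in>carrier G. conjugate_set G U g) \<lhd> G"
proof -
  let ?C = "\<Inter>g\<in>carrier G. conjugate_set G U g"
  have sub: "U \<subseteq> carrier G" using subgroup.subset[OF U] .
  have mem: "x \<in> ?C \<longleftrightarrow> x \<in> carrier G \<and> (\<forall>g\<in>carrier G. inv g \<otimes> x \<otimes> g \<in> U)" for x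
    using mem_conjugate_set_iff[OF sub] one_closed by auto
  have "subgroup ?C G"
  proof (rule subgroupI)
    show "?C \<subseteq> carrier G" using mem by blast
    show "?C \<noteq> {}" using mem[of \<one>] subgroup.one_closed[OF U] by auto
    fix a assume a: "a \<in> ?C"
    have "inv g \<otimes> inv a \<otimes> g \<in> U" if g: "g \<in> carrier G" for g
    proof -
      have "inv g \<otimes> inv a \<otimes> g = inv (inv g \<otimes> a \<otimes> g)"
        using a g mem by (simp add: inv_mult_group m_assoc)
      then show ?thesis using a g mem subgroup.m_inv_closed[OF U] by simp
    qed
    then show "inv a \<in> ?C" using a mem by simp
    fix b assume b: "b \<in> ?C"
    have "inv g \<otimes> (a \<otimes> b) \<otimes> g \<in> U" if g: "g \<in> carrier G" for g
    proof -
      have ab: "a \<in> carrier G" "b \<in> carrier G" using a b mem by auto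
      have "inv g \<otimes> (a \<otimes> b) \<otimes> g = (inv g \<otimes> a \<otimes> g) \<otimes> (inv g \<otimes> b \<otimes> g)"
        using ab g by (simp add: m_assoc) (simp add: m_assoc[symmetric])
      moreover have "inv g \<otimes> a \<otimes> g \<in> U" "inv g \<otimes> b \<otimes> g \<in> U" using a b mem g by blast+
      ultimately show ?thesis using subgroup.m_closed[OF U] by simp
    qed
    then show "a \<otimes> b \<in> ?C" using a b mem by simp
  qed
  moreover have "h \<otimes> x \<otimes> inv h \<in> ?C" if h: "h \<in> carrier G" and x: "x \<in> ?C" for h x
  proof -
    have xc: "x \<in> carrier G" using x mem by blast
    have "inv g \<otimes> (h \<otimes> x \<otimes> inv h) \<otimes> g \<in> U" if g: "g \<in> carrier G" for g
      unfolding conj_twist[OF g xc h] using x mem g h by blast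
    then show ?thesis unfolding mem using h xc by simp
  qed
  ultimately show ?thesis by (simp add: normal_inv_iff)
qed

lemma normal_generate_conjugates:
  assumes "U \<subseteq> carrier G"
  shows "generate G (\<Union>g\<in>carrier G. conjugate_set G U g) \<lhd> G"
proof (rule normal_generateI)
  show "(\<Union>g\<in>carrier G. conjugate_set G U g) \<subseteq> carrier G"
    using conjugate_set_subset[OF assms] by blast
  fix x h assume "x \<in> (\<Union>g\<in>carrier G. conjugate_set G U g)" and h: "h \<in> carrier G"
  then obtain g where g: "g \<in> carrier G" "x \<in> carrier G" "inv g \<otimes> x \<otimes> g \<in> U"
    using mem_conjugate_set_iff[OF assms] by blast
  have "inv (h \<otimes> g) \<otimes> (h \<otimes> x \<otimes> inv h) \<otimes> (h \<otimes> g) = inv g \<otimes> x \<otimes> g"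
    using g h by (simp add: inv_mult_group m_assoc) (simp add: m_assoc[symmetric])
  then have "h \<otimes> x \<otimes> inv h \<in> conjugate_set G U (h \<otimes> g)"
    using g h by (simp add: mem_conjugate_set_iff[OF assms])
  then show "h \<otimes> x \<otimes> inv h \<in> (\<Union>g\<in>carrier G. conjugate_set G U g)"
    using g h by (intro UN_I[of "h \<otimes> g"]) simp_all
qed

text \<open>The complement is the projection of a closed set along a compact factor, and such
  projections are closed. It turns a condition quantified over a compact set into an open
  one.\<close>

lemma openin_Collect_all_compact:
  assumes comp: "compact_space \<tau>"
    and f: "continuous_map (prod_topology \<tau> \<tau>) \<tau> f"
    and A: "closedin \<tau> A" and V: "openin \<tau> V"
  shows "openin \<tau> {g \<in> carrier G. \<forall>a\<in>A. f (g, a) \<in> V}"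
proof -
  let ?P = "prod_topology \<tau> \<tau>"
  let ?B = "{z \<in> topspace ?P. f z \<in> carrier G - V} \<inter> (carrier G \<times> A)"
  have cV: "closedin \<tau> (carrier G - V)" using V by (simp add: openin_closedin_eq)
  have "closedin ?P {z \<in> topspace ?P. f z \<in> carrier G - V}"
    by (rule closedin_continuous_map_preimage[OF f cV])
  moreover have "closedin \<tau> (carrier G)" using closedin_topspace[of \<tau>] by simp
  then have "closedin ?P (carrier G \<times> A)" using A by (simp add: closedin_prod_Times_iff)
  ultimately have "closedin ?P ?B" by (rule closedin_Int)
  then have "closedin \<tau> (fst ` ?B)"
    using Abstract_Topological_Spaces.closed_map_fst[OF comp, of \<tau>] unfolding closed_map_def by blast
  then have o: "openin \<tau> (topspace \<tau> - fst ` ?B)" by (rule openin_diff[OF openin_topspace])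
  have fc: "f z \<in> carrier G" if "z \<in> carrier G \<times> carrier G" for z
    using continuous_map_image_subset_topspace[OF f] that by auto
  have Ac: "A \<subseteq> carrier G" using closedin_subset[OF A] by simp
  have "g \<in> fst ` ?B \<longleftrightarrow> (\<exists>a\<in>A. f (g, a) \<notin> V)" if g: "g \<in> carrier G" for g
  proof
    assume "g \<in> fst ` ?B"
    then show "\<exists>a\<in>A. f (g, a) \<notin> V" by auto
  next
    assume "\<exists>a\<in>A. f (g, a) \<notin> V"
    then obtain a where a: "a \<in> A" "f (g, a) \<notin> V" by blast
    then have "(g, a) \<in> ?B" using Ac g fc[of "(g, a)"] by auto
    then show "g \<in> fst ` ?B" by (rule image_eqI[rotated]) simp
  qed
  then have "topspace \<tau> - fst ` ?B = {g \<in> carrier G. \<forall>a\<in>A. f (g, a) \<in> V}" by auto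
  then show ?thesis using o by (simp only:)
qed

text \<open>In a compact Hausdorff space components are quasi-components, so a clopen set
  \<open>A\<close> separates \<open>\<one>\<close> from some \<open>x\<close>. The left translations
  that map \<open>A\<close> onto itself form a subgroup, open by compactness, and \<open>x\<close>
  is not among them because \<open>x \<otimes> \<one>\<close> lies outside \<open>A\<close>.\<close>

lemma exists_proper_open_subgroup:
  assumes comp: "compact_space \<tau>" and T2: "Hausdorff_space \<tau>" and td: "totally_disconnected \<tau>"
    and nt: "carrier G \<noteq> {\<one>}"
  shows "\<exists>V. subgroup V G \<and> openin \<tau> V \<and> V \<noteq> carrier G"
proof -
  obtain x where x: "x \<in> carrier G" "x \<noteq> \<one>" using nt one_closed by blast
  have "\<not> connected_component_of \<tau> \<one> x"
    using td x unfolding connected_component_of_def totally_disconnected_def by blast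
  then have "\<not> quasi_component_of \<tau> \<one> x"
    using quasi_eq_connected_component_of[of \<tau> \<one>] comp T2 by auto
  then obtain A where A: "\<one> \<in> A" "closedin \<tau> A" "openin \<tau> A" "x \<notin> A"
    unfolding quasi_component_of using x by auto
  have Ac: "A \<subseteq> carrier G" using closedin_subset[OF A(2)] by simp
  define V where "V = {g \<in> carrier G. \<forall>a\<in>A. g \<otimes> a \<in> A} \<inter> {g \<in> carrier G. \<forall>a\<in>A. inv g \<otimes> a \<in> A}"
  have c1: "continuous_map (prod_topology \<tau> \<tau>) \<tau> fst" "continuous_map (prod_topology \<tau> \<tau>) \<tau> snd"
    by (simp_all add: continuous_map_fst continuous_map_snd)
  have "openin \<tau> {g \<in> carrier G. \<forall>a\<in>A. fst (g, a) \<otimes> snd (g, a) \<in> A}"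
    "openin \<tau> {g \<in> carrier G. \<forall>a\<in>A. inv (fst (g, a)) \<otimes> snd (g, a) \<in> A}"
    by (rule openin_Collect_all_compact[OF comp _ A(2,3)]; intro continuous_map_mult continuous_map_inv c1)+
  then have op: "openin \<tau> V" unfolding V_def by (simp add: openin_Int)
  have sub: "subgroup V G"
  proof (rule subgroupI)
    show "V \<subseteq> carrier G" by (auto simp: V_def)
    have "\<one> \<in> V" using Ac by (auto simp: V_def subset_iff)
    then show "V \<noteq> {}" by blast
    show "inv a \<in> V" if "a \<in> V" for a using that by (auto simp: V_def)
    fix a b assume ab: "a \<in> V" "b \<in> V"
    then have c: "a \<in> carrier G" "b \<in> carrier G" by (auto simp: V_def)
    have "a \<otimes> b \<otimes> y \<in> A" "inv (a \<otimes> b) \<otimes> y \<in> A" if "y \<in> A" for y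
    proof -
      have y: "y \<in> carrier G" using that Ac by blast
      have "a \<otimes> (b \<otimes> y) \<in> A" "inv b \<otimes> (inv a \<otimes> y) \<in> A" using ab that by (auto simp: V_def)
      then show "a \<otimes> b \<otimes> y \<in> A" "inv (a \<otimes> b) \<otimes> y \<in> A"
        using c y by (simp_all add: m_assoc inv_mult_group)
    qed
    then show "a \<otimes> b \<in> V" using c by (simp add: V_def)
  qed
  have "x \<notin> V"
  proof
    assume "x \<in> V"
    then have "x \<otimes> \<one> \<in> A" using A(1) by (auto simp: V_def)
    then show False using A(4) x(1) by simp
  qed
  then show ?thesis using op sub x(1) by blast
qed

text \<open>Membership in the core is a condition on all conjugators, and these form a compact
  set.\<close>

lemma openin_core_compact:
  assumes comp: "compact_space \<tau>" and V: "subgroup V G" "openin \<tau> V"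
  shows "openin \<tau> (\<Inter>g\<in>carrier G. conjugate_set G V g)"
proof -
  have c1: "continuous_map (prod_topology \<tau> \<tau>) \<tau> fst" "continuous_map (prod_topology \<tau> \<tau>) \<tau> snd"
    by (simp_all add: continuous_map_fst continuous_map_snd)
  have "openin \<tau> {x \<in> carrier G. \<forall>g\<in>topspace \<tau>. inv (snd (x, g)) \<otimes> fst (x, g) \<otimes> snd (x, g) \<in> V}"
    by (rule openin_Collect_all_compact[OF comp _ closedin_topspace V(2)];
        intro continuous_map_mult continuous_map_inv c1)
  moreover have "{x \<in> carrier G. \<forall>g\<in>topspace \<tau>. inv (snd (x, g)) \<otimes> fst (x, g) \<otimes> snd (x, g) \<in> V}
      = (\<Inter>g\<in>carrier G. conjugate_set G V g)"
    using mem_conjugate_set_iff[OF subgroup.subset[OF V(1)]] one_closed by auto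
  ultimately show ?thesis by simp
qed

end

lemma class_S_compact_open_subgroup:
  assumes S: "class_S H \<sigma>" and W: "compact_open_subgroup H \<sigma> W"
  shows "generate H (\<Union>g\<in>carrier H. conjugate_set H W g) = carrier H"
    and "(\<Inter>g\<in>carrier H. conjugate_set H W g) = {\<one>\<^bsub>H\<^esub>}"
proof -
  have tg: "topological_group H \<sigma>" and T2: "Hausdorff_space \<sigma>" and td: "totally_disconnected \<sigma>"
    and nd: "\<sigma> \<noteq> discrete_topology (carrier H)" and nt: "carrier H \<noteq> {\<one>\<^bsub>H\<^esub>}"
    and simp: "\<And>N. N \<lhd> H \<Longrightarrow> closedin \<sigma> N \<Longrightarrow> N = {\<one>\<^bsub>H\<^esub>} \<or> N = carrier H"
    using S by (auto simp: class_S_def tdlc_group_def topologically_simple_def)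
  interpret topological_grp H \<sigma>
    using tg by (simp add: topological_grp_def topological_grp_axioms_def topological_group_def)
  have sub: "subgroup W H" and cW: "compactin \<sigma> W" and oW: "openin \<sigma> W"
    using W by (auto simp: compact_open_subgroup_def)
  have Wc: "W \<subseteq> carrier H" using subgroup.subset[OF sub] .
  \<comment> \<open>Open subgroups are closed, and the trivial subgroup of a nondiscrete group is
    not open, so simplicity leaves only the whole group. This settles generation, because the normal
    closure of \<open>W\<close> contains the open set \<open>W\<close>.\<close>
  have open_normal: "N = carrier H" if N: "N \<lhd> H" "openin \<sigma> N" for N
  proof -
    have "N \<noteq> {\<one>\<^bsub>H\<^esub>}"
    proof
      assume "N = {\<one>\<^bsub>H\<^esub>}"
      then have "openin \<sigma> {\<one>\<^bsub>H\<^esub>}" using N(2) by (simp only:)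
      from discrete_if_one_open[OF this] nd show False by (rule notE[rotated])
    qed
    with simp[OF N(1) closedin_open_subgroup[OF normal_imp_subgroup[OF N(1)] N(2)]]
    show ?thesis by argo
  qed
  let ?N = "generate H (\<Union>g\<in>carrier H. conjugate_set H W g)"
  let ?C = "\<Inter>g\<in>carrier H. conjugate_set H W g"
  have "W \<subseteq> (\<Union>g\<in>carrier H. conjugate_set H W g)"
    using UN_upper[OF one_closed, of "conjugate_set H W"] unfolding conjugate_set_one[OF Wc] .
  then have WN: "W \<subseteq> ?N" by (rule subset_trans) (rule subsetI, rule generate.incl)
  have "\<one>\<^bsub>H\<^esub> \<in> W" using subgroup.one_closed[OF sub] .
  then have "W \<noteq> {}" by (metis empty_iff)
  then have "openin \<sigma> ?N"
    by (rule openin_superset_subgroup[OF normal_imp_subgroup[OF normal_generate_conjugates[OF Wc]] oW _ WN])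
  then show "?N = carrier H" by (rule open_normal[OF normal_generate_conjugates[OF Wc]])
  have "closedin \<sigma> (conjugate_set H W g)" if g: "g \<in> carrier H" for g
  proof -
    have c: "continuous_map \<sigma> \<sigma> (\<lambda>x. inv\<^bsub>H\<^esub> g \<otimes>\<^bsub>H\<^esub> x \<otimes>\<^bsub>H\<^esub> g)"
      by (intro continuous_group_ops inv_closed g)
    have "conjugate_set H W g = {x \<in> topspace \<sigma>. inv\<^bsub>H\<^esub> g \<otimes>\<^bsub>H\<^esub> x \<otimes>\<^bsub>H\<^esub> g \<in> W}"
      using mem_conjugate_set_iff[OF Wc g] by auto
    then show ?thesis
      using closedin_continuous_map_preimage[OF c closedin_open_subgroup[OF sub oW]] by simp
  qed
  then have "closedin \<sigma> ?C" using one_closed by (intro closedin_INT) blast+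
  then have "?C = {\<one>\<^bsub>H\<^esub>} \<or> ?C = carrier H" by (rule simp[OF core_normal[OF sub]])
  moreover have "?C \<noteq> carrier H"
  proof
    assume C: "?C = carrier H"
    have "?C \<subseteq> W"
      using INT_lower[OF one_closed, of "conjugate_set H W"] unfolding conjugate_set_one[OF Wc] .
    then have "W = carrier H" using Wc unfolding C by (rule subset_antisym[rotated])
    then have comp: "compact_space \<sigma>" using cW by (simp add: compact_space_def)
    obtain V where V: "subgroup V H" "openin \<sigma> V" "V \<noteq> carrier H"
      using exists_proper_open_subgroup[OF comp T2 td nt] by blast
    have Vc: "V \<subseteq> carrier H" using subgroup.subset[OF V(1)] .
    have "(\<Inter>g\<in>carrier H. conjugate_set H V g) = carrier H"
      by (rule open_normal[OF core_normal[OF V(1)] openin_core_compact[OF comp V(1,2)]])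
    moreover have "(\<Inter>g\<in>carrier H. conjugate_set H V g) \<subseteq> V"
      using INT_lower[OF one_closed, of "conjugate_set H V"] unfolding conjugate_set_one[OF Vc] .
    ultimately show False using Vc V(3) by simp
  qed
  ultimately show "?C = {\<one>\<^bsub>H\<^esub>}" by argo
qed

lemma topological_grpI: "topological_group G \<tau> \<Longrightarrow> topological_grp G \<tau>"
  by (simp add: topological_grp_def topological_grp_axioms_def topological_group_def)

text \<open>Lets membership in the class be proved for permutations of words and then be carried
  over to the universal group acting on the tree.\<close>

lemma class_S_iso:
  assumes iso: "topological_group_iso A \<alpha> B \<beta> f" and S: "class_S A \<alpha>"
    and tB: "topological_group B \<beta>"
  shows "class_S B \<beta>"
proof -
  have td: "totally_disconnected \<alpha>" and tA: "topological_group A \<alpha>" and T2: "Hausdorff_space \<alpha>"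
    and lc: "locally_compact_space \<alpha>" and nd: "\<alpha> \<noteq> discrete_topology (carrier A)"
    and cg: "compactly_generated A \<alpha>" and ts: "topologically_simple A \<alpha>"
    using S unfolding class_S_def tdlc_group_def by argo+
  interpret A: topological_grp A \<alpha> using tA by (rule topological_grpI)
  interpret B: topological_grp B \<beta> using tB by (rule topological_grpI)
  have fh: "f \<in> hom A B" and bij: "bij_betw f (carrier A) (carrier B)"
    and hm: "homeomorphic_map \<alpha> \<beta> f"
    using iso by (auto simp: topological_group_iso_def iso_def)
  interpret f: group_hom A B f
    by (simp add: group_hom_def group_hom_axioms_def fh A.is_group B.is_group)
  have inj: "inj_on f (carrier A)" and img: "f ` carrier A = carrier B"
    using bij by (auto simp: bij_betw_def)
  have hs: "\<alpha> homeomorphic_space \<beta>" using hm by (rule homeomorphic_map_imp_homeomorphic_space)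
  have pre: "f ` {a \<in> carrier A. f a \<in> N} = N" if "N \<subseteq> carrier B" for N
    using that img by (auto simp: image_iff subset_iff)
  have "Hausdorff_space \<beta>" using homeomorphic_Hausdorff_space[OF hs] T2 by simp
  moreover have "locally_compact_space \<beta>" using homeomorphic_locally_compact_space[OF hs] lc by simp
  moreover have "totally_disconnected \<beta>"
    unfolding totally_disconnected_def
  proof (intro allI impI)
    fix C assume C: "connectedin \<beta> C"
    then have Cc: "C \<subseteq> carrier B" using connectedin_subset_topspace by fastforce
    define D where "D = {a \<in> carrier A. f a \<in> C}"
    have fD: "f ` D = C" unfolding D_def by (rule pre[OF Cc])
    have "D \<subseteq> topspace \<alpha>" by (auto simp: D_def)
    then have "connectedin \<alpha> D"
      using homeomorphic_map_connectedness[OF hm, of D] C fD by simp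
    then obtain x where "D \<subseteq> {x}" using td unfolding totally_disconnected_def by blast
    then have "f ` D \<subseteq> {f x}" by blast
    then show "\<exists>x. C \<subseteq> {x}" unfolding fD by (rule exI)
  qed
  moreover have "\<beta> \<noteq> discrete_topology (carrier B)"
  proof
    assume d: "\<beta> = discrete_topology (carrier B)"
    have c: "continuous_map \<alpha> \<beta> f" using hm by (rule homeomorphic_imp_continuous_map)
    have "openin \<beta> {\<one>\<^bsub>B\<^esub>}" unfolding d by simp
    then have "openin \<alpha> {a \<in> topspace \<alpha>. f a \<in> {\<one>\<^bsub>B\<^esub>}}"
      by (rule openin_continuous_map_preimage[OF c])
    moreover have "{a \<in> topspace \<alpha>. f a \<in> {\<one>\<^bsub>B\<^esub>}} = {\<one>\<^bsub>A\<^esub>}"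
    proof -
      have "a = \<one>\<^bsub>A\<^esub>" if "a \<in> carrier A" "f a = \<one>\<^bsub>B\<^esub>" for a
        using inj_onD[OF inj _ that(1) A.one_closed] that(2) by simp
      then show ?thesis by auto
    qed
    ultimately have "openin \<alpha> {\<one>\<^bsub>A\<^esub>}" by simp
    from A.discrete_if_one_open[OF this] nd show False by (rule notE[rotated])
  qed
  moreover have "compactly_generated B \<beta>"
  proof -
    obtain C where C: "compactin \<alpha> C" "generate A C = carrier A"
      using cg by (auto simp: compactly_generated_def)
    have Cc: "C \<subseteq> carrier A" using compactin_subset_topspace[OF C(1)] by simp
    have "compactin \<beta> (f ` C)"
      by (rule image_compactin[OF C(1) homeomorphic_imp_continuous_map[OF hm]])
    moreover have "generate B (f ` C) = carrier B"
      using f.generate_img[OF Cc] C(2) img by simp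
    ultimately show ?thesis unfolding compactly_generated_def by blast
  qed
  moreover have "topologically_simple B \<beta>"
    unfolding topologically_simple_def
  proof (intro conjI allI impI)
    show "carrier B \<noteq> {\<one>\<^bsub>B\<^esub>}"
    proof
      assume b: "carrier B = {\<one>\<^bsub>B\<^esub>}"
      have "a = \<one>\<^bsub>A\<^esub>" if a: "a \<in> carrier A" for a
      proof -
        have "f a \<in> carrier B" using a img by blast
        then have "f a = f \<one>\<^bsub>A\<^esub>" using b by simp
        then show ?thesis using inj_onD[OF inj _ a A.one_closed] by blast
      qed
      then have "carrier A = {\<one>\<^bsub>A\<^esub>}" using A.one_closed by blast
      then show False using ts by (simp add: topologically_simple_def)
    qed
    fix N assume N: "N \<lhd> B \<and> closedin \<beta> N"
    then have Nn: "N \<lhd> B" and Nc: "closedin \<beta> N" by auto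
    have sN: "subgroup N B" by (rule normal_imp_subgroup[OF Nn])
    have Ns: "N \<subseteq> carrier B" using subgroup.subset[OF sN] .
    define M where "M = {a \<in> carrier A. f a \<in> N}"
    have fM: "f ` M = N" unfolding M_def by (rule pre[OF Ns])
    have "subgroup M A"
    proof (rule A.subgroupI)
      have "\<one>\<^bsub>A\<^esub> \<in> M" using subgroup.one_closed[OF sN] by (simp add: M_def)
      then show "M \<noteq> {}" by (metis empty_iff)
      show "inv\<^bsub>A\<^esub> a \<in> M" if "a \<in> M" for a
        using that subgroup.m_inv_closed[OF sN] by (simp add: M_def)
      show "a \<otimes>\<^bsub>A\<^esub> b \<in> M" if "a \<in> M" "b \<in> M" for a b
        using that subgroup.m_closed[OF sN] by (simp add: M_def)
    qed (simp add: M_def)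
    moreover have "x \<otimes>\<^bsub>A\<^esub> h \<otimes>\<^bsub>A\<^esub> inv\<^bsub>A\<^esub> x \<in> M" if "x \<in> carrier A" "h \<in> M" for x h
      using that B.normal_invE(2)[OF Nn, of "f x" "f h"] by (simp add: M_def)
    ultimately have "M \<lhd> A" by (simp add: A.normal_inv_iff)
    moreover have "closedin \<alpha> M"
      using homeomorphic_map_closedness[OF hm, of M] Nc fM by (simp add: M_def)
    ultimately have "M = {\<one>\<^bsub>A\<^esub>} \<or> M = carrier A"
      using ts by (simp add: topologically_simple_def)
    then show "N = {\<one>\<^bsub>B\<^esub>} \<or> N = carrier B"
      unfolding fM[symmetric] using img by auto
  qed
  ultimately show ?thesis
    unfolding class_S_def tdlc_group_def using tB by argo
qed

text \<open>Multiplying \<open>a\<close> on the right by the inverse of \<open>s (\<rho> a)\<close>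
  lands in the kernel, so \<open>a\<close> is a kernel element times \<open>s (\<rho> a)\<close>.
  Both directions of this decomposition are continuous, and \<open>H\<close> acts on the kernel by
  conjugation through \<open>s\<close>.\<close>

lemma splits_as_semidirect_productI:
  assumes tA: "topological_group A \<alpha>" and tH: "topological_group H \<sigma>"
    and rho: "\<rho> \<in> hom A H" "continuous_map \<alpha> \<sigma> \<rho>"
    and s: "s \<in> hom H A" "continuous_map \<sigma> \<alpha> s"
    and rs: "\<And>h. h \<in> carrier H \<Longrightarrow> \<rho> (s h) = h"
    and K: "K = {a \<in> carrier A. \<rho> a = \<one>\<^bsub>H\<^esub>}"
  shows "splits_as_semidirect_product A \<alpha> K H \<sigma>"
proof -
  interpret A: topological_grp A \<alpha> using tA by (rule topological_grpI)
  interpret H: topological_grp H \<sigma> using tH by (rule topological_grpI)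
  interpret r: group_hom A H \<rho>
    by (simp add: group_hom_def group_hom_axioms_def rho A.is_group H.is_group)
  interpret s: group_hom H A s
    by (simp add: group_hom_def group_hom_axioms_def s A.is_group H.is_group)
  \<comment> \<open>The restriction makes \<open>\<theta> h\<close> extensional on \<open>K\<close>,
    as members of \<open>AutoGroup\<close> have to be.\<close>
  define \<theta> where "\<theta> = (\<lambda>h. \<lambda>k\<in>K. s h \<otimes>\<^bsub>A\<^esub> k \<otimes>\<^bsub>A\<^esub> inv\<^bsub>A\<^esub> (s h))"
  define f where "f = (\<lambda>a. (a \<otimes>\<^bsub>A\<^esub> inv\<^bsub>A\<^esub> (s (\<rho> a)), \<rho> a))"
  let ?K = "A\<lparr>carrier := K\<rparr>"
  have Kc: "k \<in> carrier A" and Kr: "\<rho> k = \<one>\<^bsub>H\<^esub>" if "k \<in> K" for k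
    using that K by auto
  have KI: "a \<in> carrier A \<Longrightarrow> \<rho> a = \<one>\<^bsub>H\<^esub> \<Longrightarrow> a \<in> K" for a using K by simp
  have thK: "s h \<otimes>\<^bsub>A\<^esub> k \<otimes>\<^bsub>A\<^esub> inv\<^bsub>A\<^esub> (s h) \<in> K" if "h \<in> carrier H" "k \<in> K" for h k
    using that Kc Kr rs by (intro KI) simp_all
  have mK: "k \<otimes>\<^bsub>A\<^esub> l \<in> K" if "k \<in> K" "l \<in> K" for k l
    using that Kc Kr by (intro KI) simp_all
  have th: "\<theta> h k = s h \<otimes>\<^bsub>A\<^esub> k \<otimes>\<^bsub>A\<^esub> inv\<^bsub>A\<^esub> (s h)" if "k \<in> K" for h k
    using that by (simp add: \<theta>_def)
  have th_mult: "\<theta> (h \<otimes>\<^bsub>H\<^esub> h') k = \<theta> h (\<theta> h' k)"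
    if "h \<in> carrier H" "h' \<in> carrier H" "k \<in> K" for h h' k
    using that Kc thK by (simp add: th A.inv_mult_group A.m_assoc)
  have th_one: "\<theta> \<one>\<^bsub>H\<^esub> k = k" if "k \<in> K" for k
    using that Kc by (simp add: th)
  have th_Bij: "\<theta> h \<in> Bij K" if h: "h \<in> carrier H" for h
  proof (rule BijI[where f' = "\<theta> (inv\<^bsub>H\<^esub> h)"])
    show "\<theta> h \<in> extensional K" by (simp add: \<theta>_def)
    fix k assume k: "k \<in> K"
    show "\<theta> h k \<in> K" "\<theta> (inv\<^bsub>H\<^esub> h) k \<in> K" using k h thK by (simp_all only: th H.inv_closed)
    show "\<theta> (inv\<^bsub>H\<^esub> h) (\<theta> h k) = k"
      using th_mult[OF H.inv_closed[OF h] h k] th_one[OF k] h by simp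
    show "\<theta> h (\<theta> (inv\<^bsub>H\<^esub> h) k) = k"
      using th_mult[OF h H.inv_closed[OF h] k] th_one[OF k] h by simp
  qed
  have th_auto: "\<theta> h \<in> auto ?K" if h: "h \<in> carrier H" for h
  proof -
    have "\<theta> h (k \<otimes>\<^bsub>A\<^esub> l) = \<theta> h k \<otimes>\<^bsub>A\<^esub> \<theta> h l" if "k \<in> K" "l \<in> K" for k l
      using that h mK Kc by (simp add: th A.m_assoc) (simp add: A.m_assoc[symmetric])
    then show ?thesis
      using th_Bij[OF h] thK h by (auto simp: auto_def hom_def th)
  qed
  have hom: "\<theta> \<in> hom H (AutoGroup ?K)"
  proof (rule homI)
    show "\<theta> h \<in> carrier (AutoGroup ?K)" if "h \<in> carrier H" for h
      using th_auto[OF that] by (simp add: AutoGroup_def)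
    fix h h' assume hh: "h \<in> carrier H" "h' \<in> carrier H"
    have "\<theta> (h \<otimes>\<^bsub>H\<^esub> h') = \<theta> h \<otimes>\<^bsub>BijGroup K\<^esub> \<theta> h'"
    proof (rule Bij_ext)
      show "\<theta> (h \<otimes>\<^bsub>H\<^esub> h') \<in> Bij K" by (rule th_Bij) (simp add: hh)
      show "\<theta> h \<otimes>\<^bsub>BijGroup K\<^esub> \<theta> h' \<in> Bij K"
        using th_Bij hh by (simp add: mult_BijGroup compose_Bij)
      show "\<theta> (h \<otimes>\<^bsub>H\<^esub> h') k = (\<theta> h \<otimes>\<^bsub>BijGroup K\<^esub> \<theta> h') k" if "k \<in> K" for k
        using th_Bij hh that by (simp add: mult_BijGroup_apply th_mult)
    qed
    then show "\<theta> (h \<otimes>\<^bsub>H\<^esub> h') = \<theta> h \<otimes>\<^bsub>AutoGroup ?K\<^esub> \<theta> h'"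
      by (simp add: AutoGroup_def)
  qed
  have tK: "topspace (subtopology \<alpha> K) = K" using Kc by (auto simp: topspace_subtopology)
  have sub_id: "continuous_map (subtopology \<alpha> K) \<alpha> (\<lambda>x. x)"
    using continuous_map_from_subtopology[OF A.continuous_map_id'] .
  let ?P = "prod_topology \<sigma> (subtopology \<alpha> K)"
  have f1: "continuous_map ?P \<sigma> fst" by (simp add: continuous_map_fst)
  have f2: "continuous_map ?P \<alpha> snd"
    using continuous_map_compose[OF continuous_map_snd sub_id] by (simp add: o_def)
  have sf: "continuous_map ?P \<alpha> (\<lambda>z. s (fst z))"
    using continuous_map_compose[OF f1 s(2)] by (simp add: o_def)
  have "continuous_map ?P \<alpha> (\<lambda>z. s (fst z) \<otimes>\<^bsub>A\<^esub> snd z \<otimes>\<^bsub>A\<^esub> inv\<^bsub>A\<^esub> (s (fst z)))"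
    by (intro A.continuous_map_mult A.continuous_map_inv sf f2)
  then have "continuous_map ?P \<alpha> (\<lambda>(h, k). \<theta> h k)"
    by (rule continuous_map_eq) (auto simp: tK th)
  then have cont: "continuous_map ?P (subtopology \<alpha> K) (\<lambda>(h, k). \<theta> h k)"
    unfolding continuous_map_in_subtopology using thK by (auto simp: tK th)
  have act: "continuous_automorphic_action H \<sigma> ?K (subtopology \<alpha> K) \<theta>"
    unfolding continuous_automorphic_action_def using hom cont by simp
  let ?S = "semidirect_product ?K H \<theta>"
  let ?g = "\<lambda>(k, h). k \<otimes>\<^bsub>A\<^esub> s h"
  have fK: "a \<otimes>\<^bsub>A\<^esub> inv\<^bsub>A\<^esub> (s (\<rho> a)) \<in> K" if "a \<in> carrier A" for a
    using that rs by (intro KI) simp_all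
  have gf: "?g (f a) = a" if "a \<in> carrier A" for a
    using that by (simp add: f_def A.m_assoc)
  have fg: "f (?g z) = z" if "z \<in> K \<times> carrier H" for z
    using that Kc Kr rs by (auto simp: f_def A.m_assoc)
  have fhom: "f \<in> hom A ?S"
  proof (rule homI)
    show "f a \<in> carrier ?S" if "a \<in> carrier A" for a
      using that fK by (simp add: f_def semidirect_product_def)
    fix a b assume ab: "a \<in> carrier A" "b \<in> carrier A"
    then show "f (a \<otimes>\<^bsub>A\<^esub> b) = f a \<otimes>\<^bsub>?S\<^esub> f b"
      using fK[OF ab(2)]
      by (simp add: f_def semidirect_product_def th A.inv_mult_group A.m_assoc)
        (simp add: A.m_assoc[symmetric])
  qed
  have fbij: "bij_betw f (carrier A) (carrier ?S)"
    by (rule bij_betwI[where g = ?g])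
      (use hom_in_carrier[OF fhom] gf fg Kc in \<open>auto simp: semidirect_product_def Pi_def\<close>)
  have "continuous_map \<alpha> \<alpha> (\<lambda>a. s (\<rho> a))"
    using continuous_map_compose[OF rho(2) s(2)] by (simp add: o_def)
  then have "continuous_map \<alpha> \<alpha> (\<lambda>a. a \<otimes>\<^bsub>A\<^esub> inv\<^bsub>A\<^esub> (s (\<rho> a)))"
    by (intro A.continuous_map_mult A.continuous_map_inv A.continuous_map_id')
  then have "continuous_map \<alpha> (subtopology \<alpha> K) (\<lambda>a. a \<otimes>\<^bsub>A\<^esub> inv\<^bsub>A\<^esub> (s (\<rho> a)))"
    unfolding continuous_map_in_subtopology using fK by auto
  then have cf: "continuous_map \<alpha> (prod_topology (subtopology \<alpha> K) \<sigma>) f"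
    unfolding f_def using rho(2) by (rule continuous_map_pairedI)
  let ?Q = "prod_topology (subtopology \<alpha> K) \<sigma>"
  have q1: "continuous_map ?Q \<alpha> fst"
    using continuous_map_compose[OF continuous_map_fst sub_id] by (simp add: o_def)
  have q2: "continuous_map ?Q \<alpha> (\<lambda>z. s (snd z))"
    using continuous_map_compose[OF continuous_map_snd s(2)] by (simp add: o_def)
  have "continuous_map ?Q \<alpha> (\<lambda>z. fst z \<otimes>\<^bsub>A\<^esub> s (snd z))"
    by (intro A.continuous_map_mult q1 q2)
  then have cg: "continuous_map ?Q \<alpha> ?g"
    by (simp add: case_prod_unfold)
  have "homeomorphic_maps \<alpha> ?Q f ?g"
    unfolding homeomorphic_maps_def using cf cg gf fg tK by simp
  then have hm: "homeomorphic_map \<alpha> ?Q f" by (rule homeomorphic_maps_imp_map)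
  have "\<forall>k\<in>K. f k = (k, \<one>\<^bsub>H\<^esub>)" using Kc Kr by (simp add: f_def)
  then show ?thesis
    unfolding splits_as_semidirect_product_def topological_group_iso_def iso_def
    using act fhom fbij hm by blast
qed

section \<open>Representation on cosets of a compact open subgroup\<close>

lemma finite_image_compactin:
  assumes K: "compactin X K" and f: "\<And>x. x \<in> K \<Longrightarrow> openin X {y \<in> topspace X. f y = f x}"
  shows "finite (f ` K)"
proof -
  define W where "W = (\<lambda>v. {y \<in> topspace X. f y = v})"
  have Kt: "K \<subseteq> topspace X" using compactin_subset_topspace[OF K] .
  have "\<forall>T\<in>W ` f ` K. openin X T" using f by (auto simp: W_def)
  moreover have "K \<subseteq> \<Union> (W ` f ` K)" using Kt by (auto simp: W_def)
  ultimately obtain \<F> where F: "finite \<F>" "\<F> \<subseteq> W ` f ` K" "K \<subseteq> \<Union> \<F>"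
    using K unfolding compactin_def by meson
  obtain C where C: "C \<subseteq> f ` K" "finite C" "\<F> = W ` C"
    using finite_subset_image[OF F(1,2)] by blast
  have "f ` K \<subseteq> C" using F(3) unfolding C(3) by (auto simp: W_def)
  then show ?thesis using C(2) finite_subset by blast
qed

context topological_grp begin

section \<open>The coset space of a compact open subgroup\<close>

lemma l_coset_eq_iff:
  assumes U: "subgroup U G" and gh: "g \<in> carrier G" "h \<in> carrier G"
  shows "g <# U = h <# U \<longleftrightarrow> inv g \<otimes> h \<in> U"
proof -
  have sub: "U \<subseteq> carrier G" using subgroup.subset[OF U] .
  show ?thesis
  proof
    assume eq: "g <# U = h <# U"
    have "h \<in> h <# U" using subgroup.one_closed[OF U] gh unfolding l_coset_def by force
    then show "inv g \<otimes> h \<in> U" unfolding eq[symmetric] l_coset_eq_preimage[OF gh(1) sub] by simp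
  next
    assume u: "inv g \<otimes> h \<in> U"
    have "inv h \<otimes> x \<in> U \<longleftrightarrow> inv g \<otimes> x \<in> U" if x: "x \<in> carrier G" for x
    proof
      assume "inv h \<otimes> x \<in> U"
      then have "(inv g \<otimes> h) \<otimes> (inv h \<otimes> x) \<in> U" using u subgroup.m_closed[OF U] by blast
      moreover have "(inv g \<otimes> h) \<otimes> (inv h \<otimes> x) = inv g \<otimes> x"
        using gh x by (simp add: m_assoc) (simp add: m_assoc[symmetric])
      ultimately show "inv g \<otimes> x \<in> U" by simp
    next
      assume "inv g \<otimes> x \<in> U"
      then have "inv (inv g \<otimes> h) \<otimes> (inv g \<otimes> x) \<in> U"
        using subgroup.m_inv_closed[OF U u] subgroup.m_closed[OF U] by blast
      moreover have "inv (inv g \<otimes> h) \<otimes> (inv g \<otimes> x) = inv h \<otimes> x"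
        using gh x by (simp add: m_assoc inv_mult_group) (simp add: m_assoc[symmetric])
      ultimately show "inv h \<otimes> x \<in> U" by simp
    qed
    then show "g <# U = h <# U"
      unfolding l_coset_eq_preimage[OF gh(1) sub] l_coset_eq_preimage[OF gh(2) sub] by blast
  qed
qed

text \<open>The product of a multiplier and a fixed coset depends locally constantly on the
  multiplier, so a compact set of multipliers produces finitely many cosets from one. Starting from
  \<open>U\<close>, every coset is reached in finitely many such steps. Countability is what allows
  cosets to be coded by natural numbers.\<close>

lemma countable_l_cosets:
  assumes cg: "compactly_generated G \<tau>" and U: "subgroup U G" "openin \<tau> U"
  shows "countable ((\<lambda>g. g <# U) ` carrier G)"
proof -
  obtain C where C: "compactin \<tau> C" "generate G C = carrier G"
    using cg by (auto simp: compactly_generated_def)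
  have Cc: "C \<subseteq> carrier G" using compactin_subset_topspace[OF C(1)] by simp
  have sub: "U \<subseteq> carrier G" using subgroup.subset[OF U(1)] .
  \<comment> \<open>\<open>generate\<close> also admits inverses of generators, so the set of
    multipliers is made symmetric.\<close>
  define D where "D = C \<union> (\<lambda>x. inv x) ` C"
  have "compactin \<tau> ((\<lambda>x. inv x) ` C)"
    by (rule image_compactin[OF C(1)]) (intro continuous_group_ops)
  then have D: "compactin \<tau> D" unfolding D_def using C(1) by (simp add: compactin_Un)
  have Dc: "D \<subseteq> carrier G" using compactin_subset_topspace[OF D] by simp
  define step where "step = (\<lambda>\<Q>. \<Union>q\<in>\<Q>. (\<lambda>c. c <# q) ` D)"
  define E where "E = (\<lambda>n. (step ^^ n) {U})"
  have E_Suc: "E (Suc n) = step (E n)" for n by (simp add: E_def)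
  have fin: "finite ((\<lambda>c. c <# (g <# U)) ` D)" if g: "g \<in> carrier G" for g
  proof (rule finite_image_compactin[OF D])
    fix c assume "c \<in> D"
    then have c: "c \<in> carrier G" using Dc by blast
    have "y <# (g <# U) = c <# (g <# U) \<longleftrightarrow> inv (c \<otimes> g) \<otimes> (y \<otimes> g) \<in> U" if "y \<in> carrier G" for y
      using l_coset_eq_iff[OF U(1), of "c \<otimes> g" "y \<otimes> g"] that c g sub
      by (auto simp: lcos_m_assoc[symmetric])
    then have "{y \<in> topspace \<tau>. y <# (g <# U) = c <# (g <# U)}
        = {y \<in> carrier G. inv (c \<otimes> g) \<otimes> (y \<otimes> g) \<in> U}" by auto
    moreover have "openin \<tau> {y \<in> carrier G. inv (c \<otimes> g) \<otimes> (y \<otimes> g) \<in> U}"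
      by (rule openin_preimage[OF _ U(2)], intro continuous_group_ops) (use c g in simp_all)
    ultimately show "openin \<tau> {y \<in> topspace \<tau>. y <# (g <# U) = c <# (g <# U)}" by simp
  qed
  have E: "finite (E n) \<and> E n \<subseteq> (\<lambda>g. g <# U) ` carrier G" for n
  proof (induction n)
    case 0
    have "U = \<one> <# U" using sub by (simp add: lcos_mult_one)
    then show ?case by (auto simp: E_def)
  next
    case (Suc n)
    have "finite (step (E n))"
      unfolding step_def using Suc fin by (intro finite_UN_I) (blast, auto)
    moreover have "c <# q \<in> (\<lambda>g. g <# U) ` carrier G" if "c \<in> D" "q \<in> E n" for c q
    proof -
      have "q \<in> (\<lambda>g. g <# U) ` carrier G" using Suc \<open>q \<in> E n\<close> by blast
      then obtain g where g: "g \<in> carrier G" "q = g <# U" by blast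
      have "c \<in> carrier G" using that Dc by blast
      then have "c <# q = (c \<otimes> g) <# U" using g sub by (simp add: lcos_m_assoc)
      then show ?thesis using \<open>c \<in> carrier G\<close> g by blast
    qed
    ultimately show ?case unfolding E_Suc step_def by blast
  qed
  have stepE: "c <# q \<in> (\<Union>n. E n)" if "c \<in> D" "q \<in> (\<Union>n. E n)" for c q
  proof -
    from that(2) obtain n where "q \<in> E n" by blast
    then have "c <# q \<in> E (Suc n)" unfolding E_Suc step_def using that(1) by blast
    then show ?thesis by blast
  qed
  have qc: "q \<subseteq> carrier G" if "q \<in> (\<Union>n. E n)" for q
    using that E l_coset_subset_G[OF sub] by blast
  have "\<forall>q\<in>(\<Union>n. E n). x <# q \<in> (\<Union>n. E n)" if "x \<in> generate G C" for x
    using that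
  proof induction
    case one
    show ?case using qc lcos_mult_one by simp
  next
    case (incl h)
    show ?case using stepE[of h] incl by (simp add: D_def)
  next
    case (inv h)
    show ?case using stepE[of "inv h"] inv by (simp add: D_def)
  next
    case (eng h1 h2)
    have h: "h1 \<in> carrier G" "h2 \<in> carrier G" using eng.hyps C(2) by auto
    show ?case
    proof
      fix q assume q: "q \<in> (\<Union>n. E n)"
      have "h1 \<otimes> h2 <# q = h1 <# (h2 <# q)" using lcos_m_assoc[OF qc[OF q] h] by simp
      moreover have "h1 <# (h2 <# q) \<in> (\<Union>n. E n)"
        by (rule bspec[OF eng.IH(1)], rule bspec[OF eng.IH(2)], rule q)
      ultimately show "h1 \<otimes> h2 <# q \<in> (\<Union>n. E n)" by (simp only:)
    qed
  qed
  moreover have "U \<in> (\<Union>n. E n)" by (rule UN_I[of 0]) (simp_all add: E_def)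
  ultimately have "(\<lambda>g. g <# U) ` carrier G \<subseteq> (\<Union>n. E n)" using C(2) by blast
  moreover have "countable (\<Union>n. E n)" using E by (intro countable_UN) (auto intro: countable_finite)
  ultimately show ?thesis by (rule countable_subset)
qed

text \<open>The part of \<open>U\<close> outside \<open>V\<close> is compact. Triviality of the core
  means that the complements of the conjugates of \<open>U\<close> cover it, and these are open, so
  finitely many suffice. A neighbourhood of the identity thus becomes a condition at finitely many
  points of the coset space.\<close>

lemma finite_core_nbhd:
  assumes U: "subgroup U G" "compactin \<tau> U" "openin \<tau> U"
    and core: "(\<Inter>g\<in>carrier G. conjugate_set G U g) = {\<one>}"
    and V: "openin \<tau> V" "\<one> \<in> V"
  obtains F where "finite F" "F \<subseteq> carrier G"
    "\<forall>x\<in>carrier G. (\<forall>h\<in>F. inv h \<otimes> x \<otimes> h \<in> U) \<longrightarrow> x \<in> V"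
proof -
  have sub: "U \<subseteq> carrier G" using subgroup.subset[OF U(1)] .
  define N where "N = (\<lambda>h. {x \<in> carrier G. inv h \<otimes> x \<otimes> h \<in> carrier G - U})"
  have oN: "openin \<tau> (N h)" if "h \<in> carrier G" for h
    unfolding N_def
  proof (rule openin_preimage)
    show "continuous_map \<tau> \<tau> (\<lambda>x. inv h \<otimes> x \<otimes> h)"
      by (intro continuous_group_ops) (use that in simp_all)
    show "openin \<tau> (carrier G - U)"
      using closedin_open_subgroup[OF U(1,3)] by (simp add: closedin_def)
  qed
  have "closedin \<tau> (carrier G - V)" using V(1) by (simp add: openin_closedin_eq)
  then have "compactin \<tau> ((carrier G - V) \<inter> U)" using U(2) by (rule closed_Int_compactin)
  moreover have "\<forall>T\<in>N ` carrier G. openin \<tau> T" using oN by blast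
  moreover have "(carrier G - V) \<inter> U \<subseteq> \<Union> (N ` carrier G)"
  proof
    fix x assume x: "x \<in> (carrier G - V) \<inter> U"
    then have "x \<notin> (\<Inter>g\<in>carrier G. conjugate_set G U g)" using V(2) core by auto
    then obtain g where g: "g \<in> carrier G" "x \<notin> conjugate_set G U g" by blast
    have "x \<in> N g" using g(2) x g(1) unfolding mem_conjugate_set_iff[OF sub g(1)] N_def by auto
    then show "x \<in> \<Union> (N ` carrier G)" using g(1) by blast
  qed
  ultimately obtain \<F> where F: "finite \<F>" "\<F> \<subseteq> N ` carrier G" "(carrier G - V) \<inter> U \<subseteq> \<Union> \<F>"
    unfolding compactin_def by meson
  obtain F where F': "F \<subseteq> carrier G" "finite F" "\<F> = N ` F"
    using finite_subset_image[OF F(1,2)] by blast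
  show thesis
  \<comment> \<open>The conjugator \<open>\<one>\<close> forces \<open>x\<close> into
    \<open>U\<close>, the set whose part outside \<open>V\<close> was covered.\<close>
  proof (rule that[of "insert \<one> F"])
    show "finite (insert \<one> F)" "insert \<one> F \<subseteq> carrier G" using F' by auto
    have "x \<in> V" if x: "x \<in> carrier G" and *: "\<forall>h\<in>insert \<one> F. inv h \<otimes> x \<otimes> h \<in> U" for x
    proof -
      have "x \<in> U" using bspec[OF *, of \<one>] x by simp
      moreover have "x \<notin> N h" if "h \<in> F" for h using bspec[OF *, of h] that by (simp add: N_def)
      ultimately show "x \<in> V" using F(3) x unfolding F'(3) by blast
    qed
    then show "\<forall>x\<in>carrier G. (\<forall>h\<in>insert \<one> F. inv h \<otimes> x \<otimes> h \<in> U) \<longrightarrow> x \<in> V" by blast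
  qed
qed

theorem coset_representation:
  assumes U: "subgroup U G" "compactin \<tau> U" "openin \<tau> U"
    and cg: "compactly_generated G \<tau>" and T2: "Hausdorff_space \<tau>" and nt: "carrier G \<noteq> {\<one>}"
    and gen: "generate G (\<Union>g\<in>carrier G. conjugate_set G U g) = carrier G"
    and core: "(\<Inter>g\<in>carrier G. conjugate_set G U g) = {\<one>}"
  obtains X :: "nat set" and P \<phi> where
    "subgroup P (BijGroup X)" "closedin (perm_topology X) P"
    "\<And>x y. x \<in> X \<Longrightarrow> y \<in> X \<Longrightarrow> \<exists>p\<in>P. p x = y"
    "\<And>x. x \<in> X \<Longrightarrow> compactin (perm_topology X) {p \<in> P. p x = x}"
    "generate (BijGroup X) (\<Union>x\<in>X. {p \<in> P. p x = x}) = P"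
    "\<exists>x\<in>X. \<exists>p\<in>P. p x = x \<and> p \<noteq> \<one>\<^bsub>BijGroup X\<^esub>"
    "\<exists>C. compactin (perm_topology X) C \<and> generate (BijGroup X) C = P"
    "topological_group_iso G \<tau> (BijGroup X\<lparr>carrier := P\<rparr>) (subtopology (perm_topology X) P) \<phi>"
    "\<And>x. x \<in> X \<Longrightarrow> fst (prod_decode x) = i"
proof -
  have sub: "U \<subseteq> carrier G" using subgroup.subset[OF U(1)] .
  define Q where "Q = (\<lambda>g. g <# U) ` carrier G"
  have cQ: "countable Q" unfolding Q_def by (rule countable_l_cosets[OF cg U(1,3)])
  \<comment> \<open>The first component of the code is the tag \<open>i\<close>, so the point sets
    of different indices are disjoint and the type of a letter can be read off from it.\<close>
  define c where "c = (\<lambda>g. prod_encode (i, to_nat_on Q (g <# U)))"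
  have c_eq: "c g = c h \<longleftrightarrow> inv g \<otimes> h \<in> U" if "g \<in> carrier G" "h \<in> carrier G" for g h
    unfolding c_def l_coset_eq_iff[OF U(1) that, symmetric]
    using inj_on_to_nat_on[OF cQ] that by (auto simp: Q_def dest: inj_onD)
  define X where "X = c ` carrier G"
  define rep where "rep = inv_into (carrier G) c"
  define \<phi> where "\<phi> = (\<lambda>g. \<lambda>x\<in>X. c (g \<otimes> rep x))"
  have c_X: "c h \<in> X" if "h \<in> carrier G" for h using that by (simp add: X_def)
  have c_mult: "c (g \<otimes> h) = c (g \<otimes> k) \<longleftrightarrow> c h = c k"
    if "g \<in> carrier G" "h \<in> carrier G" "k \<in> carrier G" for g h k
  proof -
    have "inv (g \<otimes> h) \<otimes> (g \<otimes> k) = inv h \<otimes> k"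
      using that by (simp add: inv_mult_group m_assoc) (simp add: m_assoc[symmetric])
    then show ?thesis using that by (simp add: c_eq)
  qed
  have phi: "\<phi> g (c h) = c (g \<otimes> h)" if "g \<in> carrier G" "h \<in> carrier G" for g h
  proof -
    have "c h \<in> c ` carrier G" using that by blast
    then have "rep (c h) \<in> carrier G" "c (rep (c h)) = c h"
      unfolding rep_def by (rule inv_into_into, rule f_inv_into_f)
    then show ?thesis using that c_X by (simp add: \<phi>_def c_mult)
  qed
  have Xc: "\<exists>h\<in>carrier G. x = c h" if "x \<in> X" for x using that by (auto simp: X_def)
  have phi_Bij: "\<phi> g \<in> Bij X" if g: "g \<in> carrier G" for g
  proof (rule BijI[where f' = "\<phi> (inv g)"])
    show "\<phi> g \<in> extensional X" by (simp add: \<phi>_def)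
    fix x assume "x \<in> X"
    then obtain h where h: "h \<in> carrier G" "x = c h" using Xc by blast
    show "\<phi> g x \<in> X" "\<phi> (inv g) x \<in> X" "\<phi> (inv g) (\<phi> g x) = x" "\<phi> g (\<phi> (inv g) x) = x"
      using g h by (simp_all add: phi c_X m_assoc[symmetric])
  qed
  have phi_hom: "\<phi> \<in> hom G (BijGroup X)"
  proof (rule homI)
    show "\<phi> g \<in> carrier (BijGroup X)" if "g \<in> carrier G" for g using phi_Bij[OF that] by simp
    fix g h assume gh: "g \<in> carrier G" "h \<in> carrier G"
    show "\<phi> (g \<otimes> h) = \<phi> g \<otimes>\<^bsub>BijGroup X\<^esub> \<phi> h"
    proof (rule Bij_ext)
      show "\<phi> (g \<otimes> h) \<in> Bij X" by (rule phi_Bij) (simp add: gh)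
      show "\<phi> g \<otimes>\<^bsub>BijGroup X\<^esub> \<phi> h \<in> Bij X"
        using phi_Bij gh by (simp add: mult_BijGroup compose_Bij)
      fix x assume x: "x \<in> X"
      then obtain k where k: "k \<in> carrier G" "x = c k" using Xc by blast
      show "\<phi> (g \<otimes> h) x = (\<phi> g \<otimes>\<^bsub>BijGroup X\<^esub> \<phi> h) x"
        using phi_Bij[OF gh(1)] phi_Bij[OF gh(2)] gh x k
        by (simp add: mult_BijGroup_apply phi m_assoc)
    qed
  qed
  interpret \<phi>: group_hom G "BijGroup X" \<phi>
    by (simp add: group_hom_def group_hom_axioms_def phi_hom group_BijGroup)
  have phi_eq_iff: "\<phi> g (c h) = \<phi> g' (c h) \<longleftrightarrow> inv h \<otimes> (inv g \<otimes> g') \<otimes> h \<in> U"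
    if "g \<in> carrier G" "g' \<in> carrier G" "h \<in> carrier G" for g g' h
    using that by (simp add: phi c_eq inv_mult_group m_assoc)
  have inj: "inj_on \<phi> (carrier G)"
  proof (rule inj_onI)
    fix g g' assume g: "g \<in> carrier G" "g' \<in> carrier G" "\<phi> g = \<phi> g'"
    then have "inv h \<otimes> (inv g \<otimes> g') \<otimes> h \<in> U" if "h \<in> carrier G" for h
      using phi_eq_iff that by metis
    then have "inv g \<otimes> g' \<in> (\<Inter>g\<in>carrier G. conjugate_set G U g)"
      using g by (simp add: mem_conjugate_set_iff[OF sub])
    then have "inv g \<otimes> g' = \<one>" using core by simp
    then show "g = g'" using g by (metis inv_equality inv_inv inv_closed)
  qed
  define P where "P = \<phi> ` carrier G"
  have P: "subgroup P (BijGroup X)" unfolding P_def by (rule \<phi>.img_is_subgroup)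
  have PB: "P \<subseteq> Bij X" using phi_Bij by (auto simp: P_def)
  have op: "openin \<tau> {g \<in> carrier G. \<phi> g x = y}" if xy: "x \<in> X" "y \<in> X" for x y
  proof -
    obtain h where h: "h \<in> carrier G" "x = c h" using Xc xy by blast
    obtain k where k: "k \<in> carrier G" "y = c k" using Xc xy by blast
    have "{g \<in> carrier G. \<phi> g x = y} = {g \<in> carrier G. inv k \<otimes> (g \<otimes> h) \<in> U}"
    proof -
      have "\<phi> g x = y \<longleftrightarrow> inv k \<otimes> (g \<otimes> h) \<in> U" if "g \<in> carrier G" for g
        using c_eq[OF k(1) m_closed[OF that h(1)]] phi[OF that h(1)] unfolding h(2) k(2) by metis
      then show ?thesis by blast
    qed
    moreover have "openin \<tau> {g \<in> carrier G. inv k \<otimes> (g \<otimes> h) \<in> U}"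
      by (rule openin_preimage[OF _ U(3)], intro continuous_group_ops) (use h k in simp_all)
    ultimately show ?thesis by simp
  qed
  have cl: "closedin \<tau> {g \<in> carrier G. \<phi> g x = y}" if xy: "x \<in> X" "y \<in> X" for x y
  proof -
    have "carrier G - {g \<in> carrier G. \<phi> g x = y} = (\<Union>z\<in>X - {y}. {g \<in> carrier G. \<phi> g x = z})"
      using Bij_apply[OF phi_Bij xy(1)] by auto
    moreover have "openin \<tau> (\<Union>z\<in>X - {y}. {g \<in> carrier G. \<phi> g x = z})"
      by (rule openin_Union) (use op[OF xy(1)] in blast)
    ultimately show ?thesis by (auto simp: closedin_def)
  qed
  have cont: "continuous_map \<tau> (perm_topology X) \<phi>"
    unfolding continuous_map_perm_topology_iff using phi_Bij op by auto
  have trans: "\<exists>p\<in>P. p x = y" if xy: "x \<in> X" "y \<in> X" for x y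
  proof -
    obtain h where h: "h \<in> carrier G" "x = c h" using Xc xy by blast
    obtain k where k: "k \<in> carrier G" "y = c k" using Xc xy by blast
    define m where "m = k \<otimes> inv h"
    have m: "m \<in> carrier G" "m \<otimes> h = k" using h k by (simp_all add: m_def m_assoc)
    have "\<phi> m x = y" unfolding h(2) k(2) m(2)[symmetric] by (rule phi[OF m(1) h(1)])
    moreover have "\<phi> m \<in> P" unfolding P_def using m(1) by (rule imageI)
    ultimately show ?thesis by (rule bexI)
  qed
  have stab: "{g \<in> carrier G. \<phi> g (c h) = c h} = conjugate_set G U h" if h: "h \<in> carrier G" for h
  proof -
    have "\<phi> g (c h) = c h \<longleftrightarrow> inv h \<otimes> g \<otimes> h \<in> U" if "g \<in> carrier G" for g
      using that h c_eq[of h "g \<otimes> h"] by (simp add: phi m_assoc eq_commute[of _ "c h"])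
    then show ?thesis using mem_conjugate_set_iff[OF sub h] by blast
  qed
  have Pstab: "{p \<in> P. p (c h) = c h} = \<phi> ` conjugate_set G U h" if "h \<in> carrier G" for h
  proof -
    have "{p \<in> P. p (c h) = c h} = \<phi> ` {g \<in> carrier G. \<phi> g (c h) = c h}"
      unfolding P_def by auto
    then show ?thesis unfolding stab[OF that] .
  qed
  have Pcomp: "compactin (perm_topology X) {p \<in> P. p x = x}" if "x \<in> X" for x
  proof -
    from Xc[OF that] obtain h where h: "h \<in> carrier G" "x = c h" by blast
    have "continuous_map \<tau> \<tau> (\<lambda>u. h \<otimes> u \<otimes> inv h)"
      by (rule continuous_map_mult[OF continuous_map_mult[OF continuous_map_const' continuous_map_id'] continuous_map_const'])
        (simp_all add: h(1))
    from image_compactin[OF U(2) this] have "compactin \<tau> (conjugate_set G U h)"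
      by (simp only: conjugate_set_eq)
    from image_compactin[OF this cont] have "compactin (perm_topology X) {p \<in> P. p (c h) = c h}"
      by (simp only: Pstab[OF h(1)])
    then show ?thesis by (simp only: h(2))
  qed
  have Punion: "(\<Union>x\<in>X. {p \<in> P. p x = x}) = \<phi> ` (\<Union>g\<in>carrier G. conjugate_set G U g)"
    unfolding X_def using Pstab by auto
  have Pgen: "generate (BijGroup X) (\<Union>x\<in>X. {p \<in> P. p x = x}) = P"
  proof -
    have "(\<Union>g\<in>carrier G. conjugate_set G U g) \<subseteq> carrier G"
      using conjugate_set_subset[OF sub] by blast
    from \<phi>.generate_img[OF this] show ?thesis unfolding Punion gen P_def[symmetric] .
  qed
  \<comment> \<open>Trivial point stabilisers would generate the trivial group, but they generate
    \<open>P\<close>, a faithful image of the nontrivial group. The point found here later becomes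
    the base point.\<close>
  have Pnt: "\<exists>x\<in>X. \<exists>p\<in>P. p x = x \<and> p \<noteq> \<one>\<^bsub>BijGroup X\<^esub>"
  proof (rule ccontr)
    assume no: "\<not> ?thesis"
    have triv: "subgroup {\<one>\<^bsub>BijGroup X\<^esub>} (BijGroup X)"
      by (rule group.triv_subgroup[OF group_BijGroup])
    have "(\<Union>x\<in>X. {p \<in> P. p x = x}) \<subseteq> {\<one>\<^bsub>BijGroup X\<^esub>}" using no by blast
    from group.generate_subgroup_incl[OF group_BijGroup this triv]
    have P1: "P \<subseteq> {\<one>\<^bsub>BijGroup X\<^esub>}" unfolding Pgen .
    have "g = \<one>" if g: "g \<in> carrier G" for g
    proof -
      have "\<phi> g \<in> P" unfolding P_def using g by (rule imageI)
      then have "\<phi> g = \<phi> \<one>" using P1 \<phi>.hom_one by auto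
      from inj_onD[OF inj this g one_closed] show ?thesis .
    qed
    then have "carrier G = {\<one>}" using one_closed by blast
    from nt this show False by (rule notE)
  qed
  \<comment> \<open>If \<open>f\<close> is approximated on finite sets, the sets \<open>Z x\<close>
    of group elements that act like \<open>f\<close> at \<open>x\<close> are closed and have the
    finite intersection property. One of them, \<open>Z (c \<one>)\<close>, is a left coset of
    \<open>U\<close> and so compact; hence a single element acts like \<open>f\<close>
    everywhere.\<close>
  have closed: "closedin (perm_topology X) P"
    unfolding closedin_perm_topology_iff
  proof (intro conjI ballI impI)
    show "P \<subseteq> Bij X" by (rule PB)
    fix f assume f: "f \<in> Bij X"
      and approx: "\<forall>F. finite F \<and> F \<subseteq> X \<longrightarrow> (\<exists>a\<in>P. \<forall>x\<in>F. a x = f x)"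
    define Z where "Z = (\<lambda>x. {g \<in> carrier G. \<phi> g x = f x})"
    have fX: "f x \<in> X" if "x \<in> X" for x using Bij_apply[OF f that] .
    have Zcl: "closedin \<tau> (Z x)" if "x \<in> X" for x unfolding Z_def by (rule cl[OF that fX[OF that]])
    have c1: "c \<one> \<in> X" by (simp add: c_X)
    have fip: "\<exists>g\<in>carrier G. \<forall>x\<in>F. g \<in> Z x" if "finite F" "F \<subseteq> X" for F
    proof -
      from that approx obtain a where "a \<in> P" "\<forall>x\<in>F. a x = f x" by blast
      then show ?thesis unfolding P_def Z_def by blast
    qed
    have "compactin \<tau> (Z (c \<one>))"
    proof -
      obtain g where g: "g \<in> carrier G" "f (c \<one>) = c g" using Xc fX[OF c1] by blast
      have "\<phi> x (c \<one>) = c g \<longleftrightarrow> inv g \<otimes> x \<in> U" if "x \<in> carrier G" for x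
        using phi[OF that one_closed] c_eq[OF g(1) that] r_one[OF that] by metis
      then have "Z (c \<one>) = g <# U"
        unfolding l_coset_eq_preimage[OF g(1) sub] Z_def g(2) by blast
      then show ?thesis using compactin_l_coset[OF g(1) U(2)] by simp
    qed
    moreover have "Z (c \<one>) \<inter> \<Inter> \<F> \<noteq> {}" if FF: "finite \<F>" "\<F> \<subseteq> Z ` X" for \<F>
    proof -
      obtain F where F: "F \<subseteq> X" "finite F" "\<F> = Z ` F" using finite_subset_image[OF FF] by blast
      obtain g where "\<forall>x\<in>insert (c \<one>) F. g \<in> Z x" using fip[of "insert (c \<one>) F"] F c1 by blast
      then have "g \<in> Z (c \<one>) \<inter> \<Inter> \<F>" unfolding F(3) by blast
      then show ?thesis by blast
    qed
    moreover have "\<forall>C\<in>Z ` X. closedin \<tau> C" using Zcl by blast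
    ultimately have "Z (c \<one>) \<inter> \<Inter> (Z ` X) \<noteq> {}" unfolding compactin_fip by meson
    then obtain g where g: "g \<in> Z (c \<one>)" "\<And>x. x \<in> X \<Longrightarrow> g \<in> Z x" by blast
    have gc: "g \<in> carrier G" using g(1) by (simp add: Z_def)
    have "\<phi> g = f" by (rule Bij_ext[OF phi_Bij[OF gc] f]) (use g(2) in \<open>simp add: Z_def\<close>)
    then show "f \<in> P" using gc by (auto simp: P_def)
  qed
  \<comment> \<open>After translation to the identity, \<open>finite_core_nbhd\<close> supplies
    finitely many points such that elements agreeing with \<open>g\<close> there lie in
    \<open>V\<close>. This gives continuity of the inverse of \<open>\<phi>\<close>.\<close>
  have open_map: "open_map \<tau> (subtopology (perm_topology X) P) \<phi>"
    unfolding open_map_def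
  proof (intro allI impI)
    fix V assume V: "openin \<tau> V"
    have Vc: "V \<subseteq> carrier G" using openin_subset[OF V] by simp
    show "openin (subtopology (perm_topology X) P) (\<phi> ` V)"
    proof (subst openin_subopen, intro ballI)
      fix p assume "p \<in> \<phi> ` V"
      then obtain g where g: "g \<in> V" "p = \<phi> g" by blast
      have gc: "g \<in> carrier G" using g Vc by blast
      define V' where "V' = {x \<in> carrier G. g \<otimes> x \<in> V}"
      have V'o: "openin \<tau> V'" unfolding V'_def
        by (rule openin_preimage[OF _ V], intro continuous_group_ops) (rule gc)
      have V'1: "\<one> \<in> V'" using g gc by (simp add: V'_def)
      obtain F where F: "finite F" "F \<subseteq> carrier G"
        "\<forall>x\<in>carrier G. (\<forall>h\<in>F. inv h \<otimes> x \<otimes> h \<in> U) \<longrightarrow> x \<in> V'"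
        by (rule finite_core_nbhd[OF U core V'o V'1])
      define T where "T = {q \<in> Bij X. \<forall>x\<in>c ` F. q x = \<phi> g x} \<inter> P"
      have "c ` F \<subseteq> X" using F(2) c_X by blast
      then have "openin (perm_topology X) {q \<in> Bij X. \<forall>x\<in>c ` F. q x = \<phi> g x}"
        by (intro perm_topology_base phi_Bij gc finite_imageI F(1))
      then have "openin (subtopology (perm_topology X) P) T"
        unfolding T_def openin_subtopology by blast
      moreover have "p \<in> T" unfolding T_def g(2) using phi_Bij[OF gc] gc by (simp add: P_def)
      moreover have "T \<subseteq> \<phi> ` V"
      proof
        fix q assume q: "q \<in> T"
        then obtain g' where g': "g' \<in> carrier G" "q = \<phi> g'" by (auto simp: T_def P_def)
        have inU: "inv h \<otimes> (inv g \<otimes> g') \<otimes> h \<in> U" if "h \<in> F" for h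
        proof -
          have "h \<in> carrier G" using that F(2) by blast
          moreover have "\<phi> g (c h) = \<phi> g' (c h)" using q that g'(2) by (simp add: T_def)
          ultimately show ?thesis using phi_eq_iff[OF gc g'(1)] by simp
        qed
        have "inv g \<otimes> g' \<in> carrier G" using gc g' by simp
        then have "inv g \<otimes> g' \<in> V'" using F(3) inU by blast
        then have "g' \<in> V" using gc g' by (simp add: V'_def m_assoc[symmetric])
        then show "q \<in> \<phi> ` V" using g'(2) by blast
      qed
      ultimately show "\<exists>T. openin (subtopology (perm_topology X) P) T \<and> p \<in> T \<and> T \<subseteq> \<phi> ` V"
        by (intro exI conjI)
    qed
  qed
  have "homeomorphic_map \<tau> (subtopology (perm_topology X) P) \<phi>"
  proof (rule bijective_open_imp_homeomorphic_map[OF _ open_map])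
    show "continuous_map \<tau> (subtopology (perm_topology X) P) \<phi>"
      unfolding continuous_map_in_subtopology using cont by (auto simp: P_def)
    show "\<phi> ` topspace \<tau> = topspace (subtopology (perm_topology X) P)"
      using PB by (simp add: topspace_subtopology Int_absorb1 P_def)
    show "inj_on \<phi> (topspace \<tau>)" using inj by simp
  qed
  moreover have "\<phi> \<in> iso G (BijGroup X\<lparr>carrier := P\<rparr>)"
    using phi_hom inj by (auto simp: iso_def hom_def bij_betw_def P_def)
  ultimately have tgi: "topological_group_iso G \<tau> (BijGroup X\<lparr>carrier := P\<rparr>) (subtopology (perm_topology X) P) \<phi>"
    by (simp add: topological_group_iso_def)
  have enc: "fst (prod_decode x) = i" if "x \<in> X" for x
    using that by (auto simp: X_def c_def)
  have Pcg: "\<exists>C. compactin (perm_topology X) C \<and> generate (BijGroup X) C = P"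
  proof -
    obtain C where C: "compactin \<tau> C" "generate G C = carrier G"
      using cg by (auto simp: compactly_generated_def)
    have "C \<subseteq> carrier G" using compactin_subset_topspace[OF C(1)] by simp
    from \<phi>.generate_img[OF this] have "generate (BijGroup X) (\<phi> ` C) = P"
      unfolding C(2) P_def[symmetric] .
    then show ?thesis using image_compactin[OF C(1) cont] by (intro exI conjI)
  qed
  show thesis by (rule that[OF P closed trans Pcomp Pgen Pnt Pcg tgi enc])
qed

end

section \<open>Reduced words\<close>

text \<open>The point \<open>b i\<close> plays the part of a neutral element of \<open>X i\<close>,
  and \<open>tp\<close> recovers the index of a letter, which later is the tag in its code.\<close>

locale reduced_words =
  fixes I :: "'i set" and X :: "'i \<Rightarrow> 'x set" and P :: "'i \<Rightarrow> ('x \<Rightarrow> 'x) set"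
    and b :: "'i \<Rightarrow> 'x" and tp :: "'x \<Rightarrow> 'i"
  assumes b_X: "\<And>i. i \<in> I \<Longrightarrow> b i \<in> X i"
    and tp_X: "\<And>i x. i \<in> I \<Longrightarrow> x \<in> X i \<Longrightarrow> tp x = i"
    and P_sub: "\<And>i. i \<in> I \<Longrightarrow> subgroup (P i) (BijGroup (X i))"
begin

definition Y :: "'x list set" where
  "Y = {w. (\<forall>x\<in>set w. tp x \<in> I \<and> x \<in> X (tp x) \<and> x \<noteq> b (tp x)) \<and> successively (\<lambda>x y. tp x \<noteq> tp y) w}"

abbreviation word_mult (infixl "\<cdot>" 70) where "g \<cdot> h \<equiv> g \<otimes>\<^bsub>BijGroup Y\<^esub> h"
abbreviation iv where "iv g \<equiv> inv\<^bsub>BijGroup Y\<^esub> g"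

definition ends :: "'i \<Rightarrow> 'x list \<Rightarrow> bool" where "ends i w \<longleftrightarrow> w \<noteq> [] \<and> tp (last w) = i"
definition starts :: "'i \<Rightarrow> 'x list \<Rightarrow> bool" where "starts i w \<longleftrightarrow> w \<noteq> [] \<and> tp (hd w) = i"

text \<open>A class of type \<open>i\<close> consists of the words with a given \<open>base i\<close>; \<open>col\<close> is its colouring.\<close>

definition base :: "'i \<Rightarrow> 'x list \<Rightarrow> 'x list" where "base i w = (if ends i w then butlast w else w)"
definition col :: "'i \<Rightarrow> 'x list \<Rightarrow> 'x" where "col i w = (if ends i w then last w else b i)"
text \<open>The base point acts as the empty letter, so \<open>app i u\<close> runs through a whole
  class while its last argument runs through \<open>X i\<close>.\<close>

definition app :: "'i \<Rightarrow> 'x list \<Rightarrow> 'x \<Rightarrow> 'x list" where "app i u x = (if x = b i then u else u @ [x])"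
text \<open>The counterpart of \<open>app\<close> at the front of a word; \<open>rest\<close> and
  \<open>head\<close> undo it as \<open>base\<close> and \<open>col\<close> undo \<open>app\<close>.
  The front is where the local groups act.\<close>

definition cons :: "'i \<Rightarrow> 'x \<Rightarrow> 'x list \<Rightarrow> 'x list" where "cons i x u = (if x = b i then u else x # u)"
definition rest :: "'i \<Rightarrow> 'x list \<Rightarrow> 'x list" where "rest i w = (if starts i w then tl w else w)"
definition head :: "'i \<Rightarrow> 'x list \<Rightarrow> 'x" where "head i w = (if starts i w then hd w else b i)"

section \<open>Taking reduced words apart at either end\<close>

lemma Nil_Y [simp]: "[] \<in> Y" by (simp add: Y_def)

lemma ends_Nil [simp]: "\<not> ends i []" by (simp add: ends_def)
lemma starts_Nil [simp]: "\<not> starts i []" by (simp add: starts_def)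

lemma Y_snoc:
  "w @ [x] \<in> Y \<longleftrightarrow> w \<in> Y \<and> tp x \<in> I \<and> x \<in> X (tp x) \<and> x \<noteq> b (tp x) \<and> \<not> ends (tp x) w"
  by (cases "w = []") (auto simp: Y_def ends_def successively_append_iff)

lemma Y_Cons:
  "x # w \<in> Y \<longleftrightarrow> w \<in> Y \<and> tp x \<in> I \<and> x \<in> X (tp x) \<and> x \<noteq> b (tp x) \<and> \<not> starts (tp x) w"
  by (cases w) (auto simp: Y_def starts_def)

lemma app_b [simp]: "app i u (b i) = u" by (simp add: app_def)
lemma cons_b [simp]: "cons i (b i) u = u" by (simp add: cons_def)

lemma app_Y:
  assumes "i \<in> I" "u \<in> Y" "\<not> ends i u" "x \<in> X i"
  shows "app i u x \<in> Y"
  using assms tp_X[OF assms(1,4)] by (auto simp: app_def Y_snoc)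

lemma base_app: "i \<in> I \<Longrightarrow> \<not> ends i u \<Longrightarrow> x \<in> X i \<Longrightarrow> base i (app i u x) = u"
  using tp_X[of i x] by (auto simp: app_def base_def ends_def)

lemma col_app: "i \<in> I \<Longrightarrow> \<not> ends i u \<Longrightarrow> x \<in> X i \<Longrightarrow> col i (app i u x) = x"
  using tp_X[of i x] by (auto simp: app_def col_def ends_def)

lemma app_inj:
  assumes "i \<in> I" "\<not> ends i u" "x \<in> X i" "y \<in> X i" "app i u x = app i u y"
  shows "x = y"
proof -
  have "x = col i (app i u x)" by (rule col_app[OF assms(1-3), symmetric])
  also have "\<dots> = y" unfolding assms(5) by (rule col_app[OF assms(1,2,4)])
  finally show ?thesis .
qed

lemma base_Y:
  assumes "i \<in> I" "w \<in> Y"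
  shows "base i w \<in> Y" "\<not> ends i (base i w)" "col i w \<in> X i" "app i (base i w) (col i w) = w"
proof -
  have "base i w \<in> Y \<and> \<not> ends i (base i w) \<and> col i w \<in> X i \<and> app i (base i w) (col i w) = w"
  proof (cases "ends i w")
    case False
    then show ?thesis using assms b_X[OF assms(1)] by (simp add: base_def col_def)
  next
    case True
    then obtain v x where w: "w = v @ [x]" "tp x = i"
      unfolding ends_def by (metis append_butlast_last_id)
    then have "v \<in> Y" "x \<in> X i" "x \<noteq> b i" "\<not> ends i v" using assms(2) Y_snoc[of v x] by auto
    then show ?thesis using w True by (simp add: base_def col_def app_def)
  qed
  then show "base i w \<in> Y" "\<not> ends i (base i w)" "col i w \<in> X i" "app i (base i w) (col i w) = w"
    by auto
qed

lemma cons_Y: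
  assumes "i \<in> I" "u \<in> Y" "\<not> starts i u" "x \<in> X i"
  shows "cons i x u \<in> Y"
  using assms tp_X[OF assms(1,4)] by (auto simp: cons_def Y_Cons)

lemma rest_cons: "i \<in> I \<Longrightarrow> \<not> starts i u \<Longrightarrow> x \<in> X i \<Longrightarrow> rest i (cons i x u) = u"
  using tp_X[of i x] by (auto simp: cons_def rest_def starts_def)

lemma head_cons: "i \<in> I \<Longrightarrow> \<not> starts i u \<Longrightarrow> x \<in> X i \<Longrightarrow> head i (cons i x u) = x"
  using tp_X[of i x] by (auto simp: cons_def head_def starts_def)

lemma rest_Y:
  assumes "i \<in> I" "w \<in> Y"
  shows "rest i w \<in> Y" "\<not> starts i (rest i w)" "head i w \<in> X i" "cons i (head i w) (rest i w) = w"
proof -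
  have "rest i w \<in> Y \<and> \<not> starts i (rest i w) \<and> head i w \<in> X i \<and> cons i (head i w) (rest i w) = w"
  proof (cases "starts i w")
    case False
    then show ?thesis using assms b_X[OF assms(1)] by (simp add: rest_def head_def)
  next
    case True
    then obtain v x where w: "w = x # v" "tp x = i"
      unfolding starts_def by (metis list.exhaust_sel)
    then have "v \<in> Y" "x \<in> X i" "x \<noteq> b i" "\<not> starts i v" using assms(2) Y_Cons[of x v] by auto
    then show ?thesis using w True by (simp add: rest_def head_def cons_def)
  qed
  then show "rest i w \<in> Y" "\<not> starts i (rest i w)" "head i w \<in> X i" "cons i (head i w) (rest i w) = w"
    by auto
qed

lemma P_Bij: "i \<in> I \<Longrightarrow> p \<in> P i \<Longrightarrow> p \<in> Bij (X i)"
  using subgroup.subset[OF P_sub] by auto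

lemma P_X: "i \<in> I \<Longrightarrow> p \<in> P i \<Longrightarrow> x \<in> X i \<Longrightarrow> p x \<in> X i"
  using Bij_apply[OF P_Bij] by blast

lemma P_inj: "i \<in> I \<Longrightarrow> p \<in> P i \<Longrightarrow> x \<in> X i \<Longrightarrow> y \<in> X i \<Longrightarrow> p x = p y \<Longrightarrow> x = y"
  using inj_onD[OF Bij_inj[OF P_Bij]] by blast

lemma P_id: "i \<in> I \<Longrightarrow> (\<lambda>x\<in>X i. x) \<in> P i"
  using subgroup.one_closed[OF P_sub[of i]] by (simp add: one_BijGroup)

lemma P_compose: "i \<in> I \<Longrightarrow> p \<in> P i \<Longrightarrow> q \<in> P i \<Longrightarrow> compose (X i) p q \<in> P i"
  using subgroup.m_closed[OF P_sub[of i], of p q] P_Bij by (simp add: mult_BijGroup)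

lemma P_inverse:
  assumes "i \<in> I" "p \<in> P i"
  obtains q where "q \<in> P i" "\<forall>x\<in>X i. q (p x) = x" "\<forall>x\<in>X i. p (q x) = x"
  using that[of "inv\<^bsub>BijGroup (X i)\<^esub> p"] subgroup.m_inv_closed[OF P_sub[OF assms(1)] assms(2)]
    inv_BijGroup_apply[OF P_Bij[OF assms]] by simp

text \<open>A class of type \<open>i\<close> will be the star of a tree vertex over
  \<open>i\<close>; in these terms \<open>p\<close> is the local action of \<open>g\<close> at that
  vertex.\<close>

definition maps_class :: "('x list \<Rightarrow> 'x list) \<Rightarrow> ('x \<Rightarrow> 'x) \<Rightarrow> 'i \<Rightarrow> 'x list \<Rightarrow> 'x list \<Rightarrow> bool" where
  "maps_class g p i u v \<longleftrightarrow> v \<in> Y \<and> \<not> ends i v \<and> p \<in> P i \<and> (\<forall>x\<in>X i. g (app i u x) = app i v (p x))"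

text \<open>Only the vertices over leaves impose a condition. Triviality of the local group at the
  centre is already expressed by classes of type \<open>i\<close> going to classes of the same
  type.\<close>

definition U :: "('x list \<Rightarrow> 'x list) set" where
  "U = {g \<in> Bij Y. \<forall>i\<in>I. \<forall>u\<in>Y. \<not> ends i u \<longrightarrow> (\<exists>p v. maps_class g p i u v)}"

section \<open>The group of word permutations\<close>

lemma U_Bij: "g \<in> U \<Longrightarrow> g \<in> Bij Y" by (simp add: U_def)
lemma U_Y: "g \<in> U \<Longrightarrow> w \<in> Y \<Longrightarrow> g w \<in> Y" using Bij_apply[OF U_Bij] by blast

lemma U_class:
  assumes "g \<in> U" "i \<in> I" "u \<in> Y" "\<not> ends i u"
  obtains p v where "maps_class g p i u v"
  using assms unfolding U_def by blast

lemma U_I: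
  assumes "g \<in> Bij Y" "\<And>i u. i \<in> I \<Longrightarrow> u \<in> Y \<Longrightarrow> \<not> ends i u \<Longrightarrow> \<exists>p v. maps_class g p i u v"
  shows "g \<in> U"
  using assms by (simp add: U_def)

text \<open>Gives a well-defined action on classes, that is, on the tree vertices over the
  leaves.\<close>

lemma U_base:
  assumes "g \<in> U" "i \<in> I" "w \<in> Y" "w' \<in> Y" "base i w = base i w'"
  shows "base i (g w) = base i (g w')"
proof -
  obtain p v where m: "maps_class g p i (base i w) v"
    using U_class[OF assms(1,2) base_Y(1,2)[OF assms(2,3)]] .
  have "base i (g z) = v" if z: "z \<in> Y" "base i z = base i w" for z
  proof -
    have c: "col i z \<in> X i" using base_Y[OF assms(2) z(1)] by blast
    then have "g z = app i v (p (col i z))"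
      using m base_Y(4)[OF assms(2) z(1)] z(2) unfolding maps_class_def by metis
    then show ?thesis using m P_X[OF assms(2) _ c] base_app[OF assms(2)] unfolding maps_class_def by metis
  qed
  then show ?thesis using assms by metis
qed

lemma U_one: "(\<lambda>w\<in>Y. w) \<in> U"
proof (rule U_I)
  show "(\<lambda>w\<in>Y. w) \<in> Bij Y" by (rule id_Bij)
  fix i u assume iu: "i \<in> I" "u \<in> Y" "\<not> ends i u"
  have "maps_class (\<lambda>w\<in>Y. w) (\<lambda>x\<in>X i. x) i u u"
    unfolding maps_class_def using iu app_Y[OF iu] P_id[OF iu(1)] by simp
  then show "\<exists>p v. maps_class (\<lambda>w\<in>Y. w) p i u v" by (intro exI)
qed

lemma U_inverse:
  assumes g: "g \<in> U"
  shows "iv g \<in> U"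
proof (rule U_I)
  let ?h = "iv g"
  show "?h \<in> Bij Y" by (rule inv_BijGroup_Bij[OF U_Bij[OF g]])
  fix i u assume iu: "i \<in> I" "u \<in> Y" "\<not> ends i u"
  \<comment> \<open>The class of \<open>u\<close> has to come from the class of its preimage;
    comparing bases then forces \<open>v = u\<close>.\<close>
  define z where "z = ?h u"
  have z: "z \<in> Y" "g z = u" using inv_BijGroup_apply[OF U_Bij[OF g] iu(2)] by (auto simp: z_def)
  note bz = base_Y[OF iu(1) z(1)]
  obtain p v where m: "maps_class g p i (base i z) v" using U_class[OF g iu(1) bz(1,2)] .
  have p: "p \<in> P i" and v: "\<not> ends i v"
    and gv: "\<And>x. x \<in> X i \<Longrightarrow> g (app i (base i z) x) = app i v (p x)"
    using m by (auto simp: maps_class_def)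
  have "u = app i v (p (col i z))" using gv[OF bz(3)] unfolding bz(4) z(2) .
  then have "base i u = v" using base_app[OF iu(1) v P_X[OF iu(1) p bz(3)]] by (simp only:)
  then have uv: "v = u" using iu(3) by (simp add: base_def)
  obtain q where q: "q \<in> P i" "\<forall>x\<in>X i. q (p x) = x" "\<forall>x\<in>X i. p (q x) = x"
    by (rule P_inverse[OF iu(1) p])
  have "?h (app i u x) = app i (base i z) (q x)" if x: "x \<in> X i" for x
  proof -
    have qx: "q x \<in> X i" by (rule P_X[OF iu(1) q(1) x])
    have "g (app i (base i z) (q x)) = app i u x" unfolding gv[OF qx] bspec[OF q(3) x] uv ..
    then show ?thesis
      using inv_BijGroup_apply(1)[OF U_Bij[OF g] app_Y[OF iu(1) bz(1,2) qx]] by simp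
  qed
  then have "\<forall>x\<in>X i. ?h (app i u x) = app i (base i z) (q x)" by (rule ballI)
  then have "maps_class ?h q i u (base i z)"
    unfolding maps_class_def by (intro conjI bz(1,2) q(1))
  then show "\<exists>p v. maps_class ?h p i u v" by (intro exI)
qed

lemma U_mult:
  assumes gh: "g \<in> U" "h \<in> U"
  shows "g \<cdot> h \<in> U"
proof (rule U_I)
  show "g \<cdot> h \<in> Bij Y"
    using U_Bij[OF gh(1)] U_Bij[OF gh(2)] by (simp add: mult_BijGroup compose_Bij)
  fix i u assume iu: "i \<in> I" "u \<in> Y" "\<not> ends i u"
  obtain q v where q: "maps_class h q i u v" using U_class[OF gh(2) iu] .
  then have v: "v \<in> Y" "\<not> ends i v" "q \<in> P i"
    and hq: "\<And>x. x \<in> X i \<Longrightarrow> h (app i u x) = app i v (q x)" by (auto simp: maps_class_def)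
  obtain p v' where p: "maps_class g p i v v'" using U_class[OF gh(1) iu(1) v(1,2)] .
  then have p': "v' \<in> Y" "\<not> ends i v'" "p \<in> P i"
    and gp: "\<And>x. x \<in> X i \<Longrightarrow> g (app i v x) = app i v' (p x)" by (auto simp: maps_class_def)
  have "(g \<cdot> h) (app i u x) = app i v' (compose (X i) p q x)" if x: "x \<in> X i" for x
    using mult_BijGroup_apply[OF U_Bij[OF gh(1)] U_Bij[OF gh(2)] app_Y[OF iu x]]
      hq[OF x] gp[OF P_X[OF iu(1) v(3) x]] x by (simp add: compose_def)
  then have "\<forall>x\<in>X i. (g \<cdot> h) (app i u x) = app i v' (compose (X i) p q x)"
    by (rule ballI)
  then have "maps_class (g \<cdot> h) (compose (X i) p q) i u v'"
    unfolding maps_class_def by (intro conjI p'(1,2) P_compose[OF iu(1) p'(3) v(3)])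
  then show "\<exists>p v. maps_class (g \<cdot> h) p i u v" by (intro exI)
qed

lemma U_subgroup: "subgroup U (BijGroup Y)"
proof (rule group.subgroupI[OF group_BijGroup])
  show "U \<subseteq> carrier (BijGroup Y)" unfolding carrier_BijGroup using U_Bij by (rule subsetI)
  show "U \<noteq> {}" using U_one by (metis empty_iff)
qed (rule U_inverse U_mult; assumption)+

lemma U_mult_apply: "g \<in> U \<Longrightarrow> h \<in> U \<Longrightarrow> w \<in> Y \<Longrightarrow> (g \<cdot> h) w = g (h w)"
  by (simp add: mult_BijGroup_apply U_Bij)

lemma U_inv_apply:
  assumes "g \<in> U" "w \<in> Y"
  shows "(iv g) (g w) = w" "g ((iv g) w) = w"
    "(iv g) w \<in> Y"
  using inv_BijGroup_apply[OF U_Bij[OF assms(1)] assms(2)] by auto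

lemma U_ext: "g \<in> U \<Longrightarrow> h \<in> U \<Longrightarrow> (\<And>w. w \<in> Y \<Longrightarrow> g w = h w) \<Longrightarrow> g = h"
  by (rule Bij_ext[OF U_Bij U_Bij])

text \<open>Within their classes of type \<open>i\<close> both \<open>w\<close> and
  \<open>g w\<close> have colour \<open>b i\<close>. Hence the local action fixes
  \<open>b i\<close>, and the image class has base \<open>g w\<close>.\<close>

lemma U_extend_letter:
  assumes g: "g \<in> U" and i: "i \<in> I" and w: "w \<in> Y" "\<not> ends i w" "\<not> ends i (g w)"
  obtains p where "p \<in> P i" "p (b i) = b i" "\<forall>x\<in>X i. g (app i w x) = app i (g w) (p x)"
proof -
  obtain p v where m: "maps_class g p i w v" using U_class[OF g i w(1,2)] .
  then have p: "p \<in> P i" and v: "\<not> ends i v"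
    and gx: "\<And>x. x \<in> X i \<Longrightarrow> g (app i w x) = app i v (p x)"
    by (auto simp: maps_class_def)
  have pb: "p (b i) \<in> X i" by (rule P_X[OF i p b_X[OF i]])
  have "g w = app i v (p (b i))" using gx[OF b_X[OF i]] by simp
  then have "base i (g w) = v" "col i (g w) = p (b i)"
    using base_app[OF i v pb] col_app[OF i v pb] by auto
  then have "g w = v" "p (b i) = b i" using w(3) by (auto simp: base_def col_def)
  then show thesis using that[OF p] gx by simp
qed

text \<open>Reducedness prevents folding back: once the first letter of \<open>w\<close> can follow
  \<open>g []\<close>, every further letter is appended as well, possibly changed but of the same
  type. This is the word form of a geodesic that continues away from the root.\<close>

lemma U_extend:
  assumes g: "g \<in> U" and l: "l \<in> I" "\<not> ends l (g [])"
    and w: "w \<in> Y" "w = [] \<or> starts l w"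
  obtains w' where "g w = g [] @ w'" "map tp w' = map tp w"
proof -
  have "\<exists>w'. g w = g [] @ w' \<and> map tp w' = map tp w"
    using w
  proof (induction w rule: rev_induct)
    case Nil
    then show ?case by simp
  next
    case (snoc x w)
    define j where "j = tp x"
    have wx: "w \<in> Y" "j \<in> I" "x \<in> X j" "x \<noteq> b j" "\<not> ends j w"
      using snoc.prems(1) unfolding Y_snoc j_def by auto
    have "w = [] \<or> starts l w" using snoc.prems(2) by (cases w) (auto simp: starts_def)
    then obtain w' where w': "g w = g [] @ w'" "map tp w' = map tp w" using snoc.IH wx(1) by blast
    \<comment> \<open>For the first letter this is the hypothesis on \<open>g []\<close>. Later the
      last type of \<open>g w\<close> is that of \<open>w\<close>, which differs from
      \<open>j\<close> because the word is reduced.\<close>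
    have "\<not> ends j (g w)"
    proof (cases "w = []")
      case True
      then have "j = l" using snoc.prems(2) by (simp add: starts_def j_def)
      then show ?thesis using True l(2) by simp
    next
      case False
      then have "w' \<noteq> []" using w'(2) by auto
      then have "tp (last w') = tp (last w)" using w'(2) False by (metis last_map)
      then show ?thesis using wx(5) False \<open>w' \<noteq> []\<close> unfolding w'(1) by (simp add: ends_def)
    qed
    then obtain p where p: "p \<in> P j" "p (b j) = b j" "\<forall>x\<in>X j. g (app j w x) = app j (g w) (p x)"
      using U_extend_letter[OF g wx(2) wx(1) wx(5)] by blast
    have "p x \<noteq> b j" using P_inj[OF wx(2) p(1) wx(3) b_X[OF wx(2)]] p(2) wx(4) by metis
    then have "g (w @ [x]) = g w @ [p x]" using bspec[OF p(3) wx(3)] wx(4) by (simp add: app_def)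
    moreover have "tp (p x) = tp x" using tp_X[OF wx(2) P_X[OF wx(2) p(1) wx(3)]] by (simp add: j_def)
    ultimately show ?case using w' by (intro exI[of _ "w' @ [p x]"]) simp
  qed
  then show thesis using that by blast
qed

subsection \<open>The action of the local groups on reduced words\<close>

definition sec :: "'i \<Rightarrow> ('x \<Rightarrow> 'x) \<Rightarrow> 'x list \<Rightarrow> 'x list" where
  "sec i p = (\<lambda>w\<in>Y. cons i (p (head i w)) (rest i w))"

lemma sec_cons:
  "i \<in> I \<Longrightarrow> u \<in> Y \<Longrightarrow> \<not> starts i u \<Longrightarrow> x \<in> X i \<Longrightarrow> sec i p (cons i x u) = cons i (p x) u"
  by (simp add: sec_def cons_Y rest_cons head_cons)

lemma sec_Y: "i \<in> I \<Longrightarrow> p \<in> P i \<Longrightarrow> w \<in> Y \<Longrightarrow> sec i p w \<in> Y"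
  using rest_Y[of i w] P_X by (simp add: sec_def cons_Y)

lemma sec_compose:
  assumes "i \<in> I" "p \<in> P i" "q \<in> P i" "w \<in> Y"
  shows "sec i p (sec i q w) = cons i (p (q (head i w))) (rest i w)"
  using rest_Y[OF assms(1,4)] assms P_X[OF assms(1,3)] by (simp add: sec_def[of i q] sec_cons)

lemma sec_Bij:
  assumes i: "i \<in> I" and p: "p \<in> P i"
  shows "sec i p \<in> Bij Y"
proof -
  obtain q where q: "q \<in> P i" "\<forall>x\<in>X i. q (p x) = x" "\<forall>x\<in>X i. p (q x) = x"
    by (rule P_inverse[OF i p])
  show ?thesis
  proof (rule BijI[where f' = "sec i q"])
    show "sec i p \<in> extensional Y" by (simp add: sec_def)
    fix w assume w: "w \<in> Y"
    show "sec i p w \<in> Y" "sec i q w \<in> Y" using sec_Y i p q(1) w by auto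
    show "sec i q (sec i p w) = w" "sec i p (sec i q w) = w"
      using sec_compose[OF i _ _ w] p q rest_Y[OF i w] by simp_all
  qed
qed

lemma starts_app: "u \<noteq> [] \<Longrightarrow> starts i (app j u x) \<longleftrightarrow> starts i u"
  by (simp add: app_def starts_def)

text \<open>Changing the first letter commutes with appending a last one, so classes are moved with
  identity local action. The exception is the class of type \<open>i\<close> at the empty word,
  where the first and the last letter coincide and the local action is \<open>p\<close>.\<close>

lemma sec_U:
  assumes i: "i \<in> I" and p: "p \<in> P i"
  shows "sec i p \<in> U"
proof (rule U_I)
  show "sec i p \<in> Bij Y" by (rule sec_Bij[OF assms])
  fix j u assume ju: "j \<in> I" "u \<in> Y" "\<not> ends j u"
  show "\<exists>q v. maps_class (sec i p) q j u v"
  proof (cases "j = i \<and> u = []")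
    case True
    have "sec i p (app i [] x) = app i [] (p x)" if "x \<in> X i" for x
      using sec_cons[OF i Nil_Y _ that, of p] by (simp add: app_def cons_def split: if_splits)
    then have "maps_class (sec i p) p j u []" using True p by (simp add: maps_class_def)
    then show ?thesis by blast
  next
    case False
    define x0 u' where "x0 = head i u" and "u' = rest i u"
    have u': "u' \<in> Y" "\<not> starts i u'" "x0 \<in> X i" "cons i x0 u' = u"
      using rest_Y[OF i ju(2)] by (auto simp: x0_def u'_def)
    have px: "p x0 \<in> X i" by (rule P_X[OF i p u'(3)])
    have su: "sec i p u = cons i (p x0) u'" using sec_cons[OF i u'(1-3), of p] u'(4) by simp
    \<comment> \<open>Here \<open>u\<close> is empty or a single letter of type \<open>i\<close>.
      For \<open>j = i\<close> the former is excluded by the case distinction, the latter because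
      \<open>u\<close> does not end in type \<open>j\<close>.\<close>
    have neq: "j \<noteq> i" if "u' = []"
      using that False ju(3) u'(4) tp_X[OF i u'(3)] by (auto simp: cons_def ends_def split: if_splits)
    have e: "ends j (cons i y u') \<longleftrightarrow> ends j u'" if "y \<in> X i" for y
      using neq tp_X[OF i that] by (cases "u' = []") (auto simp: cons_def ends_def)
    have ne: "\<not> ends j u'" using e[OF u'(3)] u'(4) ju(3) by simp
    have "sec i p (app j u x) = app j (sec i p u) x" if x: "x \<in> X j" for x
    proof -
      have c: "cons i y (app j u' x) = app j (cons i y u') x" for y
        by (simp add: cons_def app_def)
      have "\<not> starts i (app j u' x)"
        using neq starts_app[of u' i j x] u'(2) tp_X[OF ju(1) x]
        by (cases "u' = []") (auto simp: app_def starts_def)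
      then have "sec i p (cons i x0 (app j u' x)) = cons i (p x0) (app j u' x)"
        by (intro sec_cons[OF i] app_Y ju(1) u' ne x)
      then show ?thesis unfolding c u'(4) su .
    qed
    then have "maps_class (sec i p) (\<lambda>x\<in>X j. x) j u (sec i p u)"
      using P_id[OF ju(1)] sec_Y[OF i p ju(2)] e[OF px] ne su by (simp add: maps_class_def)
    then show ?thesis by blast
  qed
qed

lemma sec_mult:
  assumes "i \<in> I" "p \<in> P i" "q \<in> P i"
  shows "sec i (p \<otimes>\<^bsub>BijGroup (X i)\<^esub> q) = sec i p \<cdot> sec i q"
proof (rule U_ext)
  have "p \<otimes>\<^bsub>BijGroup (X i)\<^esub> q \<in> P i" by (rule subgroup.m_closed[OF P_sub[OF assms(1)] assms(2,3)])
  then show "sec i (p \<otimes>\<^bsub>BijGroup (X i)\<^esub> q) \<in> U" by (rule sec_U[OF assms(1)])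
  show "sec i p \<cdot> sec i q \<in> U" by (intro U_mult sec_U assms)
  fix w assume w: "w \<in> Y"
  show "sec i (p \<otimes>\<^bsub>BijGroup (X i)\<^esub> q) w = (sec i p \<cdot> sec i q) w"
    using w rest_Y(3)[OF assms(1) w] sec_compose[OF assms w] assms
    by (simp add: U_mult_apply sec_U mult_BijGroup_apply P_Bij sec_def[of i "p \<otimes>\<^bsub>BijGroup (X i)\<^esub> q"])
qed

lemma sec_Cons:
  assumes "x # w \<in> Y" "p (b (tp x)) = x"
  shows "sec (tp x) p w = x # w"
  using assms sec_cons[of "tp x" w "b (tp x)" p] b_X[of "tp x"]
  unfolding Y_Cons by (simp add: cons_def)

text \<open>If \<open>p\<close> takes the base point to the letter \<open>x\<close>, then
  \<open>sec (tp x) p\<close> puts \<open>x\<close> in front of a word, so words are built one front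
  letter at a time. The subgroup \<open>N\<close> is kept general because the lemma serves for
  \<open>U\<close>, for closed normal subgroups and for generated ones.\<close>

lemma transitive_on_words:
  assumes trans: "\<And>i x. i \<in> I \<Longrightarrow> x \<in> X i \<Longrightarrow> \<exists>p\<in>P i. p (b i) = x"
    and N: "\<And>i p. i \<in> I \<Longrightarrow> p \<in> P i \<Longrightarrow> sec i p \<in> N" "N \<subseteq> U" "subgroup N (BijGroup Y)"
    and w: "w \<in> Y"
  shows "\<exists>g\<in>N. g [] = w"
  using w
proof (induction w)
  case Nil
  have "\<one>\<^bsub>BijGroup Y\<^esub> \<in> N" using subgroup.one_closed[OF N(3)] .
  then show ?case by (rule bexI[rotated]) (simp add: one_BijGroup)
next
  case (Cons x w)
  then have wx: "w \<in> Y" "tp x \<in> I" "x \<in> X (tp x)" unfolding Y_Cons by auto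
  obtain g where g: "g \<in> N" "g [] = w" using Cons.IH[OF wx(1)] by blast
  obtain p where p: "p \<in> P (tp x)" "p (b (tp x)) = x" using trans[OF wx(2,3)] by blast
  have "sec (tp x) p \<cdot> g \<in> N" by (intro subgroup.m_closed[OF N(3)] N(1) g wx p)
  moreover have "(sec (tp x) p \<cdot> g) [] = x # w"
    using g N(2) sec_U[OF wx(2) p(1)] sec_Cons[where x = x and w = w and p = p, OF Cons.prems p(2)] by (simp add: U_mult_apply subset_iff)
  ultimately show ?case by (intro bexI[of _ "sec (tp x) p \<cdot> g"])
qed

lemma contains_U_if:
  assumes N: "subgroup N (BijGroup Y)" "N \<subseteq> U"
    and st: "\<And>u. u \<in> U \<Longrightarrow> u [] = [] \<Longrightarrow> u \<in> N"
    and tr: "\<And>w. w \<in> Y \<Longrightarrow> \<exists>g\<in>N. g [] = w"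
  shows "N = U"
proof (rule subset_antisym[OF N(2)], rule subsetI)
  fix u assume u: "u \<in> U"
  obtain g where g: "g \<in> N" "g [] = u []" using tr[OF U_Y[OF u Nil_Y]] by blast
  have gU: "g \<in> U" using g N(2) by blast
  let ?h = "iv g \<cdot> u"
  have hU: "?h \<in> U" by (intro U_mult U_inverse gU u)
  have "?h [] = []"
    using U_mult_apply[OF U_inverse[OF gU] u Nil_Y] U_inv_apply(1)[OF gU Nil_Y] g(2) by simp
  then have "?h \<in> N" by (rule st[OF hU])
  then have "g \<cdot> ?h \<in> N" by (rule subgroup.m_closed[OF N(1) g(1)])
  moreover have "g \<cdot> ?h = u"
    by (rule U_ext) (use gU u hU in \<open>simp_all add: U_mult U_mult_apply U_inverse U_inv_apply U_Y\<close>)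
  ultimately show "u \<in> N" by simp
qed

end

text \<open>\<open>other_type\<close> excludes a single type, for which no word has two letters, and
  \<open>P_nt\<close> provides branching. The conditions on \<open>P\<close> are those that
  \<open>coset_representation\<close> supplies, with \<open>b i\<close> taken at a nontrivial
  stabiliser.\<close>

locale word_group = reduced_words +
  assumes fin_I: "finite I"
    and other_type: "\<And>i. i \<in> I \<Longrightarrow> \<exists>j\<in>I. j \<noteq> i"
    and nonempty_I: "I \<noteq> {}"
    and P_trans: "\<And>i x y. i \<in> I \<Longrightarrow> x \<in> X i \<Longrightarrow> y \<in> X i \<Longrightarrow> \<exists>p\<in>P i. p x = y"
    and P_closed: "\<And>i. i \<in> I \<Longrightarrow> closedin (perm_topology (X i)) (P i)"
    and P_comp: "\<And>i x. i \<in> I \<Longrightarrow> x \<in> X i \<Longrightarrow> compactin (perm_topology (X i)) {p \<in> P i. p x = x}"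
    and P_gen: "\<And>i. i \<in> I \<Longrightarrow> generate (BijGroup (X i)) (\<Union>x\<in>X i. {p \<in> P i. p x = x}) = P i"
    and P_nt: "\<And>i. i \<in> I \<Longrightarrow> \<exists>p\<in>P i. p (b i) = b i \<and> p \<noteq> \<one>\<^bsub>BijGroup (X i)\<^esub>"
    and P_cg: "\<And>i. i \<in> I \<Longrightarrow> \<exists>C. compactin (perm_topology (X i)) C \<and> generate (BijGroup (X i)) C = P i"
begin

section \<open>Spare letters and transitivity on words\<close>

lemma P_moves:
  assumes "i \<in> I"
  obtains p y where "p \<in> P i" "p (b i) = b i" "y \<in> X i" "p y \<noteq> y"
proof -
  obtain p where p: "p \<in> P i" "p (b i) = b i" "p \<noteq> \<one>\<^bsub>BijGroup (X i)\<^esub>"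
    using P_nt[OF assms] by blast
  have "\<exists>y\<in>X i. p y \<noteq> y"
  proof (rule ccontr)
    assume no: "\<not> (\<exists>y\<in>X i. p y \<noteq> y)"
    have "p = (\<lambda>x\<in>X i. x)"
      by (rule Bij_ext[OF P_Bij[OF assms p(1)] id_Bij]) (use no in simp)
    then show False using p(3) by (simp add: one_BijGroup)
  qed
  then show thesis using that p by blast
qed

text \<open>An element that fixes \<open>b i\<close> and moves \<open>y\<close> yields two distinct
  letters \<open>y\<close> and \<open>p y\<close> other than \<open>b i\<close>, and one of them
  avoids \<open>a\<close>. It serves to branch off a given word.\<close>

lemma third_letter:
  assumes "i \<in> I"
  shows "\<exists>c\<in>X i. c \<noteq> b i \<and> c \<noteq> a"
proof -
  obtain p y where p: "p \<in> P i" "p (b i) = b i" "y \<in> X i" "p y \<noteq> y"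
    by (rule P_moves[OF assms])
  have "y \<noteq> b i" using p by metis
  moreover have "p y \<noteq> b i" using P_inj[OF assms p(1) p(3) b_X[OF assms]] p(2) calculation by metis
  moreover have "p y \<in> X i" by (rule P_X[OF assms p(1,3)])
  ultimately show ?thesis using p(3,4) by metis
qed

lemma transitive_U: "w \<in> Y \<Longrightarrow> \<exists>g\<in>U. g [] = w"
  by (rule transitive_on_words[OF _ sec_U subset_refl U_subgroup]) (rule P_trans[OF _ b_X])

subsection \<open>Branches and hyperbolic elements\<close>

text \<open>The rigid stabiliser of a branch at the root: in the tree, the elements supported on the
  half-tree behind the neighbour of the empty word over \<open>l\<close>.\<close>

definition R :: "'a \<Rightarrow> ('b list \<Rightarrow> 'b list) set" where
  "R l = {g \<in> U. \<forall>w\<in>Y. \<not> starts l w \<longrightarrow> g w = w}"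

lemma R_U: "g \<in> R l \<Longrightarrow> g \<in> U" by (simp add: R_def)
lemma R_fix: "g \<in> R l \<Longrightarrow> w \<in> Y \<Longrightarrow> \<not> starts l w \<Longrightarrow> g w = w" by (simp add: R_def)

lemma R_inverse:
  assumes "g \<in> R l"
  shows "iv g \<in> R l"
proof -
  have "(iv g) w = w" if "w \<in> Y" "\<not> starts l w" for w
    using U_inv_apply(1)[OF R_U[OF assms] that(1)] unfolding R_fix[OF assms that] .
  then show ?thesis unfolding R_def using U_inverse[OF R_U[OF assms]] by simp
qed

text \<open>Products and inverses are those of the full symmetric group, so that elements of
  \<open>N\<close> and \<open>U\<close> can be mixed freely.\<close>

definition normal_in_U :: "('b list \<Rightarrow> 'b list) set \<Rightarrow> bool" where
  "normal_in_U N \<longleftrightarrow> subgroup N (BijGroup Y) \<and> N \<subseteq> U \<and>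
     (\<forall>g\<in>U. \<forall>n\<in>N. g \<cdot> n \<cdot> iv g \<in> N)"

lemma normal_in_UD:
  assumes "normal_in_U N"
  shows "subgroup N (BijGroup Y)" "N \<subseteq> U"
    "g \<in> U \<Longrightarrow> n \<in> N \<Longrightarrow> g \<cdot> n \<cdot> iv g \<in> N"
  using assms unfolding normal_in_U_def by auto

lemma conj_apply:
  assumes "g \<in> U" "n \<in> U" "w \<in> Y"
  shows "(g \<cdot> n \<cdot> iv g) w = g (n ((iv g) w))"
  using U_mult_apply[OF U_mult[OF assms(1,2)] U_inverse[OF assms(1)] assms(3)]
    U_mult_apply[OF assms(1,2) U_inv_apply(3)[OF assms(1,3)]] by simp

lemma starts_append: "z \<noteq> [] \<Longrightarrow> starts i (z @ w) \<longleftrightarrow> starts i z"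
  by (simp add: starts_def)

lemma ends_map: "map tp w' = map tp w \<Longrightarrow> ends i w' \<longleftrightarrow> ends i w"
  by (cases w rule: rev_cases; cases w' rule: rev_cases) (auto simp: ends_def)

lemma ends_append: "w \<noteq> [] \<Longrightarrow> ends i (z @ w) \<longleftrightarrow> ends i w"
  by (simp add: ends_def)

lemma ends_unique: "ends i w \<Longrightarrow> ends j w \<Longrightarrow> i = j"
  by (simp add: ends_def)

lemma type_in_I:
  assumes "w \<in> Y" "w \<noteq> []"
  shows "tp (hd w) \<in> I" "tp (last w) \<in> I"
  using assms hd_in_set[OF assms(2)] last_in_set[OF assms(2)] by (auto simp: Y_def)

text \<open>If \<open>n\<close> displaces the root along a path whose first and last arcs have the same type, a
  conjugate of \<open>n\<close> displaces it along a path of another type, and the product is hyperbolic.\<close>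

lemma exists_hyperbolic:
  assumes N: "normal_in_U N" and nt: "\<exists>n\<in>N. \<exists>w\<in>Y. n w \<noteq> w"
  obtains t i k where "t \<in> N" "i \<in> I" "k \<in> I" "i \<noteq> k" "starts i (t [])" "ends k (t [])"
proof -
  note Nsub = normal_in_UD(1)[OF N] and NU = subsetD[OF normal_in_UD(2)[OF N]]
    and Nconj = normal_in_UD(3)[OF N]
  obtain n y where n: "n \<in> N" "y \<in> Y" "n y \<noteq> y" using nt by blast
  have nU: "n \<in> U" by (rule NU[OF n(1)])
  obtain g where g: "g \<in> U" "g [] = y" using transitive_U[OF n(2)] by blast
  let ?g = "iv g"
  have gU: "?g \<in> U" by (rule U_inverse[OF g(1)])
  \<comment> \<open>Conjugation turns the word moved by \<open>n\<close> into the empty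
    word.\<close>
  define n1 where "n1 = ?g \<cdot> n \<cdot> iv ?g"
  have n1: "n1 \<in> N" unfolding n1_def by (rule Nconj[OF gU n(1)])
  have n1U: "n1 \<in> U" by (rule NU[OF n1])
  define z where "z = n1 []"
  have ginv: "(iv ?g) [] = y"
    using group.inv_inv[OF group_BijGroup, of g Y] U_Bij[OF g(1)] g(2) by simp
  have "n1 [] = ?g (n y)" unfolding n1_def conj_apply[OF gU nU Nil_Y] ginv ..
  then have "g z = n y" unfolding z_def using U_inv_apply(2)[OF g(1) U_Y[OF nU n(2)]] by simp
  then have zne: "z \<noteq> []" using g(2) n(3) by metis
  have zY: "z \<in> Y" unfolding z_def by (rule U_Y[OF n1U Nil_Y])
  define i where "i = tp (hd z)"
  have i: "i \<in> I" "starts i z" using type_in_I[OF zY zne] zne by (auto simp: i_def starts_def)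
  define j where "j = tp (last z)"
  have j: "j \<in> I" "ends j z" using type_in_I[OF zY zne] zne by (auto simp: j_def ends_def)
  show thesis
  proof (cases "i = j")
    case False
    show ?thesis using that[OF n1 i(1) j(1) False] i(2) j(2) by (simp add: z_def)
  next
    case True
    obtain k where k: "k \<in> I" "k \<noteq> i" using other_type[OF i(1)] by blast
    obtain x where x: "x \<in> X k" "x \<noteq> b k" using third_letter[OF k(1)] by blast
    have tx: "tp x = k" by (rule tp_X[OF k(1) x(1)])
    obtain p where p: "p \<in> P k" "p (b k) = x" using P_trans[OF k(1) b_X[OF k(1)] x(1)] by blast
    obtain q where q: "q \<in> P k" "\<forall>x\<in>X k. q (p x) = x" "\<forall>x\<in>X k. p (q x) = x"
      by (rule P_inverse[OF k(1) p(1)])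
    define x' where "x' = q (b k)"
    have x': "x' \<in> X k" "p x' = b k" unfolding x'_def
      using P_X[OF k(1) q(1) b_X[OF k(1)]] q(3) b_X[OF k(1)] by auto
    have x'b: "x' \<noteq> b k" using x' p(2) x(2) by metis
    have xY: "[x] \<in> Y" "[x'] \<in> Y"
      using x x' x'b tx tp_X[OF k(1) x'(1)] k(1) by (auto simp: Y_def)
    define u where "u = sec k p"
    have uU: "u \<in> U" unfolding u_def by (rule sec_U[OF k(1) p(1)])
    have u0: "u [] = [x]"
      using sec_Cons[where x = x and w = "[]" and p = p] xY(1) p(2) unfolding u_def tx by simp
    have ux': "u [x'] = []"
      using sec_cons[OF k(1) Nil_Y _ x'(1), of p] x'(2) x'b by (simp add: u_def cons_def)
    let ?u = "iv u"
    have uinv: "?u [] = [x']" using U_inv_apply(1)[OF uU xY(2)] unfolding ux' .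
    \<comment> \<open>Since \<open>u\<close> sends \<open>[x']\<close> to \<open>[]\<close> and
      \<open>[]\<close> to \<open>[x]\<close>, the word \<open>m []\<close> is
      \<open>u (n1 [x'])\<close>: the letter \<open>x\<close>, then letters of the types of
      \<open>z\<close>, then one letter of type \<open>k\<close>. It starts and ends in type
      \<open>k\<close>.\<close>
    define m where "m = u \<cdot> n1 \<cdot> ?u"
    have m: "m \<in> N" unfolding m_def by (rule Nconj[OF uU n1])
    have mU: "m \<in> U" by (rule NU[OF m])
    have nek: "\<not> ends k z" using ends_unique j(2) True k(2) by metis
    have sx': "starts k [x']" using tp_X[OF k(1) x'(1)] by (simp add: starts_def)
    obtain w1 where w1: "n1 [x'] = n1 [] @ w1" "map tp w1 = map tp [x']"
      using U_extend[OF n1U k(1) _ xY(2)] nek sx' unfolding z_def by blast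
    have w1k: "ends k w1" "w1 \<noteq> []"
      using ends_map[OF w1(2), of k] tp_X[OF k(1) x'(1)] w1(2) by (auto simp: ends_def)
    have v1Y: "z @ w1 \<in> Y" using U_Y[OF n1U xY(2)] unfolding w1(1) z_def .
    have v1s: "starts i (z @ w1)" using i(2) zne by (simp add: starts_append)
    have nei: "\<not> ends i (u [])" unfolding u0 using tx k(2) by (simp add: ends_def)
    obtain w2 where w2: "u (z @ w1) = u [] @ w2" "map tp w2 = map tp (z @ w1)"
      using U_extend[OF uU i(1) nei v1Y] v1s by blast
    have m0: "m [] = x # w2"
      unfolding m_def conj_apply[OF uU n1U Nil_Y] uinv w1(1) z_def[symmetric] w2(1) u0 by simp
    have w2k: "ends k w2" unfolding ends_map[OF w2(2)] using w1k by (simp add: ends_append)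
    have msk: "starts k (m [])" unfolding m0 using tx by (simp add: starts_def)
    have mek: "ends k (m [])" unfolding m0 using w2k by (simp add: ends_def)
    obtain w3 where w3: "n1 (m []) = n1 [] @ w3" "map tp w3 = map tp (m [])"
      using U_extend[OF n1U k(1) _ U_Y[OF mU Nil_Y]] nek msk unfolding z_def by blast
    \<comment> \<open>Applying \<open>n1\<close> to \<open>m []\<close> puts \<open>z\<close>, which
      starts in type \<open>i\<close>, in front of letters whose last type is still
      \<open>k\<close>; nothing folds back because \<open>z\<close> does not end in type
      \<open>k\<close>.\<close>
    define t where "t = n1 \<cdot> m"
    have t: "t \<in> N" unfolding t_def by (rule subgroup.m_closed[OF Nsub n1 m])
    have t0: "t [] = z @ w3"
      unfolding t_def U_mult_apply[OF n1U mU Nil_Y] w3(1) z_def ..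
    have w3k: "ends k w3" unfolding ends_map[OF w3(2)] by (rule mek)
    then have "w3 \<noteq> []" by (auto simp: ends_def)
    then have "ends k (t [])" unfolding t0 using w3k by (simp add: ends_append)
    moreover have "starts i (t [])" unfolding t0 using i(2) zne by (simp add: starts_append)
    ultimately show ?thesis using that[OF t i(1) k(1) k(2)[symmetric]] by simp
  qed
qed

lemma iterate_in_subgroup:
  assumes N: "subgroup N (BijGroup Y)" "N \<subseteq> U" and t: "t \<in> N"
  shows "\<exists>s\<in>N. \<forall>w\<in>Y. s w = (t ^^ m) w"
proof (induction m)
  case 0
  show ?case
    by (rule bexI[of _ "\<one>\<^bsub>BijGroup Y\<^esub>"]) (simp_all add: one_BijGroup subgroup.one_closed[OF N(1), unfolded one_BijGroup])
next
  case (Suc m)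
  then obtain s where s: "s \<in> N" "\<forall>w\<in>Y. s w = (t ^^ m) w" by blast
  have sU: "s \<in> U" and tU: "t \<in> U" using s(1) t N(2) by blast+
  have "\<forall>w\<in>Y. (t \<cdot> s) w = (t ^^ Suc m) w"
    using s(2) U_mult_apply[OF tU sU] by simp
  then show ?case using subgroup.m_closed[OF N(1) t s(1)] by blast
qed

text \<open>The powers of a hyperbolic element move a suitable branch off every finite set.\<close>

lemma displaced_branch:
  assumes N: "normal_in_U N" and nt: "\<exists>n\<in>N. \<exists>w\<in>Y. n w \<noteq> w" and l: "l \<in> I"
  obtains u where "u \<in> U"
    "\<forall>g\<in>R l. \<forall>F. finite F \<and> F \<subseteq> Y \<longrightarrow>
       (\<exists>s\<in>N. \<forall>w\<in>F. s (u (g ((iv u) ((iv s) w)))) = w)"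
proof -
  note Nsub = normal_in_UD(1)[OF N] and NsU = normal_in_UD(2)[OF N]
  obtain t i k where t: "t \<in> N" "i \<in> I" "k \<in> I" "i \<noteq> k" "starts i (t [])" "ends k (t [])"
    by (rule exists_hyperbolic[OF N nt])
  have tU: "t \<in> U" using t(1) NsU by blast
  define z where "z = t []"
  have zY: "z \<in> Y" unfolding z_def by (rule U_Y[OF tU Nil_Y])
  have zs: "starts i z" and ze: "ends k z" using t by (auto simp: z_def)
  have zne: "z \<noteq> []" using zs by (auto simp: starts_def)
  \<comment> \<open>The word \<open>y\<close> must diverge from \<open>z\<close>, so that no word
    extends both, and must not end in type \<open>l\<close>, so that an element taking the root to
    \<open>y\<close> carries the branch of type \<open>l\<close> beyond \<open>y\<close>. If
    \<open>l \<noteq> i\<close>, one letter other than the first of \<open>z\<close> will do;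
    otherwise the last letter of \<open>z\<close> is exchanged.\<close>
  have "\<exists>y\<in>Y. starts i y \<and> \<not> ends l y \<and> (\<forall>w w'. y @ w \<noteq> z @ w')"
  proof (cases "l = i")
    case False
    obtain c where c: "c \<in> X i" "c \<noteq> b i" "c \<noteq> hd z" using third_letter[OF t(2)] by blast
    have tc: "tp c = i" by (rule tp_X[OF t(2) c(1)])
    have "[c] \<in> Y" using c tc t(2) by (auto simp: Y_def)
    moreover have "starts i [c]" "\<not> ends l [c]" using tc False by (auto simp: starts_def ends_def)
    moreover have "[c] @ w \<noteq> z @ w'" for w w' using zne c(3) by (cases z) auto
    ultimately show ?thesis by blast
  next
    case True
    obtain c where c: "c \<in> X k" "c \<noteq> b k" "c \<noteq> last z" using third_letter[OF t(3)] by blast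
    have tc: "tp c = k" by (rule tp_X[OF t(3) c(1)])
    obtain v a where va: "z = v @ [a]" using zne by (metis rev_exhaust)
    have ta: "tp a = k" using ze unfolding va by (simp add: ends_def)
    have "v \<noteq> []" using zs ta t(4) unfolding va by (auto simp: starts_def)
    have vY: "v \<in> Y" "\<not> ends k v" using zY ta unfolding va Y_snoc by auto
    have "v @ [c] \<in> Y" unfolding Y_snoc using vY c tc t(3) by simp
    moreover have "starts i (v @ [c])" using zs \<open>v \<noteq> []\<close> unfolding va by (simp add: starts_append)
    moreover have "\<not> ends l (v @ [c])" using tc t(4) True by (simp add: ends_def)
    moreover have "(v @ [c]) @ w \<noteq> z @ w'" for w w' using c(3) unfolding va by simp
    ultimately show ?thesis by blast
  qed
  then obtain y where y: "y \<in> Y" "starts i y" "\<not> ends l y"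
    and yz: "\<And>w w'. y @ w \<noteq> z @ w'" by blast
  obtain u where u: "u \<in> U" "u [] = y" using transitive_U[OF y(1)] by blast
  define Q where "Q = {w \<in> Y. \<exists>w'. w = y @ w'}"
  have tnY: "(t ^^ m) w \<in> Y" if "w \<in> Y" for m w
    using that by (induction m) (auto intro: U_Y[OF tU])
  have neti: "\<not> ends i (t [])" using ends_unique t(4,6) by metis
  \<comment> \<open>\<open>t\<close> sends words that start in type \<open>i\<close> to extensions
    of \<open>z\<close>, and these start in type \<open>i\<close> again.\<close>
  have iter: "\<exists>w'. (t ^^ Suc m) w = z @ w'" if w: "w \<in> Y" "starts i w" for m w
  proof (induction m)
    case 0
    show ?case using U_extend[OF tU t(2) neti w(1)] w(2) unfolding z_def by auto
  next
    case (Suc m)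
    then have "starts i ((t ^^ Suc m) w)" using zs zne starts_append by metis
    from U_extend[OF tU t(2) neti tnY[OF w(1), of "Suc m"] disjI2[OF this]]
    show ?case unfolding z_def by auto
  qed
  have Qi: "w \<in> Y" "starts i w" if "w \<in> Q" for w
  proof -
    have "y \<noteq> []" using y(2) by (auto simp: starts_def)
    then show "w \<in> Y" "starts i w" using that y(2) unfolding Q_def by (auto simp: starts_append)
  qed
  have tinj: "w1 = w2" if "w1 \<in> Y" "w2 \<in> Y" "(t ^^ m) w1 = (t ^^ m) w2" for w1 w2 m
    using that
  proof (induction m)
    case (Suc m)
    have "t ((t ^^ m) w1) = t ((t ^^ m) w2)" using Suc.prems(3) by simp
    then have "(t ^^ m) w1 = (t ^^ m) w2"
      using inj_onD[OF Bij_inj[OF U_Bij[OF tU]] _ tnY tnY] Suc.prems(1,2) by blast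
    then show ?case using Suc.IH Suc.prems by blast
  qed simp
  \<comment> \<open>Ping-pong: cancelling \<open>t ^^ a\<close> would exhibit an extension of
    \<open>y\<close> that is also an extension of \<open>z\<close>.\<close>
  have disj: "(t ^^ a) w1 \<noteq> (t ^^ c) w2" if "a < c" "w1 \<in> Q" "w2 \<in> Q" for a c w1 w2
  proof
    assume eq: "(t ^^ a) w1 = (t ^^ c) w2"
    obtain d where d: "c = a + Suc d" using \<open>a < c\<close> less_imp_Suc_add by fastforce
    have "(t ^^ c) w2 = (t ^^ a) ((t ^^ Suc d) w2)" unfolding d funpow_add by simp
    then have "w1 = (t ^^ Suc d) w2"
      using eq tinj[OF Qi(1)[OF that(2)] tnY[OF Qi(1)[OF that(3)]]] by metis
    moreover have "\<exists>w'. (t ^^ Suc d) w2 = z @ w'" by (rule iter[OF Qi[OF that(3)]])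
    moreover have "\<exists>w''. w1 = y @ w''" using that(2) unfolding Q_def by blast
    ultimately show False using yz by metis
  qed
  \<comment> \<open>The translates of \<open>Q\<close> by powers of \<open>t\<close> are pairwise
    disjoint, so a finite set cannot meet all of them.\<close>
  have avoid: "\<exists>m. \<forall>w\<in>Q. (t ^^ m) w \<notin> F" if F: "finite F" for F
  proof (rule ccontr)
    assume "\<not> ?thesis"
    then have "\<forall>m. \<exists>w. w \<in> Q \<and> (t ^^ m) w \<in> F" by blast
    then obtain f where f: "\<And>m. f m \<in> Q" "\<And>m. (t ^^ m) (f m) \<in> F" by metis
    have "inj (\<lambda>m. (t ^^ m) (f m))"
    proof (rule injI, rule ccontr)
      fix a c assume ac: "(t ^^ a) (f a) = (t ^^ c) (f c)" "a \<noteq> c"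
      show False
      proof (cases "a < c")
        case True
        from disj[OF True f(1) f(1)] ac(1) show False by (rule notE)
      next
        case False
        then have "c < a" using ac(2) by simp
        from disj[OF this f(1) f(1)] ac(1)[symmetric] show False by (rule notE)
      qed
    qed
    moreover have "range (\<lambda>m. (t ^^ m) (f m)) \<subseteq> F" using f(2) by blast
    ultimately show False using F finite_imageD finite_subset infinite_UNIV_nat by blast
  qed
  \<comment> \<open>The conjugate of \<open>g\<close> by \<open>u\<close> is supported on
    \<open>Q\<close>, because \<open>u\<close> sends words that start in type \<open>l\<close> to
    extensions of \<open>y\<close>.\<close>
  have fixQ: "u (g ((iv u) w)) = w" if g: "g \<in> R l" and w: "w \<in> Y" "w \<notin> Q" for g w
  proof -
    define w1 where "w1 = (iv u) w"
    have w1: "w1 \<in> Y" "u w1 = w" unfolding w1_def using U_inv_apply[OF u(1) w(1)] by auto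
    have "\<not> starts l w1"
    proof
      assume s: "starts l w1"
      have "\<not> ends l (u [])" unfolding u(2) by (rule y(3))
      from U_extend[OF u(1) l this w1(1) disjI2[OF s]] have "\<exists>w'. w = u [] @ w'" unfolding w1(2) by metis
      then have "w \<in> Q" unfolding u(2) Q_def using w(1) by simp
      then show False using w(2) by simp
    qed
    then have "g w1 = w1" by (rule R_fix[OF g w1(1)])
    then show ?thesis using w1(2) by (simp add: w1_def)
  qed
  show thesis
  proof (rule that[OF u(1)], intro ballI allI impI)
    fix g F assume g: "g \<in> R l" and F: "finite F \<and> F \<subseteq> Y"
    obtain m where m: "\<forall>w\<in>Q. (t ^^ m) w \<notin> F" using avoid F by blast
    obtain s where s: "s \<in> N" "\<forall>w\<in>Y. s w = (t ^^ m) w"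
      using iterate_in_subgroup[OF Nsub NsU t(1)] by blast
    have sU: "s \<in> U" using s(1) NsU by blast
    have "s (u (g ((iv u) ((iv s) w)))) = w" if w: "w \<in> F" for w
    proof -
      define w0 where "w0 = (iv s) w"
      have wY: "w \<in> Y" using w F by blast
      have w0: "w0 \<in> Y" "s w0 = w" unfolding w0_def using U_inv_apply[OF sU wY] by auto
      then have "(t ^^ m) w0 \<in> F" using s(2) w by metis
      then have "w0 \<notin> Q" using m by blast
      from fixQ[OF g w0(1) this] w0(2) show ?thesis unfolding w0_def by simp
    qed
    then show "\<exists>s\<in>N. \<forall>w\<in>F. s (u (g ((iv u) ((iv s) w)))) = w"
      using s(1) by blast
  qed
qed

lemma branch_group_subset:
  assumes N: "normal_in_U N" and nt: "\<exists>n\<in>N. \<exists>w\<in>Y. n w \<noteq> w" and l: "l \<in> I"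
    and cl: "closedin (perm_topology Y) N"
  shows "R l \<subseteq> N"
proof
  fix g assume g: "g \<in> R l"
  interpret S: group "BijGroup Y" by (rule group_BijGroup)
  note Nsub = normal_in_UD(1)[OF N] and NsU = normal_in_UD(2)[OF N] and Nconj = normal_in_UD(3)[OF N]
  obtain u where u: "u \<in> U"
    "\<forall>g\<in>R l. \<forall>F. finite F \<and> F \<subseteq> Y \<longrightarrow>
       (\<exists>s\<in>N. \<forall>w\<in>F. s (u (g ((iv u) ((iv s) w)))) = w)"
    by (rule displaced_branch[OF N nt l])
  have gU: "g \<in> U" by (rule R_U[OF g])
  have c: "x \<in> carrier (BijGroup Y)" if "x \<in> U" for x using U_Bij[OF that] by simp
  define g' where "g' = u \<cdot> g \<cdot> iv u"
  have g'U: "g' \<in> U" unfolding g'_def by (intro U_mult U_inverse u gU)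
  have g'inv: "iv g' = u \<cdot> iv g \<cdot> iv u"
    unfolding g'_def using c[OF u(1)] c[OF gU] by (simp add: S.inv_mult_group S.m_assoc del: carrier_BijGroup)
  have "g' \<in> N"
  proof -
    have "\<exists>h\<in>N. \<forall>w\<in>F. h w = g' w" if F: "finite F \<and> F \<subseteq> Y" for F
    proof -
      obtain s where s: "s \<in> N"
        "\<forall>w\<in>F. s (u ((iv g) ((iv u) ((iv s) w)))) = w"
        using bspec[OF u(2) R_inverse[OF g]] F by blast
      have sU: "s \<in> U" using s(1) NsU by blast
      \<comment> \<open>The conjugate of \<open>iv g'\<close> by \<open>s\<close> is trivial on
        \<open>F\<close>, so the commutator \<open>?h\<close> agrees with \<open>g'\<close> on
        \<open>F\<close>. Regrouped as a conjugate of \<open>s\<close> times \<open>iv s\<close>,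
        the same commutator is seen to lie in \<open>N\<close>.\<close>
      let ?d = "s \<cdot> iv g' \<cdot> iv s"
      let ?h = "g' \<cdot> ?d"
      have dU: "?d \<in> U" by (intro U_mult U_inverse sU g'U)
      have "?h = (g' \<cdot> s \<cdot> iv g') \<cdot> iv s"
        using c[OF sU] c[OF g'U] by (simp add: S.m_assoc del: carrier_BijGroup)
      moreover have "(g' \<cdot> s \<cdot> iv g') \<cdot> iv s \<in> N"
        by (rule subgroup.m_closed[OF Nsub Nconj[OF g'U s(1)] subgroup.m_inv_closed[OF Nsub s(1)]])
      ultimately have hN: "?h \<in> N" by (simp only:)
      have "?h w = g' w" if w: "w \<in> F" for w
      proof -
        have wY: "w \<in> Y" using w F by blast
        have sw: "(iv s) w \<in> Y" by (rule U_inv_apply(3)[OF sU wY])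
        have "?d w = s ((iv g') ((iv s) w))"
          by (rule conj_apply[OF sU U_inverse[OF g'U] wY])
        also have "(iv g') ((iv s) w) =
            u ((iv g) ((iv u) ((iv s) w)))"
          unfolding g'inv by (rule conj_apply[OF u(1) U_inverse[OF gU] sw])
        also have "s \<dots> = w" by (rule bspec[OF s(2) w])
        finally have "?d w = w" .
        then show ?thesis using U_mult_apply[OF g'U dU wY] by simp
      qed
      then show ?thesis using hN by blast
    qed
    then show ?thesis using cl U_Bij[OF g'U] unfolding closedin_perm_topology_iff by blast
  qed
  then have "iv u \<cdot> g' \<cdot> iv (iv u) \<in> N"
    by (rule Nconj[OF U_inverse[OF u(1)]])
  moreover have "iv u \<cdot> g' \<cdot> iv (iv u) = g"
    unfolding g'_def using c[OF u(1)] c[OF gU]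
    by (simp add: S.m_assoc del: carrier_BijGroup) (simp add: S.m_assoc[symmetric] del: carrier_BijGroup)
  ultimately show "g \<in> N" by simp
qed

subsection \<open>The stabiliser of the empty word\<close>

text \<open>The part of a root-fixing \<open>u\<close> that acts on the branches with first type in
  \<open>J\<close>. That it again belongs to \<open>U\<close> is Tits' independence property at the
  root.\<close>

definition cut :: "'a set \<Rightarrow> ('b list \<Rightarrow> 'b list) \<Rightarrow> 'b list \<Rightarrow> 'b list" where
  "cut J u = (\<lambda>w\<in>Y. if w \<noteq> [] \<and> tp (hd w) \<in> J then u w else w)"

lemma map_tp_stabilizer:
  assumes "u \<in> U" "u [] = []" "w \<in> Y"
  shows "map tp (u w) = map tp w"
proof (cases "w = []")
  case False
  have "\<not> ends (tp (hd w)) (u [])" using assms(2) by simp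
  moreover have "starts (tp (hd w)) w" using False by (simp add: starts_def)
  ultimately show ?thesis
    using U_extend[OF assms(1) type_in_I(1)[OF assms(3) False] _ assms(3)] assms(2) by auto
qed (use assms in simp)

lemma stabilizer_hd:
  assumes "u \<in> U" "u [] = []" "w \<in> Y" "w \<noteq> []"
  shows "u w \<noteq> []" "tp (hd (u w)) = tp (hd w)"
proof -
  note m = map_tp_stabilizer[OF assms(1-3)]
  show "u w \<noteq> []" using m assms(4) by auto
  then show "tp (hd (u w)) = tp (hd w)" using m assms(4) by (metis hd_map)
qed

lemma cut_apply: "w \<in> Y \<Longrightarrow> cut J u w = (if w \<noteq> [] \<and> tp (hd w) \<in> J then u w else w)"
  by (simp add: cut_def)

text \<open>Every class lies in one branch, except those based at the empty word. Such a class of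
  type \<open>i\<close> consists of \<open>[]\<close>, which \<open>u\<close> fixes, and of words
  that start in type \<open>i\<close>; so \<open>u\<close> and the identity agree where they are
  glued.\<close>

lemma cut_U:
  assumes u: "u \<in> U" "u [] = []"
  shows "cut J u \<in> U"
proof (rule U_I)
  let ?v = "iv u"
  have v: "?v \<in> U" "?v [] = []"
    using U_inverse[OF u(1)] U_inv_apply(1)[OF u(1) Nil_Y] unfolding u(2) by auto
  have cY: "cut J x w \<in> Y" if "x \<in> U" "w \<in> Y" for x w
    using U_Y[OF that] that(2) by (simp add: cut_apply)
  have inv: "cut J y (cut J x w) = w"
    if x: "x \<in> U" "x [] = []" and w: "w \<in> Y" and yx: "\<And>w. w \<in> Y \<Longrightarrow> y (x w) = w" for x y w
  proof (cases "w \<noteq> [] \<and> tp (hd w) \<in> J")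
    case True
    then have "cut J x w = x w" using w by (simp add: cut_apply)
    moreover have "cut J y (x w) = y (x w)"
      using True stabilizer_hd[OF x w] U_Y[OF x(1) w] by (simp add: cut_apply)
    ultimately show ?thesis using yx[OF w] by simp
  next
    case False
    then have "cut J x w = w" for x using w by (auto simp: cut_apply)
    then show ?thesis by simp
  qed
  show "cut J u \<in> Bij Y"
  proof (rule BijI[where f' = "cut J ?v"])
    show "cut J u \<in> extensional Y" by (simp add: cut_def)
    fix w assume w: "w \<in> Y"
    show "cut J u w \<in> Y" "cut J ?v w \<in> Y" using cY u(1) v(1) w by blast+
    show "cut J ?v (cut J u w) = w" by (rule inv[OF u w]) (rule U_inv_apply(1)[OF u(1)])
    show "cut J u (cut J ?v w) = w" by (rule inv[OF v w]) (rule U_inv_apply(2)[OF u(1)])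
  qed
  fix i x assume ix: "i \<in> I" "x \<in> Y" "\<not> ends i x"
  obtain p y where p: "maps_class u p i x y" by (rule U_class[OF u(1) ix])
  have ident: "maps_class (cut J u) (\<lambda>a\<in>X i. a) i x x" if "\<And>a. a \<in> X i \<Longrightarrow> cut J u (app i x a) = app i x a"
    unfolding maps_class_def using that ix P_id[OF ix(1)] by simp
  have whole: "maps_class (cut J u) p i x y" if "\<And>a. a \<in> X i \<Longrightarrow> cut J u (app i x a) = u (app i x a)"
    using p that unfolding maps_class_def by simp
  show "\<exists>p y. maps_class (cut J u) p i x y"
  proof (cases "x = []")
    case True
    have tpa: "tp a = i" if "a \<in> X i" for a by (rule tp_X[OF ix(1) that])
    have aY: "app i [] a \<in> Y" if "a \<in> X i" for a by (rule app_Y[OF ix(1) Nil_Y _ that]) simp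
    show ?thesis
    proof (cases "i \<in> J")
      case i: True
      have "cut J u (app i x a) = u (app i x a)" if "a \<in> X i" for a
        using aY[OF that] tpa[OF that] i u(2) unfolding True by (auto simp: cut_apply app_def)
      from whole[OF this] show ?thesis by (intro exI)
    next
      case i: False
      have "cut J u (app i x a) = app i x a" if "a \<in> X i" for a
        using aY[OF that] tpa[OF that] i unfolding True by (auto simp: cut_apply app_def)
      from ident[OF this] show ?thesis by (intro exI)
    qed
  next
    case False
    have hd: "app i x a \<noteq> [] \<and> hd (app i x a) = hd x" for a using False by (simp add: app_def)
    show ?thesis
    proof (cases "tp (hd x) \<in> J")
      case i: True
      have "cut J u (app i x a) = u (app i x a)" if "a \<in> X i" for a
        using app_Y[OF ix that] hd i by (simp add: cut_apply)
      from whole[OF this] show ?thesis by (intro exI)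
    next
      case i: False
      have "cut J u (app i x a) = app i x a" if "a \<in> X i" for a
        using app_Y[OF ix that] hd i by (simp add: cut_apply)
      from ident[OF this] show ?thesis by (intro exI)
    qed
  qed
qed

text \<open>A root-fixing element is the product of its restrictions to the branches of the finitely
  many types, and the restriction to type \<open>l\<close> lies in \<open>R l\<close>.\<close>

lemma stabilizer_subset:
  assumes N: "subgroup N (BijGroup Y)" and R: "\<And>l. l \<in> I \<Longrightarrow> R l \<subseteq> N"
    and u: "u \<in> U" "u [] = []"
  shows "u \<in> N"
proof -
  have "cut J u \<in> N" if "finite J" "J \<subseteq> I" for J
    using that
  proof (induction J rule: finite_induct)
    case empty
    have "cut {} u = \<one>\<^bsub>BijGroup Y\<^esub>" by (simp add: cut_def one_BijGroup)
    then show ?case using subgroup.one_closed[OF N] by simp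
  next
    case (insert l J)
    have lR: "cut {l} u \<in> R l"
      using cut_U[OF u] by (auto simp: R_def cut_apply starts_def)
    have cJ: "cut J u \<in> U" and cl: "cut {l} u \<in> U" by (rule cut_U[OF u])+
    have "cut {l} u \<cdot> cut J u \<in> N"
      using subgroup.m_closed[OF N] R[of l] lR insert by blast
    moreover have "cut {l} u \<cdot> cut J u = cut (insert l J) u"
    proof (rule U_ext[OF U_mult[OF cl cJ] cut_U[OF u]])
      fix w assume w: "w \<in> Y"
      show "(cut {l} u \<cdot> cut J u) w = cut (insert l J) u w"
      proof (cases "w \<noteq> [] \<and> tp (hd w) \<in> J")
        case True
        then have "tp (hd w) \<noteq> l" using insert by auto
        then have "cut {l} u (u w) = u w"
          using True stabilizer_hd[OF u w] U_Y[OF u(1) w] by (simp add: cut_apply)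
        then show ?thesis using True w by (simp add: U_mult_apply[OF cl cJ] cut_apply)
      next
        case False
        then have "cut J u w = w" using w by (auto simp: cut_apply)
        then show ?thesis using False w by (auto simp: U_mult_apply[OF cl cJ] cut_apply)
      qed
    qed
    ultimately show ?case by (simp only:)
  qed
  from this[OF fin_I subset_refl] have "cut I u \<in> N" .
  moreover have "cut I u = u"
  proof (rule U_ext[OF cut_U[OF u] u(1)])
    fix w assume w: "w \<in> Y"
    show "cut I u w = u w" using type_in_I(1)[OF w] w u(2) by (cases "w = []") (simp_all add: cut_apply)
  qed
  ultimately show ?thesis by simp
qed

text \<open>The homomorphism \<open>sec i\<close> carries generators to generators. It is applied to
  the union of point stabilisers for simplicity and to a compact set for compact generation.\<close>

lemma sec_generate:
  assumes i: "i \<in> I" and K: "generate (BijGroup (X i)) K = P i" "K \<subseteq> P i"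
    and N: "subgroup N (BijGroup Y)" and KN: "\<And>k. k \<in> K \<Longrightarrow> sec i k \<in> N" and p: "p \<in> P i"
  shows "sec i p \<in> N"
proof -
  let ?A = "BijGroup (X i)\<lparr>carrier := P i\<rparr>"
  have gA: "group ?A" by (rule subgroup.subgroup_is_group[OF P_sub[OF i] group_BijGroup])
  have "sec i \<in> hom ?A (BijGroup Y)"
    by (rule homI) (simp_all add: sec_mult[OF i] sec_Bij[OF i])
  then have gh: "group_hom ?A (BijGroup Y) (sec i)"
    by (simp add: group_hom_def group_hom_axioms_def gA group_BijGroup)
  have "generate ?A K = P i"
    using group.generate_consistent[OF group_BijGroup K(2) P_sub[OF i]] K(1) by simp
  then have "sec i ` P i = generate (BijGroup Y) (sec i ` K)"
    using group_hom.generate_img[OF gh, of K] K(2) by simp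
  also have "\<dots> \<subseteq> N"
    by (rule group.generate_subgroup_incl[OF group_BijGroup _ N]) (use KN in blast)
  finally show ?thesis using p by blast
qed

lemma closed_normal_eq_U:
  assumes N: "normal_in_U N" and nt: "\<exists>n\<in>N. \<exists>w\<in>Y. n w \<noteq> w"
    and cl: "closedin (perm_topology Y) N"
  shows "N = U"
proof (rule contains_U_if)
  note Nsub = normal_in_UD(1)[OF N] and NsU = normal_in_UD(2)[OF N] and Nconj = normal_in_UD(3)[OF N]
  show "subgroup N (BijGroup Y)" "N \<subseteq> U" by (rule Nsub, rule NsU)
  show st: "u \<in> N" if "u \<in> U" "u [] = []" for u
    by (rule stabilizer_subset[OF Nsub _ that]) (rule branch_group_subset[OF N nt _ cl])
  \<comment> \<open>By transitivity the stabilisers of other words are conjugates of the root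
    stabiliser, and \<open>N\<close> is normal.\<close>
  have point: "u \<in> N" if u: "u \<in> U" "w \<in> Y" "u w = w" for u w
  proof -
    interpret S: group "BijGroup Y" by (rule group_BijGroup)
    have c: "x \<in> carrier (BijGroup Y)" if "x \<in> U" for x using U_Bij[OF that] by simp
    obtain g where g: "g \<in> U" "g [] = w" using transitive_U[OF u(2)] by blast
    let ?g = "iv g"
    define v where "v = ?g \<cdot> u \<cdot> g"
    have gu: "?g \<cdot> u \<in> U" by (intro U_mult U_inverse g u)
    have vU: "v \<in> U" unfolding v_def by (rule U_mult[OF gu g(1)])
    have "v [] = ?g (u (g []))"
      unfolding v_def U_mult_apply[OF gu g(1) Nil_Y] U_mult_apply[OF U_inverse[OF g(1)] u(1) U_Y[OF g(1) Nil_Y]] ..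
    also have "\<dots> = []" unfolding g(2) u(3) using U_inv_apply(1)[OF g(1) Nil_Y] unfolding g(2) .
    finally have "v \<in> N" by (rule st[OF vU])
    then have "g \<cdot> v \<cdot> ?g \<in> N" by (rule Nconj[OF g(1)])
    moreover have "g \<cdot> v \<cdot> ?g = u"
      unfolding v_def using c[OF g(1)] c[OF u(1)]
      by (simp add: S.m_assoc del: carrier_BijGroup) (simp add: S.m_assoc[symmetric] del: carrier_BijGroup)
    ultimately show ?thesis by simp
  qed
  have secN: "sec i p \<in> N" if i: "i \<in> I" and p: "p \<in> P i" for i p
  proof (rule sec_generate[OF i P_gen[OF i] _ Nsub _ p])
    show "(\<Union>x\<in>X i. {p \<in> P i. p x = x}) \<subseteq> P i" by blast
    fix k assume "k \<in> (\<Union>x\<in>X i. {p \<in> P i. p x = x})"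
    then obtain x where x: "x \<in> X i" "k \<in> P i" "k x = x" by blast
    \<comment> \<open>Through \<open>sec i\<close>, a point stabiliser of \<open>P i\<close> fixes a
      word with at most one letter.\<close>
    have "sec i k (cons i x []) = cons i x []"
      using sec_cons[OF i Nil_Y _ x(1), of k] x(3) by simp
    moreover have "cons i x [] \<in> Y" by (rule cons_Y[OF i Nil_Y _ x(1)]) simp
    ultimately show "sec i k \<in> N" using point[OF sec_U[OF i x(2)]] by blast
  qed
  show "\<exists>g\<in>N. g [] = w" if "w \<in> Y" for w
    by (rule transitive_on_words[OF _ secN NsU Nsub that]) (rule P_trans[OF _ b_X])
qed

section \<open>Finite orbits of stabilisers and closedness of the word group\<close>

lemma finite_P_orbit:
  assumes "i \<in> I" "x \<in> X i" "y \<in> X i"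
  shows "finite ((\<lambda>p. p y) ` {p \<in> P i. p x = x})"
proof -
  have "compactin (discrete_topology (X i)) ((\<lambda>p. p y) ` {p \<in> P i. p x = x})"
    by (rule image_compactin[OF P_comp[OF assms(1,2)] continuous_map_perm_eval[OF assms(3)]])
  then show ?thesis by (simp add: compactin_discrete_topology)
qed

text \<open>The image of \<open>w @ [x]\<close> is determined by the image of \<open>w\<close> and a
  letter \<open>p x\<close> with \<open>p\<close> fixing \<open>b j\<close>. The former ranges over
  a finite set by induction, the latter because point stabilisers in \<open>P j\<close> are
  compact.\<close>

lemma finite_stabilizer_orbit:
  "w \<in> Y \<Longrightarrow> finite ((\<lambda>g. g w) ` {g \<in> U. g [] = []})"
proof (induction w rule: rev_induct)
  case Nil
  have "(\<lambda>g. g []) ` {g \<in> U. g [] = []} \<subseteq> {[]}" by auto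
  then show ?case by (rule finite_subset) simp
next
  case (snoc x w)
  define j where "j = tp x"
  have wx: "w \<in> Y" "j \<in> I" "x \<in> X j" "x \<noteq> b j" "\<not> ends j w"
    using snoc.prems unfolding Y_snoc j_def by auto
  let ?A = "(\<lambda>g. g w) ` {g \<in> U. g [] = []}"
  let ?B = "(\<lambda>p. p x) ` {p \<in> P j. p (b j) = b j}"
  have "(\<lambda>g. g (w @ [x])) ` {g \<in> U. g [] = []} \<subseteq> (\<lambda>(v, y). app j v y) ` (?A \<times> ?B)"
  proof (rule image_subsetI)
    fix g assume "g \<in> {g \<in> U. g [] = []}"
    then have g: "g \<in> U" "g [] = []" by auto
    have "\<not> ends j (g w)" using wx(5) ends_map[OF map_tp_stabilizer[OF g wx(1)]] by simp
    from U_extend_letter[OF g(1) wx(2) wx(1) wx(5) this]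
    obtain p where p: "p \<in> P j" "p (b j) = b j" "\<forall>x\<in>X j. g (app j w x) = app j (g w) (p x)" .
    have "g (w @ [x]) = app j (g w) (p x)" using bspec[OF p(3) wx(3)] wx(4) by (simp add: app_def)
    moreover have "g w \<in> ?A" by (rule image_eqI[of _ _ g]) (use g in simp_all)
    moreover have "p x \<in> ?B" by (rule image_eqI[of _ _ p]) (use p in simp_all)
    ultimately show "g (w @ [x]) \<in> (\<lambda>(v, y). app j v y) ` (?A \<times> ?B)"
      by (intro image_eqI[of _ _ "(g w, p x)"]) simp_all
  qed
  moreover have "finite (?A \<times> ?B)"
    using snoc.IH[OF wx(1)] finite_P_orbit[OF wx(2) b_X[OF wx(2)] wx(3)] by simp
  then have "finite ((\<lambda>(v, y). app j v y) ` (?A \<times> ?B))" by (rule finite_imageI)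
  ultimately show ?case by (rule finite_subset)
qed

lemma U_base_iff:
  assumes "g \<in> U" "i \<in> I" "w \<in> Y" "w' \<in> Y"
  shows "base i (g w) = base i (g w') \<longleftrightarrow> base i w = base i w'"
proof
  assume "base i (g w) = base i (g w')"
  from U_base[OF U_inverse[OF assms(1)] assms(2) U_Y[OF assms(1,3)] U_Y[OF assms(1,4)] this]
  show "base i w = base i w'" unfolding U_inv_apply(1)[OF assms(1,3)] U_inv_apply(1)[OF assms(1,4)] .
qed (rule U_base[OF assms])

lemma maps_class_base:
  assumes "maps_class g p i u v" "i \<in> I" "x \<in> X i"
  shows "base i (g (app i u x)) = v" "col i (g (app i u x)) = p x"
proof -
  have g: "g (app i u x) = app i v (p x)" and v: "\<not> ends i v" and p: "p \<in> P i"
    using assms(1,3) unfolding maps_class_def by auto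
  show "base i (g (app i u x)) = v" "col i (g (app i u x)) = p x"
    unfolding g using base_app[OF assms(2) v] col_app[OF assms(2) v] P_X[OF assms(2) p assms(3)] by auto
qed

text \<open>A limit \<open>f\<close> still maps classes into classes, and its colour maps
  \<open>p\<close> are limits of elements of \<open>P i\<close>, so closedness of \<open>P i\<close>
  applies once \<open>p\<close> is known to be a permutation. Injectivity is inherited from the
  approximations, while surjectivity needs that of \<open>f\<close>.\<close>

lemma closed_U: "closedin (perm_topology Y) U"
  unfolding closedin_perm_topology_iff
proof (intro conjI ballI impI)
  show "U \<subseteq> Bij Y" using U_Bij by (rule subsetI)
  fix f assume f: "f \<in> Bij Y" and ap: "\<forall>F. finite F \<and> F \<subseteq> Y \<longrightarrow> (\<exists>a\<in>U. \<forall>x\<in>F. a x = f x)"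
  show "f \<in> U"
  proof (rule U_I[OF f])
    fix i u assume iu: "i \<in> I" "u \<in> Y" "\<not> ends i u"
    note bX = b_X[OF iu(1)]
    define v where "v = base i (f u)"
    define p where "p = (\<lambda>x\<in>X i. col i (f (app i u x)))"
    have fY: "f w \<in> Y" if "w \<in> Y" for w by (rule Bij_apply[OF f that])
    have vY: "v \<in> Y" "\<not> ends i v" unfolding v_def using base_Y[OF iu(1) fY[OF iu(2)]] by auto
    \<comment> \<open>Adding \<open>b i\<close> to \<open>F\<close> makes the approximating element
      agree with \<open>f\<close> at \<open>u\<close> itself, which determines the base of the image
      class.\<close>
    have approx: "\<exists>q\<in>P i. \<forall>x\<in>F. f (app i u x) = app i v (q x)" if F: "finite F" "F \<subseteq> X i" for F
    proof -
      have "app i u ` insert (b i) F \<subseteq> Y"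
        by (rule image_subsetI, rule app_Y[OF iu]) (use bX F(2) in auto)
      then have "finite (app i u ` insert (b i) F) \<and> app i u ` insert (b i) F \<subseteq> Y" using F(1) by simp
      from mp[OF spec[OF ap] this]
      obtain a where a: "a \<in> U" "\<forall>w\<in>app i u ` insert (b i) F. a w = f w" ..
      obtain q v' where q: "maps_class a q i u v'" by (rule U_class[OF a(1) iu])
      have "a u = f u" using a(2) by simp
      then have "v' = v" using maps_class_base(1)[OF q iu(1) bX] unfolding v_def by simp
      moreover have "f (app i u x) = app i v' (q x)" if "x \<in> F" for x
      proof -
        have "\<forall>x\<in>X i. a (app i u x) = app i v' (q x)" using q unfolding maps_class_def by simp
        from bspec[OF this] have "a (app i u x) = app i v' (q x)" using that F(2) by blast
        then show ?thesis using a(2) that by simp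
      qed
      moreover have "q \<in> P i" using q unfolding maps_class_def by simp
      ultimately show ?thesis by (intro bexI[of _ q] ballI) simp
    qed
    have fp: "f (app i u x) = app i v (p x)" "p x \<in> X i" if x: "x \<in> X i" for x
    proof -
      obtain q where q: "q \<in> P i" "f (app i u x) = app i v (q x)" using approx[of "{x}"] x by auto
      have "q x \<in> X i" by (rule P_X[OF iu(1) q(1) x])
      moreover have "p x = q x" unfolding p_def using x q(2) col_app[OF iu(1) vY(2) calculation] by simp
      ultimately show "f (app i u x) = app i v (p x)" "p x \<in> X i" using q(2) by auto
    qed
    have agree: "\<exists>q\<in>P i. \<forall>x\<in>F. q x = p x" if F: "finite F" "F \<subseteq> X i" for F
    proof -
      obtain q where q: "q \<in> P i" "\<forall>x\<in>F. f (app i u x) = app i v (q x)" using approx[OF F] by blast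
      have "\<forall>x\<in>F. q x = p x"
      proof
        fix x assume "x \<in> F"
        note that = this
        have x: "x \<in> X i" using that F by blast
        have "app i v (q x) = app i v (p x)"
          by (rule trans[OF bspec[OF q(2) that, symmetric] fp(1)[OF x]])
        then show "q x = p x"
          by (rule app_inj[OF iu(1) vY(2) P_X[OF iu(1) q(1) x] fp(2)[OF x]])
      qed
      then show ?thesis using q(1) by (rule bexI)
    qed
    have pB: "p \<in> Bij (X i)"
    proof -
      have "inj_on p (X i)"
      proof (rule inj_onI)
        fix x y assume xy: "x \<in> X i" "y \<in> X i" "p x = p y"
        have "finite {x, y}" "{x, y} \<subseteq> X i" using xy by simp_all
        from agree[OF this] obtain q where q: "q \<in> P i" "\<forall>z\<in>{x, y}. q z = p z" ..
        have "q x = q y" using q(2) xy(3) by simp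
        then show "x = y" by (rule P_inj[OF iu(1) q(1) xy(1,2)])
      qed
      \<comment> \<open>The preimage \<open>w\<close> of \<open>app i v y\<close> under
        \<open>f\<close> lies in the class of \<open>u\<close>, because an element of
        \<open>U\<close> that agrees with \<open>f\<close> at \<open>u\<close> and \<open>w\<close>
        both preserves and reflects equality of bases.\<close>
      moreover have "y \<in> p ` X i" if y: "y \<in> X i" for y
      proof -
        have zY: "app i v y \<in> Y" by (rule app_Y[OF iu(1) vY y])
        have "f ` Y = Y" using Bij_bij_betw[OF f] by (simp add: bij_betw_def)
        then have "app i v y \<in> f ` Y" using zY by simp
        then obtain w where w: "w \<in> Y" "f w = app i v y" by (metis imageE)
        have "finite {u, w} \<and> {u, w} \<subseteq> Y" using w(1) iu(2) by simp
        from mp[OF spec[OF ap] this] obtain a where a: "a \<in> U" "\<forall>x\<in>{u, w}. a x = f x" ..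
        have "base i (a w) = base i (a u)"
          using a(2) w(2) base_app[OF iu(1) vY(2) y] by (simp add: v_def)
        then have "base i w = u" using U_base_iff[OF a(1) iu(1) w(1) iu(2)] iu(3) by (simp add: base_def)
        then have wu: "w = app i u (col i w)" "col i w \<in> X i" using base_Y[OF iu(1) w(1)] by auto
        have "f w = app i v (p (col i w))" using fp(1)[OF wu(2)] unfolding wu(1)[symmetric] .
        then have "app i v (p (col i w)) = app i v y" unfolding w(2) by (rule sym)
        then have py: "p (col i w) = y"
          by (rule app_inj[OF iu(1) vY(2) fp(2)[OF wu(2)] y])
        have "p (col i w) \<in> p ` X i" using wu(2) by (rule imageI)
        then show ?thesis unfolding py .
      qed
      then have "X i \<subseteq> p ` X i" by (rule subsetI)
      moreover have "p ` X i \<subseteq> X i" using fp(2) by (rule image_subsetI)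
      moreover have "p \<in> extensional (X i)" by (simp add: p_def)
      ultimately show ?thesis unfolding Bij_def bij_betw_def by simp
    qed
    have cl: "\<forall>f\<in>Bij (X i). (\<forall>F. finite F \<and> F \<subseteq> X i \<longrightarrow> (\<exists>a\<in>P i. \<forall>x\<in>F. a x = f x)) \<longrightarrow> f \<in> P i"
      using P_closed[OF iu(1)] unfolding closedin_perm_topology_iff by (rule conjunct2)
    have "p \<in> P i"
      by (rule mp[OF bspec[OF cl pB]], intro allI impI, elim conjE) (rule agree)
    then have "maps_class f p i u v" unfolding maps_class_def using vY fp(1) by simp
    then show "\<exists>p v. maps_class f p i u v" by (intro exI)
  qed
qed

end

lemma closedin_perm_topology_point:
  assumes "x \<in> S" "y \<in> S"
  shows "closedin (perm_topology S) {h \<in> Bij S. h x = y}"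
proof -
  have "closedin (discrete_topology S) {y}" using assms by simp
  from closedin_continuous_map_preimage[OF continuous_map_perm_eval[OF assms(1)] this]
  show ?thesis by simp
qed

context word_group begin

definition root_stab :: "('b list \<Rightarrow> 'b list) set" where
  "root_stab = {g \<in> U. g [] = []}"

lemma closed_root_stab: "closedin (perm_topology Y) root_stab"
proof -
  have "root_stab = U \<inter> {h \<in> Bij Y. h [] = []}"
    unfolding root_stab_def using U_Bij by auto
  then show ?thesis
    using closedin_Int[OF closed_U closedin_perm_topology_point[OF Nil_Y Nil_Y]] by simp
qed

lemma compact_root_stab: "compactin (perm_topology Y) root_stab"
proof (rule compactin_perm_topology[OF closed_root_stab])
  show "subgroup root_stab (BijGroup Y)"
  proof (rule group.subgroupI[OF group_BijGroup])
    show "root_stab \<subseteq> carrier (BijGroup Y)" unfolding root_stab_def using U_Bij by auto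
    have "(\<lambda>w\<in>Y. w) \<in> root_stab" unfolding root_stab_def using U_one by simp
    then show "root_stab \<noteq> {}" by (metis empty_iff)
    fix g assume "g \<in> root_stab"
    then have g: "g \<in> U" "g [] = []" by (auto simp: root_stab_def)
    show "iv g \<in> root_stab"
      using U_inverse[OF g(1)] U_inv_apply(1)[OF g(1) Nil_Y] unfolding g(2) root_stab_def by simp
    fix h assume "h \<in> root_stab"
    then have h: "h \<in> U" "h [] = []" by (auto simp: root_stab_def)
    show "g \<cdot> h \<in> root_stab"
      using U_mult[OF g(1) h(1)] U_mult_apply[OF g(1) h(1) Nil_Y] unfolding h(2) g(2) root_stab_def by simp
  qed
  show "finite ((\<lambda>g. g w) ` root_stab)" if "w \<in> Y" for w
    unfolding root_stab_def by (rule finite_stabilizer_orbit[OF that])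
qed

definition class_kernel :: "'a \<Rightarrow> ('b list \<Rightarrow> 'b list) set" where
  "class_kernel i = {g \<in> U. \<forall>x\<in>X i. g (app i [] x) = app i [] x}"

text \<open>Fixing each word of the class includes fixing \<open>[]\<close>, the word of colour
  \<open>b i\<close>, so this is a closed subset of the compact root stabiliser.\<close>

lemma compact_class_kernel:
  assumes i: "i \<in> I"
  shows "compactin (perm_topology Y) (class_kernel i)"
proof -
  let ?C = "\<Inter>x\<in>X i. {h \<in> Bij Y. h (app i [] x) = app i [] x}"
  have aY: "app i [] x \<in> Y" if "x \<in> X i" for x by (rule app_Y[OF i Nil_Y _ that]) simp
  have "closedin (perm_topology Y) ?C"
  proof (rule closedin_INT)
    show "X i \<noteq> {}" using b_X[OF i] by (metis empty_iff)
    show "closedin (perm_topology Y) {h \<in> Bij Y. h (app i [] x) = app i [] x}" if "x \<in> X i" for x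
      by (rule closedin_perm_topology_point[OF aY[OF that] aY[OF that]])
  qed
  then have "compactin (perm_topology Y) (?C \<inter> root_stab)"
    by (rule closed_Int_compactin[OF _ compact_root_stab])
  moreover have "class_kernel i = ?C \<inter> root_stab"
  proof (rule equalityI; rule subsetI)
    fix g assume "g \<in> class_kernel i"
    then have g: "g \<in> U" "\<forall>x\<in>X i. g (app i [] x) = app i [] x" by (auto simp: class_kernel_def)
    have "g [] = []" using bspec[OF g(2) b_X[OF i]] by simp
    then show "g \<in> ?C \<inter> root_stab" using g U_Bij[OF g(1)] by (simp add: root_stab_def)
  next
    fix g assume g: "g \<in> ?C \<inter> root_stab"
    then show "g \<in> class_kernel i" by (simp add: class_kernel_def root_stab_def)
  qed
  ultimately show ?thesis by simp
qed

text \<open>The word \<open>sec i p w\<close> depends on \<open>p\<close> only through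
  \<open>p (head i w)\<close>.\<close>

lemma continuous_sec:
  assumes i: "i \<in> I"
  shows "continuous_map (subtopology (perm_topology (X i)) (P i)) (perm_topology Y) (sec i)"
  unfolding continuous_map_perm_topology_iff
proof (intro conjI ballI)
  let ?T = "subtopology (perm_topology (X i)) (P i)"
  have PB: "P i \<subseteq> Bij (X i)" using subgroup.subset[OF P_sub[OF i]] by simp
  then have ts: "topspace ?T = P i" by (simp add: topspace_subtopology Int_absorb1)
  show "sec i ` topspace ?T \<subseteq> Bij Y" unfolding ts by (rule image_subsetI) (rule sec_Bij[OF i])
  fix w v assume w: "w \<in> Y" and v: "v \<in> Y"
  note r = rest_Y[OF i w]
  let ?Z = "\<Union>x\<in>{x \<in> X i. cons i x (rest i w) = v}. {p \<in> P i. p (head i w) = x}"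
  have "{p \<in> P i. sec i p w = v} = ?Z"
  proof (rule equalityI; rule subsetI)
    fix p assume "p \<in> {p \<in> P i. sec i p w = v}"
    then have p: "p \<in> P i" "cons i (p (head i w)) (rest i w) = v" using w by (auto simp: sec_def)
    then show "p \<in> ?Z" using P_X[OF i p(1) r(3)] by simp
  next
    fix p assume "p \<in> ?Z"
    then have "p \<in> P i" "cons i (p (head i w)) (rest i w) = v" by auto
    then show "p \<in> {p \<in> P i. sec i p w = v}" using w by (simp add: sec_def)
  qed
  moreover have "openin ?T ?Z"
  proof (rule openin_Union)
    fix S assume "S \<in> (\<lambda>x. {p \<in> P i. p (head i w) = x}) ` {x \<in> X i. cons i x (rest i w) = v}"
    then obtain x where S: "S = {p \<in> P i. p (head i w) = x}" by blast
    have "S = {h \<in> Bij (X i). h (head i w) = x} \<inter> P i" unfolding S using PB by auto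
    then show "openin ?T S"
      unfolding openin_subtopology by (intro exI[of _ "{h \<in> Bij (X i). h (head i w) = x}"] conjI)
        (rule openin_perm_topology_point[OF r(3)])
  qed
  ultimately show "openin ?T {p \<in> topspace ?T. sec i p w = v}" unfolding ts by simp
qed

section \<open>Compact generation, nondiscreteness and simplicity of the word group\<close>

abbreviation UG where "UG \<equiv> BijGroup Y\<lparr>carrier := U\<rparr>"
abbreviation UT where "UT \<equiv> subtopology (perm_topology Y) U"

lemma topspace_UT: "topspace UT = U"
  using U_Bij by (auto simp: topspace_subtopology)

lemma compactin_UT: "compactin (perm_topology Y) C \<Longrightarrow> C \<subseteq> U \<Longrightarrow> compactin UT C"
  by (simp add: compactin_subtopology)

text \<open>The compact root stabiliser together with the images of compact generating sets of the
  finitely many \<open>P i\<close> suffices: the latter generate every \<open>sec i p\<close> and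
  hence a subgroup transitive on words.\<close>

lemma compactly_generated_U: "compactly_generated UG UT"
proof -
  have "\<forall>i\<in>I. \<exists>C. compactin (perm_topology (X i)) C \<and> generate (BijGroup (X i)) C = P i"
    using P_cg by blast
  from bchoice[OF this] obtain C where C: "\<forall>i\<in>I. compactin (perm_topology (X i)) (C i) \<and> generate (BijGroup (X i)) (C i) = P i" ..
  have CP: "C i \<subseteq> P i" if "i \<in> I" for i
  proof
    fix x assume "x \<in> C i"
    then have "x \<in> generate (BijGroup (X i)) (C i)" by (rule generate.incl)
    then show "x \<in> P i" using C that by simp
  qed
  define K where "K = root_stab \<union> (\<Union>i\<in>I. sec i ` C i)"
  have cs: "compactin (perm_topology Y) (sec i ` C i)" if i: "i \<in> I" for i
  proof (rule image_compactin[OF _ continuous_sec[OF i]])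
    show "compactin (subtopology (perm_topology (X i)) (P i)) (C i)"
      unfolding compactin_subtopology using C CP[OF i] i by simp
  qed
  have "compactin (perm_topology Y) K"
    unfolding K_def using compact_root_stab cs fin_I
    by (intro compactin_Un compactin_Union) auto
  moreover have KU: "K \<subseteq> U"
    unfolding K_def root_stab_def using sec_U CP by fast
  ultimately have "compactin UT K" by (rule compactin_UT)
  moreover have "generate UG K = carrier UG"
  proof -
    let ?N = "generate (BijGroup Y) K"
    have Kc: "K \<subseteq> carrier (BijGroup Y)" using KU U_Bij by auto
    have N: "subgroup ?N (BijGroup Y)" by (rule group.generate_is_subgroup[OF group_BijGroup Kc])
    have NU: "?N \<subseteq> U" by (rule group.generate_subgroup_incl[OF group_BijGroup KU U_subgroup])
    have inc: "k \<in> ?N" if "k \<in> K" for k using that by (rule generate.incl)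
    have secN: "sec i p \<in> ?N" if i: "i \<in> I" and p: "p \<in> P i" for i p
    proof (rule sec_generate[OF i _ CP[OF i] N _ p])
      show "generate (BijGroup (X i)) (C i) = P i" using C i by simp
      fix k assume "k \<in> C i"
      then have "sec i k \<in> K" unfolding K_def using i by blast
      then show "sec i k \<in> ?N" by (rule inc)
    qed
    have "?N = U"
    proof (rule contains_U_if[OF N NU])
      show "u \<in> ?N" if "u \<in> U" "u [] = []" for u
        by (rule inc) (simp add: K_def root_stab_def that)
      show "\<exists>g\<in>?N. g [] = w" if "w \<in> Y" for w
        by (rule transitive_on_words[OF _ secN NU N that]) (rule P_trans[OF _ b_X])
    qed
    then show ?thesis
      using group.generate_consistent[OF group_BijGroup KU U_subgroup] by simp
  qed
  ultimately show ?thesis unfolding compactly_generated_def by blast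
qed

lemma nontrivial_branch_element:
  assumes i: "i \<in> I"
  obtains g w where "g \<in> R i" "w \<in> Y" "g w \<noteq> w"
proof -
  obtain p y where p: "p \<in> P i" "p (b i) = b i" "y \<in> X i" "p y \<noteq> y" by (rule P_moves[OF i])
  have "sec i p w = w" if w: "w \<in> Y" "\<not> starts i w" for w
    using w p(2) by (simp add: sec_def head_def rest_def)
  then have "sec i p \<in> R i" unfolding R_def using sec_U[OF i p(1)] by simp
  moreover have "cons i y [] \<in> Y" by (rule cons_Y[OF i Nil_Y _ p(3)]) simp
  moreover have "sec i p (cons i y []) \<noteq> cons i y []"
  proof -
    have "p y \<noteq> b i" using P_inj[OF i p(1,3) b_X[OF i]] p(2,4) by metis
    moreover have "y \<noteq> b i" using p(2,4) by metis
    ultimately show ?thesis using sec_cons[OF i Nil_Y _ p(3), of p] p(4) by (simp add: cons_def)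
  qed
  ultimately show thesis by (rule that)
qed

lemma normal_in_U_U: "normal_in_U U"
  unfolding normal_in_U_def using U_subgroup U_mult U_inverse by simp

lemma U_moves: "\<exists>n\<in>U. \<exists>w\<in>Y. n w \<noteq> w"
proof -
  obtain i where i: "i \<in> I" using nonempty_I by blast
  obtain g w where "g \<in> R i" "w \<in> Y" "g w \<noteq> w" by (rule nontrivial_branch_element[OF i])
  then show ?thesis using R_U by metis
qed

text \<open>This gives nondiscreteness. With \<open>U\<close> as its own normal subgroup,
  \<open>displaced_branch\<close> conjugates a nontrivial branch element until its support misses
  \<open>F\<close>.\<close>

lemma nontrivial_small_element:
  assumes F: "finite F" "F \<subseteq> Y"
  shows "\<exists>h\<in>U. (\<forall>w\<in>F. h w = w) \<and> h \<noteq> \<one>\<^bsub>BijGroup Y\<^esub>"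
proof -
  obtain i where i: "i \<in> I" using nonempty_I by blast
  obtain g w where g: "g \<in> R i" "w \<in> Y" "g w \<noteq> w" by (rule nontrivial_branch_element[OF i])
  obtain u where u: "u \<in> U"
    "\<forall>g\<in>R i. \<forall>F. finite F \<and> F \<subseteq> Y \<longrightarrow>
       (\<exists>s\<in>U. \<forall>w\<in>F. s (u (g ((iv u) ((iv s) w)))) = w)"
    by (rule displaced_branch[OF normal_in_U_U U_moves i])
  have "finite F \<and> F \<subseteq> Y" using F by simp
  from mp[OF spec[OF bspec[OF u(2) g(1)]] this]
  obtain s where s: "s \<in> U" "\<forall>w\<in>F. s (u (g ((iv u) ((iv s) w)))) = w" ..
  have gU: "g \<in> U" by (rule R_U[OF g(1)])
  define g' where "g' = u \<cdot> g \<cdot> iv u"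
  define h where "h = s \<cdot> g' \<cdot> iv s"
  have g'U: "g' \<in> U" unfolding g'_def by (intro U_mult U_inverse u gU)
  have hU: "h \<in> U" unfolding h_def by (intro U_mult U_inverse s g'U)
  have happ: "h w = s (u (g ((iv u) ((iv s) w))))" if w: "w \<in> Y" for w
  proof -
    have "g' x = u (g ((iv u) x))" if "x \<in> Y" for x
      unfolding g'_def by (rule conj_apply[OF u(1) gU that])
    from this[OF U_inv_apply(3)[OF s(1) w]] show ?thesis
      unfolding h_def conj_apply[OF s(1) g'U w] by (rule arg_cong)
  qed
  have "\<forall>w\<in>F. h w = w"
  proof
    fix w assume w: "w \<in> F"
    then have "w \<in> Y" using F(2) by blast
    then show "h w = w" unfolding happ[OF \<open>w \<in> Y\<close>] using bspec[OF s(2) w] by simp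
  qed
  moreover have "h \<noteq> \<one>\<^bsub>BijGroup Y\<^esub>"
  proof
    assume h1: "h = \<one>\<^bsub>BijGroup Y\<^esub>"
    define v where "v = s (u w)"
    have uw: "u w \<in> Y" by (rule U_Y[OF u(1) g(2)])
    have v: "v \<in> Y" unfolding v_def by (rule U_Y[OF s(1) uw])
    have "h v = s (u (g w))"
      unfolding happ[OF v] unfolding v_def U_inv_apply(1)[OF s(1) uw] U_inv_apply(1)[OF u(1) g(2)] ..
    moreover have "h v = v" unfolding h1 using v by (simp add: one_BijGroup)
    ultimately have eq: "s (u (g w)) = s (u w)" unfolding v_def by simp
    have gw: "g w \<in> Y" by (rule U_Y[OF gU g(2)])
    have "u (g w) = u w"
      using arg_cong[OF eq, of "iv s"]
      unfolding U_inv_apply(1)[OF s(1) U_Y[OF u(1) gw]] U_inv_apply(1)[OF s(1) uw] .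
    from arg_cong[OF this, of "iv u"] have "g w = w"
      unfolding U_inv_apply(1)[OF u(1) gw] U_inv_apply(1)[OF u(1) g(2)] .
    with g(3) show False by (rule notE)
  qed
  ultimately show ?thesis using hU by blast
qed

theorem class_S_U: "class_S UG UT"
proof -
  have tg: "topological_group UG UT" by (rule topological_group_perm[OF U_subgroup])
  interpret T: topological_grp UG UT using tg by (rule topological_grpI)
  have "Hausdorff_space UT" by (intro Hausdorff_space_subtopology Hausdorff_perm_topology)
  moreover have "totally_disconnected UT"
    by (intro totally_disconnected_subtopology totally_disconnected_perm_topology)
  moreover have "locally_compact_space UT"
  proof (rule T.locally_compact_if_compact_open)
    show "compactin UT root_stab"
      by (rule compactin_UT[OF compact_root_stab]) (auto simp: root_stab_def)
    have "root_stab = {h \<in> Bij Y. h [] = []} \<inter> U"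
      unfolding root_stab_def using subgroup.subset[OF U_subgroup] by auto
    then show "openin UT root_stab"
      unfolding openin_subtopology by (intro exI[of _ "{h \<in> Bij Y. h [] = []}"] conjI)
        (rule openin_perm_topology_point[OF Nil_Y])
    show "\<one>\<^bsub>UG\<^esub> \<in> root_stab" using U_one by (simp add: root_stab_def one_BijGroup)
  qed
  moreover have "UT \<noteq> discrete_topology (carrier UG)"
  proof
    assume "UT = discrete_topology (carrier UG)"
    moreover have "openin (discrete_topology (carrier UG)) {\<one>\<^bsub>UG\<^esub>}" using T.one_closed by simp
    ultimately have "openin UT {\<one>\<^bsub>UG\<^esub>}" by (simp only:)
    then obtain T where T: "openin (perm_topology Y) T" "{\<one>\<^bsub>UG\<^esub>} = T \<inter> U"
      unfolding openin_subtopology by blast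
    have one: "\<one>\<^bsub>UG\<^esub> = \<one>\<^bsub>BijGroup Y\<^esub>" by simp
    have oneT: "\<one>\<^bsub>BijGroup Y\<^esub> \<in> T" using T(2) unfolding one by blast
    have nb: "\<forall>g\<in>T. \<exists>F. finite F \<and> F \<subseteq> Y \<and> {h \<in> Bij Y. \<forall>x\<in>F. h x = g x} \<subseteq> T"
      using T(1) unfolding openin_perm_topology_iff by (rule conjunct2)
    from bspec[OF nb oneT]
    obtain F where F: "finite F \<and> F \<subseteq> Y \<and> {h \<in> Bij Y. \<forall>x\<in>F. h x = \<one>\<^bsub>BijGroup Y\<^esub> x} \<subseteq> T" ..
    then have F: "finite F" "F \<subseteq> Y" "{h \<in> Bij Y. \<forall>x\<in>F. h x = \<one>\<^bsub>BijGroup Y\<^esub> x} \<subseteq> T"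
      by auto
    from nontrivial_small_element[OF F(1,2)]
    obtain h where h: "h \<in> U" "(\<forall>w\<in>F. h w = w) \<and> h \<noteq> \<one>\<^bsub>BijGroup Y\<^esub>" ..
    then have h: "h \<in> U" "\<forall>w\<in>F. h w = w" "h \<noteq> \<one>\<^bsub>BijGroup Y\<^esub>" by auto
    have "\<forall>x\<in>F. h x = \<one>\<^bsub>BijGroup Y\<^esub> x" using h(2) F(2) by (auto simp: one_BijGroup)
    then have "h \<in> T" using F(3) U_Bij[OF h(1)] by blast
    then have "h \<in> {\<one>\<^bsub>UG\<^esub>}" unfolding T(2) using h(1) by simp
    then show False using h(3) by simp
  qed
  moreover have "topologically_simple UG UT"
    unfolding topologically_simple_def
  proof (intro conjI allI impI)
    show "carrier UG \<noteq> {\<one>\<^bsub>UG\<^esub>}"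
    proof
      assume eq: "carrier UG = {\<one>\<^bsub>UG\<^esub>}"
      obtain n w where n: "n \<in> U" "w \<in> Y" "n w \<noteq> w" using U_moves by blast
      have "n = \<one>\<^bsub>BijGroup Y\<^esub>" using n(1) eq by simp
      then show False using n(2,3) by (simp add: one_BijGroup)
    qed
    fix N assume N: "N \<lhd> UG \<and> closedin UT N"
    have sN: "subgroup N UG" using N normal_imp_subgroup by blast
    have NU: "N \<subseteq> U" using subgroup.subset[OF sN] by simp
    have sNB: "subgroup N (BijGroup Y)"
      using group.incl_subgroup[OF group_BijGroup U_subgroup] sN by blast
    have inv: "inv\<^bsub>UG\<^esub> g = iv g" if "g \<in> U" for g
      using group.m_inv_consistent[OF group_BijGroup U_subgroup that] by simp
    have conj: "g \<cdot> n \<cdot> iv g \<in> N" if "g \<in> U" "n \<in> N" for g n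
      using T.normal_invE(2)[OF conjunct1[OF N], of g n] that unfolding inv[OF that(1)] by simp
    have norm: "normal_in_U N"
      unfolding normal_in_U_def using sNB NU conj by simp
    \<comment> \<open>\<open>U\<close> is closed among all permutations, so closedness relative to
      \<open>U\<close> is absolute.\<close>
    have cl: "closedin (perm_topology Y) N"
      using closedin_trans_full conjunct2[OF N] closed_U by blast
    show "N = {\<one>\<^bsub>UG\<^esub>} \<or> N = carrier UG"
    proof (cases "\<exists>n\<in>N. \<exists>w\<in>Y. n w \<noteq> w")
      case True
      then show ?thesis using closed_normal_eq_U[OF norm True cl] by simp
    next
      case False
      have "n = \<one>\<^bsub>BijGroup Y\<^esub>" if n: "n \<in> N" for n
      proof (rule Bij_ext)
        show "n \<in> Bij Y" using n NU U_Bij by blast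
        show "\<one>\<^bsub>BijGroup Y\<^esub> \<in> Bij Y" using id_Bij by (simp add: one_BijGroup)
        show "n w = \<one>\<^bsub>BijGroup Y\<^esub> w" if "w \<in> Y" for w
          using False n that by (simp add: one_BijGroup)
      qed
      then have "N \<subseteq> {\<one>\<^bsub>UG\<^esub>}" by auto
      moreover have "\<one>\<^bsub>UG\<^esub> \<in> N" using subgroup.one_closed[OF sN] .
      ultimately have "N = {\<one>\<^bsub>UG\<^esub>}" by blast
      then show ?thesis by (rule disjI1)
    qed
  qed
  ultimately show ?thesis
    unfolding class_S_def tdlc_group_def using tg compactly_generated_U by argo
qed

end

section \<open>The local action diagram and its tree\<close>

lemma walk_nth:
  assumes "walk \<Gamma> u as w" "k < length as"
  shows "as ! k \<in> arcs \<Gamma>"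
    "targ \<Gamma> (as ! k) = (if Suc k < length as then orig \<Gamma> (as ! Suc k) else w)"
  using assms
proof (induction as arbitrary: u k)
  case (Cons a as)
  {
    case 1
    then show ?case using Cons.IH(1)[of "targ \<Gamma> a" "k - 1"] by (cases k) (auto simp: arcs_at_def)
  next
    case 2
    show ?case
    proof (cases k)
      case 0
      then show ?thesis using 2 by (cases as) (auto simp: arcs_at_def)
    next
      case (Suc m)
      then show ?thesis using 2 Cons.IH(2)[of "targ \<Gamma> a" m] by auto
    qed
  }
qed simp_all

text \<open>In a cycle, a vertex of maximal depth would have two distinct neighbours of smaller depth.\<close>

lemma no_cycle_if_depth:
  fixes d :: "'v \<Rightarrow> nat"
  assumes gr: "is_graph \<Gamma>"
    and neq: "\<And>a. a \<in> arcs \<Gamma> \<Longrightarrow> d (orig \<Gamma> a) \<noteq> d (targ \<Gamma> a)"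
    and parent: "\<And>a a'. a \<in> arcs \<Gamma> \<Longrightarrow> a' \<in> arcs \<Gamma> \<Longrightarrow> orig \<Gamma> a = orig \<Gamma> a' \<Longrightarrow>
      d (targ \<Gamma> a) < d (orig \<Gamma> a) \<Longrightarrow> d (targ \<Gamma> a') < d (orig \<Gamma> a) \<Longrightarrow> targ \<Gamma> a = targ \<Gamma> a'"
  shows "\<not> has_cycle \<Gamma>"
proof
  assume "has_cycle \<Gamma>"
  then obtain u as where len: "3 \<le> length as" and w: "walk \<Gamma> u as u"
    and dist: "distinct (map (orig \<Gamma>) as)"
    unfolding has_cycle_def by blast
  define n where "n = length as"
  have n3: "3 \<le> n" using len by (simp add: n_def)
  define o' where "o' = (\<lambda>k. orig \<Gamma> (as ! k))"
  define nx where "nx = (\<lambda>k. if Suc k < n then Suc k else 0)"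
  define pv where "pv = (\<lambda>k. if k = 0 then n - 1 else k - 1)"
  have inA: "as ! k \<in> arcs \<Gamma>" if "k < n" for k using walk_nth(1)[OF w] that by (simp add: n_def)
  have o0: "o' 0 = u" using w n3 by (cases as) (auto simp: o'_def n_def arcs_at_def)
  have tg: "targ \<Gamma> (as ! k) = o' (nx k)" if "k < n" for k
    using walk_nth(2)[OF w, of k] that o0 by (simp add: o'_def nx_def n_def)
  have "\<exists>k<n. \<forall>m<n. d (o' m) \<le> d (o' k)"
  proof -
    let ?D = "(\<lambda>m. d (o' m)) ` {..<n}"
    have fin: "finite ?D" by simp
    have "d (o' 0) \<in> ?D" using n3 by simp
    then have "?D \<noteq> {}" by (metis empty_iff)
    then have "Max ?D \<in> ?D" by (rule Max_in[OF fin])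
    then obtain k where k: "Max ?D = d (o' k)" "k < n" by auto
    have "d (o' m) \<le> d (o' k)" if "m < n" for m
      unfolding k(1)[symmetric] by (rule Max_ge[OF fin]) (use that in simp)
    then show ?thesis using k(2) by blast
  qed
  then obtain k where k: "k < n" "\<forall>m<n. d (o' m) \<le> d (o' k)" by blast
  have nk: "nx k < n" "pv k < n" "nx (pv k) = k" using k(1) n3 by (auto simp: nx_def pv_def)
  \<comment> \<open>A cycle has at least three arcs, so the two cyclic neighbours of position
    \<open>k\<close> are different positions.\<close>
  have ne: "nx k \<noteq> pv k" using k(1) n3 by (auto simp: nx_def pv_def)
  let ?r = "arev \<Gamma> (as ! pv k)"
  have r: "?r \<in> arcs \<Gamma>" "orig \<Gamma> ?r = o' k" "targ \<Gamma> ?r = o' (pv k)"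
    using gr inA[OF nk(2)] tg[OF nk(2)] nk(3) by (auto simp: is_graph_def targ_def o'_def)
  have a: "as ! k \<in> arcs \<Gamma>" "orig \<Gamma> (as ! k) = o' k" "targ \<Gamma> (as ! k) = o' (nx k)"
    using inA[OF k(1)] tg[OF k(1)] by (auto simp: o'_def)
  have l1: "d (o' (nx k)) < d (o' k)" using k(2) nk(1) neq[OF a(1)] a(2,3) by (simp add: order.strict_iff_order)
  have l2: "d (o' (pv k)) < d (o' k)" using k(2) nk(2) neq[OF r(1)] r(2,3) by (simp add: order.strict_iff_order)
  have "o' (nx k) = o' (pv k)" using parent[OF a(1) r(1)] a(2,3) r(2,3) l1 l2 by simp
  then show False
    using nth_eq_iff_index_eq[OF dist, of "nx k" "pv k"] nk(1,2) ne by (simp add: o'_def n_def)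
qed

text \<open>The number 0 is kept free for the centre, both as a vertex and as the tag of the colours
  on the arcs leaving it; this separates them from the leaves and from the sets
  \<open>X i\<close>.\<close>

locale diagram_group = word_group I X P b "\<lambda>x. fst (prod_decode x)"
  for I :: "nat set" and X :: "nat \<Rightarrow> nat set" and P b +
  assumes zero: "0 \<notin> I"
begin

abbreviation tp :: "nat \<Rightarrow> nat" where "tp \<equiv> \<lambda>x. fst (prod_decode x)"

text \<open>The diagram is a star: the centre \<open>0\<close> has trivial local group and one colour for each arc,
  and the leaf \<open>i\<close> has local group \<open>P i\<close>. The arc between \<open>0\<close> and \<open>i\<close> is \<open>da i False\<close>, its reverse
  is \<open>da i True\<close>. The vertices of the tree over \<open>0\<close> are the reduced words, those over \<open>i\<close> the
  classes of type \<open>i\<close>.\<close>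

definition da :: "nat \<Rightarrow> bool \<Rightarrow> nat" where "da i e = to_nat (i, e)"
definition cv :: "nat list \<Rightarrow> nat" where "cv w = to_nat (w, 0::nat)"
definition lv :: "nat list \<Rightarrow> nat \<Rightarrow> nat" where "lv u i = to_nat (u, i)"
text \<open>The edge between the word \<open>w\<close> and its class of type \<open>i\<close>; as
  for \<open>da\<close>, the value \<open>True\<close> marks the arc that starts on the leaf
  side.\<close>

definition ar :: "nat list \<Rightarrow> nat \<Rightarrow> bool \<Rightarrow> nat" where "ar w i e = to_nat (w, i, e)"

section \<open>The star-shaped diagram and its word graph\<close>

lemma da_inject [simp]: "da i e = da j e' \<longleftrightarrow> i = j \<and> e = e'" by (simp add: da_def)
lemma cv_inject [simp]: "cv w = cv w' \<longleftrightarrow> w = w'" by (simp add: cv_def)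
lemma lv_inject [simp]: "lv u i = lv u' j \<longleftrightarrow> u = u' \<and> i = j" by (simp add: lv_def)
lemma ar_inject [simp]: "ar w i e = ar w' j e' \<longleftrightarrow> w = w' \<and> i = j \<and> e = e'" by (simp add: ar_def)

lemma cv_neq_lv: "i \<in> I \<Longrightarrow> cv w \<noteq> lv u i" "i \<in> I \<Longrightarrow> lv u i \<noteq> cv w"
  using zero by (cases "i = 0"; simp add: cv_def lv_def)+

definition \<Delta> :: "(nat, nat, nat) action_diagram" where
  "\<Delta> = \<lparr>verts = insert 0 I, arcs = {da i e |i e. i \<in> I},
    orig = (\<lambda>a. case from_nat a of (i::nat, e) \<Rightarrow> if e then i else 0),
    arev = (\<lambda>a. case from_nat a of (i, e) \<Rightarrow> da i (\<not> e)),
    colours = (\<lambda>a. case from_nat a of (i, e) \<Rightarrow> if e then X i else {prod_encode (0, i)}),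
    local_group = (\<lambda>v. if v = 0 then {\<lambda>x\<in>(\<lambda>i. prod_encode (0, i)) ` I. x} else P v)\<rparr>"

definition T :: "(nat, nat, nat, nat, nat) labelled_tree" where
  "T = \<lparr>verts = cv ` Y \<union> {lv u i |u i. u \<in> Y \<and> i \<in> I \<and> \<not> ends i u},
    arcs = {ar w i e |w i e. w \<in> Y \<and> i \<in> I},
    orig = (\<lambda>a. case from_nat a of (w, i, e) \<Rightarrow> if e then lv (base i w) i else cv w),
    arev = (\<lambda>a. case from_nat a of (w, i, e) \<Rightarrow> ar w i (\<not> e)),
    vproj = (\<lambda>v. snd (from_nat v :: nat list \<times> nat)),
    aproj = (\<lambda>a. case from_nat a of (w :: nat list, i, e) \<Rightarrow> da i e),
    label = (\<lambda>a. case from_nat a of (w, i, e) \<Rightarrow> if e then col i w else prod_encode (0, i))\<rparr>"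

lemma diagram_simps [simp]:
  "verts \<Delta> = insert 0 I" "arcs \<Delta> = {da i e |i e. i \<in> I}"
  "orig \<Delta> (da i e) = (if e then i else 0)" "arev \<Delta> (da i e) = da i (\<not> e)"
  "colours \<Delta> (da i e) = (if e then X i else {prod_encode (0, i)})"
  "targ \<Delta> (da i e) = (if e then 0 else i)"
  by (simp_all add: \<Delta>_def da_def targ_def)

lemma tree_simps [simp]:
  "orig T (ar w i e) = (if e then lv (base i w) i else cv w)" "arev T (ar w i e) = ar w i (\<not> e)"
  "targ T (ar w i e) = (if e then cv w else lv (base i w) i)"
  "vproj T (cv w) = 0" "vproj T (lv u i) = i" "aproj T (ar w i e) = da i e"
  "label T (ar w i e) = (if e then col i w else prod_encode (0, i))"
  by (simp_all add: T_def ar_def cv_def lv_def targ_def)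

lemma verts_T: "verts T = cv ` Y \<union> {lv u i |u i. u \<in> Y \<and> i \<in> I \<and> \<not> ends i u}"
  and arcs_T: "arcs T = {ar w i e |w i e. w \<in> Y \<and> i \<in> I}"
  by (simp_all add: T_def)

lemma vert_cases:
  assumes "v \<in> verts T"
  obtains (centre) w where "v = cv w" "w \<in> Y" | (leaf) u i where "v = lv u i" "u \<in> Y" "i \<in> I" "\<not> ends i u"
  using assms unfolding verts_T by blast

lemma arc_cases:
  assumes "a \<in> arcs T"
  obtains w i e where "a = ar w i e" "w \<in> Y" "i \<in> I"
  using assms unfolding arcs_T by blast

lemma cv_T: "w \<in> Y \<Longrightarrow> cv w \<in> verts T" by (simp add: verts_T)
lemma lv_T: "u \<in> Y \<Longrightarrow> i \<in> I \<Longrightarrow> \<not> ends i u \<Longrightarrow> lv u i \<in> verts T" by (auto simp: verts_T)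
lemma ar_T: "w \<in> Y \<Longrightarrow> i \<in> I \<Longrightarrow> ar w i e \<in> arcs T" by (auto simp: arcs_T)

lemma base_fix: "\<not> ends i u \<Longrightarrow> base i u = u" by (simp add: base_def)

lemma arcs_at_cv: "w \<in> Y \<Longrightarrow> arcs_at T (cv w) = {ar w i False |i. i \<in> I}"
  unfolding arcs_at_def arcs_T using cv_neq_lv by (auto split: if_splits)

lemma arcs_at_lv: "i \<in> I \<Longrightarrow> arcs_at T (lv u i) = {ar w i True |w. w \<in> Y \<and> base i w = u}"
  unfolding arcs_at_def arcs_T using cv_neq_lv by (auto split: if_splits)

lemma arcs_at_centre: "arcs_at \<Delta> 0 = {da i False |i. i \<in> I}"
  using zero by (auto simp: arcs_at_def split: if_splits)

lemma arcs_at_leaf: "i \<in> I \<Longrightarrow> arcs_at \<Delta> i = {da i True}"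
  using zero by (auto simp: arcs_at_def split: if_splits)

lemma vertex_colours_centre: "vertex_colours \<Delta> 0 = (\<lambda>i. prod_encode (0, i)) ` I"
  unfolding vertex_colours_def arcs_at_centre by auto

lemma vertex_colours_leaf: "i \<in> I \<Longrightarrow> vertex_colours \<Delta> i = X i"
  unfolding vertex_colours_def by (simp add: arcs_at_leaf)

lemma local_group_centre: "local_group \<Delta> 0 = {\<lambda>x\<in>vertex_colours \<Delta> 0. x}"
  unfolding vertex_colours_centre by (simp add: \<Delta>_def)

lemma local_group_leaf: "i \<in> I \<Longrightarrow> local_group \<Delta> i = P i"
  using zero by (auto simp: \<Delta>_def)

lemma local_action_diagram: "local_action_diagram \<Delta>"
  unfolding local_action_diagram_def
proof (intro conjI ballI)
  show "is_graph \<Delta>" using zero by (auto simp: is_graph_def)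
  have w1: "walk \<Delta> 0 [da i False] i" "walk \<Delta> i [da i True] 0" if "i \<in> I" for i
    using that by (auto simp: arcs_at_def)
  have w2: "walk \<Delta> i [da i True, da j False] j" if "i \<in> I" "j \<in> I" for i j
    using that by (auto simp: arcs_at_def)
  have w0: "walk \<Delta> 0 [] 0" by simp
  show "graph_connected \<Delta>"
    unfolding graph_connected_def
  proof (intro ballI)
    fix u w assume "u \<in> verts \<Delta>" "w \<in> verts \<Delta>"
    then have "u = 0 \<or> u \<in> I" "w = 0 \<or> w \<in> I" by auto
    then consider "u = 0" "w = 0" | "u = 0" "w \<in> I" | "u \<in> I" "w = 0" | "u \<in> I" "w \<in> I" by blast
    then show "\<exists>as. walk \<Delta> u as w"
    proof cases
      case 1
      then show ?thesis using w0 by (intro exI[of _ "[]"]) (simp only:)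
    next
      case 2
      then show ?thesis using w1(1) by (intro exI[of _ "[da w False]"]) (simp only:)
    next
      case 3
      then show ?thesis using w1(2) by (intro exI[of _ "[da u True]"]) (simp only:)
    next
      case 4
      show ?thesis by (rule exI, rule w2[OF 4])
    qed
  qed
  show "colours \<Delta> a \<noteq> {}" if "a \<in> arcs \<Delta>" for a
  proof -
    from that obtain i e where a: "a = da i e" "i \<in> I" by auto
    have "X i \<noteq> {}" using b_X[OF a(2)] by (metis empty_iff)
    then show ?thesis by (simp add: a(1))
  qed
  show "disjoint_family_on (colours \<Delta>) (arcs \<Delta>)"
    unfolding disjoint_family_on_def
  proof (intro ballI impI)
    fix a a' assume a: "a \<in> arcs \<Delta>" "a' \<in> arcs \<Delta>" "a \<noteq> a'"
    obtain i e where ie: "a = da i e" "i \<in> I" using a(1) by auto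
    obtain j e' where je: "a' = da j e'" "j \<in> I" using a(2) by auto
    \<comment> \<open>The tag of a colour names the origin of its arc, and arcs leaving the centre
      are told apart by their single colours.\<close>
    have "tp x = (if e then i else 0)" if "x \<in> colours \<Delta> a" for x
      using that tp_X[OF ie(2), of x] unfolding ie(1) by (auto split: if_splits)
    moreover have "tp x = (if e' then j else 0)" if "x \<in> colours \<Delta> a'" for x
      using that tp_X[OF je(2), of x] unfolding je(1) by (auto split: if_splits)
    moreover have "i \<noteq> 0" "j \<noteq> 0" using ie(2) je(2) zero by metis+
    moreover have "False" if "\<not> e" "\<not> e'" "x \<in> colours \<Delta> a" "x \<in> colours \<Delta> a'" for x
      using that a(3) unfolding ie(1) je(1) by auto
    ultimately show "colours \<Delta> a \<inter> colours \<Delta> a' = {}"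
      using a(3) unfolding ie(1) je(1) da_inject by (metis disjoint_iff)
  qed
  fix v assume "v \<in> verts \<Delta>"
  then consider "v = 0" | "v \<in> I" by auto
  then have "subgroup (local_group \<Delta> v) (BijGroup (vertex_colours \<Delta> v)) \<and>
        closedin (perm_topology (vertex_colours \<Delta> v)) (local_group \<Delta> v) \<and>
        orbits (BijGroup (vertex_colours \<Delta> v)\<lparr>carrier := local_group \<Delta> v\<rparr>)
          (vertex_colours \<Delta> v) (\<lambda>g. g) = colours \<Delta> ` arcs_at \<Delta> v"
  proof cases
    case 1
    have "subgroup {\<one>\<^bsub>BijGroup (vertex_colours \<Delta> 0)\<^esub>} (BijGroup (vertex_colours \<Delta> 0))"
      by (rule group.triv_subgroup[OF group_BijGroup])
    then have "subgroup (local_group \<Delta> 0) (BijGroup (vertex_colours \<Delta> 0))"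
      unfolding local_group_centre one_BijGroup .
    moreover have "closedin (perm_topology (vertex_colours \<Delta> 0)) (local_group \<Delta> 0)"
      unfolding local_group_centre
      by (rule closedin_Hausdorff_singleton[OF Hausdorff_perm_topology]) (simp only: topspace_perm_topology id_Bij)
    moreover have "orbits (BijGroup (vertex_colours \<Delta> 0)\<lparr>carrier := local_group \<Delta> 0\<rparr>)
          (vertex_colours \<Delta> 0) (\<lambda>g. g) = colours \<Delta> ` arcs_at \<Delta> 0"
    proof -
      have "orbit (BijGroup (vertex_colours \<Delta> 0)\<lparr>carrier := local_group \<Delta> 0\<rparr>) (\<lambda>g. g) x = {x}"
        if "x \<in> vertex_colours \<Delta> 0" for x
        using that by (simp add: orbit_def local_group_centre)
      then have "orbits (BijGroup (vertex_colours \<Delta> 0)\<lparr>carrier := local_group \<Delta> 0\<rparr>)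
          (vertex_colours \<Delta> 0) (\<lambda>g. g) = (\<lambda>x. {x}) ` vertex_colours \<Delta> 0"
        unfolding orbits_def by auto
      also have "\<dots> = colours \<Delta> ` arcs_at \<Delta> 0"
        unfolding vertex_colours_centre arcs_at_centre image_image
      proof (rule equalityI; rule subsetI)
        fix S assume "S \<in> (\<lambda>i. {prod_encode (0, i)}) ` I"
        then obtain i where "i \<in> I" "S = {prod_encode (0, i)}" by blast
        then show "S \<in> colours \<Delta> ` {da i False |i. i \<in> I}" by (intro image_eqI[of _ _ "da i False"]) auto
      next
        fix S assume "S \<in> colours \<Delta> ` {da i False |i. i \<in> I}"
        then show "S \<in> (\<lambda>i. {prod_encode (0, i)}) ` I" by auto
      qed
      finally show ?thesis .
    qed
    ultimately show ?thesis using 1 by simp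
  next
    case 2
    have "orbit (BijGroup (X v)\<lparr>carrier := P v\<rparr>) (\<lambda>g. g) x = X v" if x: "x \<in> X v" for x
    proof -
      have "p x \<in> X v" if "p \<in> P v" for p by (rule P_X[OF 2 that x])
      then show ?thesis unfolding orbit_def using P_trans[OF 2 x] by auto
    qed
    then have "orbits (BijGroup (X v)\<lparr>carrier := P v\<rparr>) (X v) (\<lambda>g. g) = {X v}"
      unfolding orbits_def using b_X[OF 2] by auto
    then show ?thesis
      using P_sub[OF 2] P_closed[OF 2] unfolding vertex_colours_leaf[OF 2] local_group_leaf[OF 2] arcs_at_leaf[OF 2]
      by simp
  qed
  then show "subgroup (local_group \<Delta> v) (BijGroup (vertex_colours \<Delta> v))"
    "closedin (perm_topology (vertex_colours \<Delta> v)) (local_group \<Delta> v)"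
    "orbits (BijGroup (vertex_colours \<Delta> v)\<lparr>carrier := local_group \<Delta> v\<rparr>)
          (vertex_colours \<Delta> v) (\<lambda>g. g) = colours \<Delta> ` arcs_at \<Delta> v"
    by (simp_all only:)
qed

section \<open>The word graph is a tree over the diagram\<close>

lemma walk_append: "walk \<Gamma> u as v \<Longrightarrow> walk \<Gamma> v as' w \<Longrightarrow> walk \<Gamma> u (as @ as') w"
  by (induction as arbitrary: u) auto

lemma is_graph_T: "is_graph T"
  unfolding is_graph_def
proof (intro ballI conjI)
  fix a assume "a \<in> arcs T"
  then obtain w i e where a: "a = ar w i e" "w \<in> Y" "i \<in> I" by (rule arc_cases)
  show "orig T a \<in> verts T" "arev T a \<in> arcs T" "arev T (arev T a) = a"
    using a base_Y[OF a(3,2)] by (auto simp: cv_T lv_T ar_T)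
qed

lemma is_tree_T: "is_tree T"
  unfolding is_tree_def
proof (intro conjI)
  show "is_graph T" by (rule is_graph_T)
  show "verts T \<noteq> {}" using cv_T[OF Nil_Y] by (metis empty_iff)
  have step: "walk T (orig T (ar w i e)) [ar w i e] (targ T (ar w i e))" if "w \<in> Y" "i \<in> I" for w i e
    using that base_Y[OF that(2,1)] by (auto simp: arcs_at_def ar_T cv_T lv_T)
  have out: "\<exists>as. walk T (cv []) as (cv w)" if "w \<in> Y" for w
    using that
  proof (induction w rule: rev_induct)
    case Nil
    have "walk T (cv []) [] (cv [])" by (simp add: cv_T)
    then show ?case by (rule exI)
  next
    case (snoc x w)
    define i where "i = tp x"
    have w: "w \<in> Y" "i \<in> I" "\<not> ends i w" using snoc.prems unfolding Y_snoc i_def by auto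
    have "base i (w @ [x]) = w" by (simp add: base_def ends_def i_def)
    then have "walk T (lv w i) [ar (w @ [x]) i True] (cv (w @ [x]))"
      using step[OF snoc.prems w(2), of True] by simp
    moreover have "walk T (cv w) [ar w i False] (lv w i)"
      using step[OF w(1,2), of False] w(3) by (simp add: base_fix)
    ultimately have "walk T (cv w) ([ar w i False] @ [ar (w @ [x]) i True]) (cv (w @ [x]))"
      by (rule walk_append[rotated])
    moreover from snoc.IH[OF w(1)] obtain as where "walk T (cv []) as (cv w)" ..
    ultimately have "walk T (cv []) (as @ ([ar w i False] @ [ar (w @ [x]) i True])) (cv (w @ [x]))"
      by (rule walk_append[rotated])
    then show ?case by (rule exI)
  qed
  have inward: "\<exists>as. walk T (cv w) as (cv [])" if "w \<in> Y" for w
    using that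
  proof (induction w rule: rev_induct)
    case Nil
    have "walk T (cv []) [] (cv [])" by (simp add: cv_T)
    then show ?case by (rule exI)
  next
    case (snoc x w)
    define i where "i = tp x"
    have w: "w \<in> Y" "i \<in> I" "\<not> ends i w" using snoc.prems unfolding Y_snoc i_def by auto
    have "base i (w @ [x]) = w" by (simp add: base_def ends_def i_def)
    then have "walk T (cv (w @ [x])) [ar (w @ [x]) i False] (lv w i)"
      using step[OF snoc.prems w(2), of False] by simp
    moreover have "walk T (lv w i) [ar w i True] (cv w)"
      using step[OF w(1,2), of True] w(3) by (simp add: base_fix)
    ultimately have "walk T (cv (w @ [x])) ([ar (w @ [x]) i False] @ [ar w i True]) (cv w)"
      by (rule walk_append)
    moreover from snoc.IH[OF w(1)] obtain as where "walk T (cv w) as (cv [])" ..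
    ultimately have "walk T (cv (w @ [x])) (([ar (w @ [x]) i False] @ [ar w i True]) @ as) (cv [])"
      by (rule walk_append)
    then show ?case by (rule exI)
  qed
  have out': "\<exists>as. walk T (cv []) as v" if "v \<in> verts T" for v
    using that
  proof (cases rule: vert_cases)
    case (leaf u i)
    obtain as where "walk T (cv []) as (cv u)" using out leaf(2) by blast
    moreover have "walk T (cv u) [ar u i False] v"
      using step[OF leaf(2,3), of False] leaf by (simp add: base_fix)
    ultimately show ?thesis by (intro exI[of _ "as @ [ar u i False]"] walk_append)
  qed (use out in simp)
  have inward': "\<exists>as. walk T v as (cv [])" if "v \<in> verts T" for v
    using that
  proof (cases rule: vert_cases)
    case (leaf u i)
    obtain as where "walk T (cv u) as (cv [])" using inward leaf(2) by blast
    moreover have "walk T v [ar u i True] (cv u)"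
      using step[OF leaf(2,3), of True] leaf by (simp add: base_fix)
    ultimately show ?thesis by (intro exI[of _ "[ar u i True] @ as"] walk_append)
  qed (use inward in simp)
  show "graph_connected T"
    unfolding graph_connected_def
  proof (intro ballI)
    fix u v assume uv: "u \<in> verts T" "v \<in> verts T"
    from inward'[OF uv(1)] obtain as where as: "walk T u as (cv [])" ..
    from out'[OF uv(2)] obtain as' where "walk T (cv []) as' v" ..
    from walk_append[OF as this] show "\<exists>as. walk T u as v" by (rule exI)
  qed
  show "\<not> has_loop T"
    unfolding has_loop_def
  proof
    assume "\<exists>a\<in>arcs T. orig T a = targ T a"
    then obtain a where a: "a \<in> arcs T" "orig T a = targ T a" ..
    obtain w i e where "a = ar w i e" "i \<in> I" using a(1) by (rule arc_cases)
    then show False using a(2) cv_neq_lv by (auto split: if_splits)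
  qed
  show "\<not> has_multiple_edges T"
    unfolding has_multiple_edges_def
  proof
    assume "\<exists>a\<in>arcs T. \<exists>c\<in>arcs T. a \<noteq> c \<and> orig T a = orig T c \<and> targ T a = targ T c"
    then obtain a c where ac: "a \<in> arcs T" "c \<in> arcs T" "a \<noteq> c" "orig T a = orig T c" "targ T a = targ T c"
      by blast
    obtain w i e where a: "a = ar w i e" "i \<in> I" using ac(1) by (rule arc_cases)
    obtain w' j e' where c: "c = ar w' j e'" "j \<in> I" using ac(2) by (rule arc_cases)
    show False
      using ac(3-5) cv_neq_lv(1)[OF a(2)] cv_neq_lv(1)[OF c(2)] cv_neq_lv(2)[OF a(2)] cv_neq_lv(2)[OF c(2)]
      unfolding a(1) c(1) by (cases e; cases e') auto
  qed
  \<comment> \<open>The distance from \<open>cv []\<close>: words have even and classes odd depth.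
    The only neighbour of a word nearer to the root is the class of its last type, and that of
    \<open>lv u i\<close> is \<open>cv u\<close>.\<close>
  define d where "d = (\<lambda>v. case from_nat v of (w :: nat list, i :: nat) \<Rightarrow> 2 * length w + (if i = 0 then 0 else 1))"
  have dc: "d (cv w) = 2 * length w" for w by (simp add: d_def cv_def)
  have dl: "d (lv u i) = Suc (2 * length u)" if "i \<in> I" for u i
    using that zero by (cases "i = 0") (simp_all add: d_def lv_def)
  have blen: "length (base i w) = (if ends i w then length w - 1 else length w)" for i w
    by (simp add: base_def)
  have elen: "length w = Suc (length (base i w))" if "ends i w" for i w
    using that by (cases w rule: rev_cases) (simp_all add: base_def)
  show "\<not> has_cycle T"
  proof (rule no_cycle_if_depth[OF is_graph_T, of d])
    fix a assume "a \<in> arcs T"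
    then obtain w i e where a: "a = ar w i e" "w \<in> Y" "i \<in> I" by (rule arc_cases)
    have "2 * length w \<noteq> Suc (2 * length (base i w))" "Suc (2 * length (base i w)) \<noteq> 2 * length w" by presburger+
    then show "d (orig T a) \<noteq> d (targ T a)" unfolding a(1) using a(3) by (simp add: dc dl)
  next
    fix a a' assume A: "a \<in> arcs T" "a' \<in> arcs T" "orig T a = orig T a'"
      "d (targ T a) < d (orig T a)" "d (targ T a') < d (orig T a)"
    obtain w i e where a: "a = ar w i e" "w \<in> Y" "i \<in> I" using A(1) by (rule arc_cases)
    obtain w' j e' where c: "a' = ar w' j e'" "w' \<in> Y" "j \<in> I" using A(2) by (rule arc_cases)
    show "targ T a = targ T a'"
    proof (cases e)
      case False
      have e': "\<not> e'" using A(3) cv_neq_lv(1)[OF c(3)] False unfolding a(1) c(1) by auto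
      then have w: "w' = w" using A(3) False unfolding a(1) c(1) by simp
      have "Suc (2 * length (base i w)) < 2 * length w" "Suc (2 * length (base j w)) < 2 * length w"
        using A(4,5) False e' a(3) c(3) unfolding a(1) c(1) w by (simp_all add: dc dl)
      then have "ends i w" "ends j w" by (auto simp: blen split: if_splits)
      then have "i = j" by (rule ends_unique)
      then show ?thesis using False e' unfolding a(1) c(1) w by simp
    next
      case True
      have e': "e'" using A(3) cv_neq_lv(2)[OF a(3)] True unfolding a(1) c(1) by (auto split: if_splits)
      then have ji: "j = i" "base i w' = base i w" using A(3) True unfolding a(1) c(1) by auto
      have "2 * length w < Suc (2 * length (base i w))" "2 * length w' < Suc (2 * length (base i w))"
        using A(4,5) True e' a(3) unfolding a(1) c(1) ji by (simp_all add: dc dl)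
      then have "length w \<noteq> Suc (length (base i w))" "length w' \<noteq> Suc (length (base i w'))"
        unfolding ji(2) by simp_all
      then have "\<not> ends i w" "\<not> ends i w'" using elen by blast+
      then have "w' = w" using ji(2) by (simp add: base_fix)
      then show ?thesis using True e' unfolding a(1) c(1) ji by simp
    qed
  qed
qed

lemma diagram_tree: "diagram_tree \<Delta> T"
  unfolding diagram_tree_def
proof (intro conjI ballI)
  show "is_tree T" by (rule is_tree_T)
  have leafY: "lv [] i \<in> verts T" if "i \<in> I" for i using lv_T[OF Nil_Y that] by simp
  show "surjective_graph_hom T \<Delta> (vproj T) (aproj T)"
    unfolding surjective_graph_hom_def graph_hom_def
  proof (intro conjI ballI)
    show "vproj T \<in> verts T \<rightarrow> verts \<Delta>"
      by (rule funcsetI) (auto elim!: vert_cases)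
    show "aproj T \<in> arcs T \<rightarrow> arcs \<Delta>"
      by (rule funcsetI) (auto elim!: arc_cases)
    show "orig \<Delta> (aproj T a) = vproj T (orig T a)" "arev \<Delta> (aproj T a) = aproj T (arev T a)"
      if "a \<in> arcs T" for a
      using that by (auto elim!: arc_cases)
    show "vproj T ` verts T = verts \<Delta>"
    proof
      show "vproj T ` verts T \<subseteq> verts \<Delta>" by (auto elim!: vert_cases)
      show "verts \<Delta> \<subseteq> vproj T ` verts T"
      proof
        fix v assume "v \<in> verts \<Delta>"
        then consider "v = 0" | "v \<in> I" by auto
        then show "v \<in> vproj T ` verts T"
        proof cases
          case 1
          then show ?thesis by (intro image_eqI[OF _ cv_T[OF Nil_Y]]) simp
        next
          case 2
          then show ?thesis by (intro image_eqI[OF _ leafY]) simp_all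
        qed
      qed
    qed
    show "aproj T ` arcs T = arcs \<Delta>"
    proof
      show "aproj T ` arcs T \<subseteq> arcs \<Delta>" by (auto elim!: arc_cases)
      show "arcs \<Delta> \<subseteq> aproj T ` arcs T"
      proof
        fix a assume "a \<in> arcs \<Delta>"
        then obtain i e where "a = da i e" "i \<in> I" by auto
        then show "a \<in> aproj T ` arcs T" by (intro image_eqI[OF _ ar_T[OF Nil_Y]]) simp_all
      qed
    qed
  qed
  show "label T \<in> arcs T \<rightarrow> (\<Union>a\<in>arcs \<Delta>. colours \<Delta> a)"
  proof
    fix a assume "a \<in> arcs T"
    then obtain w i e where a: "a = ar w i e" "w \<in> Y" "i \<in> I" by (rule arc_cases)
    have "label T a \<in> colours \<Delta> (da i e)" using base_Y(3)[OF a(3,2)] by (simp add: a(1))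
    moreover have "da i e \<in> arcs \<Delta>" using a(3) by auto
    ultimately show "label T a \<in> (\<Union>a\<in>arcs \<Delta>. colours \<Delta> a)" by blast
  qed
  fix v a assume v: "v \<in> verts T" and a: "a \<in> arcs_at \<Delta> (vproj T v)"
  show "bij_betw (label T) {c \<in> arcs_at T v. aproj T c = a} (colours \<Delta> a)"
    using v
  proof (cases rule: vert_cases)
    case (centre w)
    then obtain i where i: "a = da i False" "i \<in> I" using a arcs_at_centre by auto
    have "{c \<in> arcs_at T v. aproj T c = a} = {ar w i False}"
      unfolding centre(1) arcs_at_cv[OF centre(2)] i(1) using i(2) by auto
    then show ?thesis unfolding i(1) by (simp add: bij_betw_def)
  next
    case (leaf u i)
    then have ai: "a = da i True" using a arcs_at_leaf[OF leaf(3)] by auto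
    have S: "{c \<in> arcs_at T v. aproj T c = a} = {ar w i True |w. w \<in> Y \<and> base i w = u}"
      unfolding leaf(1) arcs_at_lv[OF leaf(3)] ai by auto
    have "bij_betw (label T) {ar w i True |w. w \<in> Y \<and> base i w = u} (X i)"
    proof (rule bij_betwI[where g = "\<lambda>x. ar (app i u x) i True"])
      show "label T \<in> {ar w i True |w. w \<in> Y \<and> base i w = u} \<rightarrow> X i"
        using base_Y(3)[OF leaf(3)] by auto
      show "(\<lambda>x. ar (app i u x) i True) \<in> X i \<rightarrow> {ar w i True |w. w \<in> Y \<and> base i w = u}"
        using app_Y[OF leaf(3,2,4)] base_app[OF leaf(3,4)] by auto
      show "ar (app i u (label T c)) i True = c" if "c \<in> {ar w i True |w. w \<in> Y \<and> base i w = u}" for c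
        using that base_Y(4)[OF leaf(3)] by auto
      show "label T (ar (app i u x) i True) = x" if "x \<in> X i" for x
        using col_app[OF leaf(3,4) that] by simp
    qed
    then show ?thesis unfolding S by (simp add: ai)
  qed
qed

subsection \<open>The universal group as the group of reduced-word permutations\<close>

text \<open>A vertex over a leaf is moved through the word that is its base. The second component
  separates the two kinds of vertices because 0 is not a type.\<close>

definition lift :: "(nat list \<Rightarrow> nat list) \<Rightarrow> nat \<Rightarrow> nat" where
  "lift g = (\<lambda>v\<in>verts T. case from_nat v of (w, i) \<Rightarrow> if i = 0 then cv (g w) else lv (base i (g w)) i)"

definition lift_arc :: "(nat list \<Rightarrow> nat list) \<Rightarrow> nat \<Rightarrow> nat" where
  "lift_arc g a = (case from_nat a of (w, i, e) \<Rightarrow> ar (g w) i e)"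

abbreviation V where "V \<equiv> universal_set \<Delta> T"

lemma lift_cv: "w \<in> Y \<Longrightarrow> lift g (cv w) = cv (g w)"
  by (simp add: lift_def cv_T) (simp add: cv_def)

lemma lift_lv:
  assumes "u \<in> Y" "i \<in> I" "\<not> ends i u"
  shows "lift g (lv u i) = lv (base i (g u)) i"
proof -
  have "i \<noteq> 0" using assms(2) zero by metis
  then show ?thesis using lv_T[OF assms] by (simp add: lift_def) (simp add: lv_def)
qed

lemma lift_arc_ar [simp]: "lift_arc g (ar w i e) = ar (g w) i e"
  by (simp add: lift_arc_def ar_def)

lemma base_base: "i \<in> I \<Longrightarrow> w \<in> Y \<Longrightarrow> base i (base i w) = base i w"
  using base_Y(2) base_fix by blast

text \<open>By \<open>U_base\<close> the image of a vertex over a leaf can be computed from any word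
  of its class.\<close>

lemma lift_lv_base:
  assumes "g \<in> U" "i \<in> I" "w \<in> Y"
  shows "lift g (lv (base i w) i) = lv (base i (g w)) i"
  using lift_lv[OF base_Y(1)[OF assms(2,3)] assms(2) base_Y(2)[OF assms(2,3)]]
    U_base[OF assms(1,2) base_Y(1)[OF assms(2,3)] assms(3) base_base[OF assms(2,3)]] by simp

lemma lift_inverse:
  assumes g: "g \<in> U" and h: "h \<in> U" and hg: "\<And>w. w \<in> Y \<Longrightarrow> h (g w) = w" and v: "v \<in> verts T"
  shows "lift h (lift g v) = v"
  using v
proof (cases rule: vert_cases)
  case (centre w)
  show ?thesis unfolding centre(1) lift_cv[OF centre(2)] lift_cv[OF U_Y[OF g centre(2)]] hg[OF centre(2)] ..
next
  case (leaf u i)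
  show ?thesis
    unfolding leaf(1) lift_lv[OF leaf(2-4)] lift_lv_base[OF h leaf(3) U_Y[OF g leaf(2)]] hg[OF leaf(2)]
    using leaf(4) by (simp add: base_fix)
qed

lemma lift_verts:
  assumes g: "g \<in> U" and v: "v \<in> verts T"
  shows "lift g v \<in> verts T"
  using v
proof (cases rule: vert_cases)
  case (centre w)
  show ?thesis unfolding centre(1) lift_cv[OF centre(2)] by (rule cv_T[OF U_Y[OF g centre(2)]])
next
  case (leaf u i)
  note b = base_Y[OF leaf(3) U_Y[OF g leaf(2)]]
  show ?thesis unfolding leaf(1) lift_lv[OF leaf(2-4)] by (rule lv_T[OF b(1) leaf(3) b(2)])
qed

lemma lift_Bij:
  assumes g: "g \<in> U"
  shows "lift g \<in> Bij (verts T)"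
proof (rule BijI[where f' = "lift (inv\<^bsub>BijGroup Y\<^esub> g)"])
  show "lift g \<in> extensional (verts T)" by (simp add: lift_def)
  fix v assume v: "v \<in> verts T"
  show "lift g v \<in> verts T" "lift (inv\<^bsub>BijGroup Y\<^esub> g) v \<in> verts T"
    by (rule lift_verts[OF g v], rule lift_verts[OF U_inverse[OF g] v])
  show "lift (inv\<^bsub>BijGroup Y\<^esub> g) (lift g v) = v"
    by (rule lift_inverse[OF g U_inverse[OF g] U_inv_apply(1)[OF g] v])
  show "lift g (lift (inv\<^bsub>BijGroup Y\<^esub> g) v) = v"
    by (rule lift_inverse[OF U_inverse[OF g] g U_inv_apply(2)[OF g] v])
qed

lemma lift_graph_hom:
  assumes g: "g \<in> U"
  shows "graph_hom T T (lift g) (lift_arc g)"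
  unfolding graph_hom_def
proof (intro conjI ballI)
  show "lift g \<in> verts T \<rightarrow> verts T" by (rule funcsetI) (rule lift_verts[OF g])
  show "lift_arc g \<in> arcs T \<rightarrow> arcs T"
  proof
    fix a assume "a \<in> arcs T"
    then obtain w i e where a: "a = ar w i e" "w \<in> Y" "i \<in> I" by (rule arc_cases)
    show "lift_arc g a \<in> arcs T" unfolding a(1) lift_arc_ar by (rule ar_T[OF U_Y[OF g a(2)] a(3)])
  qed
  fix a assume "a \<in> arcs T"
  then obtain w i e where a: "a = ar w i e" "w \<in> Y" "i \<in> I" by (rule arc_cases)
  show "orig T (lift_arc g a) = lift g (orig T a)"
    unfolding a(1) lift_arc_ar using lift_lv_base[OF g a(3,2)] lift_cv[OF a(2), of g] by simp
  show "arev T (lift_arc g a) = lift_arc g (arev T a)" by (simp add: a(1))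
qed

lemma arc_image_lift: "g \<in> U \<Longrightarrow> w \<in> Y \<Longrightarrow> i \<in> I \<Longrightarrow> arc_image T (lift g) (ar w i e) = ar (g w) i e"
  using arc_image_eq[OF is_tree_T lift_graph_hom ar_T] by simp

lemma inv_label_lv:
  assumes "i \<in> I" "u \<in> Y" "\<not> ends i u" "x \<in> X i"
  shows "inv_into (arcs_at T (lv u i)) (label T) x = ar (app i u x) i True"
proof (rule inv_into_f_eq)
  show "inj_on (label T) (arcs_at T (lv u i))"
  proof (rule inj_onI)
    fix a c assume ac: "a \<in> arcs_at T (lv u i)" "c \<in> arcs_at T (lv u i)" "label T a = label T c"
    obtain w where w: "a = ar w i True" "w \<in> Y" "base i w = u" using ac(1) unfolding arcs_at_lv[OF assms(1)] by blast
    obtain v where v: "c = ar v i True" "v \<in> Y" "base i v = u" using ac(2) unfolding arcs_at_lv[OF assms(1)] by blast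
    have "col i w = col i v" using ac(3) unfolding w(1) v(1) by simp
    then have "app i (base i w) (col i w) = app i (base i v) (col i v)" unfolding w(3) v(3) by simp
    then have "w = v" unfolding base_Y(4)[OF assms(1) w(2)] base_Y(4)[OF assms(1) v(2)] .
    then show "a = c" unfolding w(1) v(1) by simp
  qed
  show "ar (app i u x) i True \<in> arcs_at T (lv u i)"
    unfolding arcs_at_lv[OF assms(1)] using app_Y[OF assms] base_app[OF assms(1,3,4)] by blast
  show "label T (ar (app i u x) i True) = x" using col_app[OF assms(1,3,4)] by simp
qed

lemma inv_label_cv:
  assumes "w \<in> Y" "i \<in> I"
  shows "inv_into (arcs_at T (cv w)) (label T) (prod_encode (0, i)) = ar w i False"
proof (rule inv_into_f_eq)
  show "inj_on (label T) (arcs_at T (cv w))"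
    unfolding arcs_at_cv[OF assms(1)] by (rule inj_onI) auto
  show "ar w i False \<in> arcs_at T (cv w)" unfolding arcs_at_cv[OF assms(1)] using assms(2) by blast
qed simp

lemma local_action_lv:
  assumes "i \<in> I" "u \<in> Y" "\<not> ends i u"
  shows "local_action \<Delta> T (lv u i) h = (\<lambda>x\<in>X i. label T (arc_image T h (ar (app i u x) i True)))"
  unfolding local_action_def tree_simps vertex_colours_leaf[OF assms(1)]
  by (rule restrict_ext) (simp add: inv_label_lv[OF assms])

lemma lift_V:
  assumes g: "g \<in> U"
  shows "lift g \<in> V"
proof -
  have "bij_betw (lift_arc g) (arcs T) (arcs T)"
  proof (rule bij_betwI[where g = "lift_arc (inv\<^bsub>BijGroup Y\<^esub> g)"])
    show "lift_arc g \<in> arcs T \<rightarrow> arcs T" "lift_arc (inv\<^bsub>BijGroup Y\<^esub> g) \<in> arcs T \<rightarrow> arcs T"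
      using lift_graph_hom[OF g] lift_graph_hom[OF U_inverse[OF g]] by (simp_all add: graph_hom_def)
    fix a assume "a \<in> arcs T"
    then obtain w i e where a: "a = ar w i e" "w \<in> Y" "i \<in> I" by (rule arc_cases)
    show "lift_arc (inv\<^bsub>BijGroup Y\<^esub> g) (lift_arc g a) = a" "lift_arc g (lift_arc (inv\<^bsub>BijGroup Y\<^esub> g) a) = a"
      unfolding a(1) lift_arc_ar U_inv_apply(1,2)[OF g a(2)] by (rule refl)+
  qed
  then have aut: "lift g \<in> tree_auts T"
    unfolding tree_auts_def using lift_Bij[OF g] lift_graph_hom[OF g] by blast
  have "vproj T (lift g v) = vproj T v" if v: "v \<in> verts T" for v
    using v by (cases rule: vert_cases) (simp_all add: lift_cv lift_lv)
  moreover have "aproj T (arc_image T (lift g) a) = aproj T a" if a: "a \<in> arcs T" for a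
  proof -
    obtain w i e where "a = ar w i e" "w \<in> Y" "i \<in> I" using a by (rule arc_cases)
    then show ?thesis by (simp add: arc_image_lift[OF g])
  qed
  moreover have "local_action \<Delta> T v (lift g) \<in> local_group \<Delta> (vproj T v)" if v: "v \<in> verts T" for v
    using v
  proof (cases rule: vert_cases)
    case (centre w)
    have "local_action \<Delta> T v (lift g) = (\<lambda>x\<in>vertex_colours \<Delta> 0. x)"
      unfolding local_action_def centre(1) tree_simps
    proof (rule restrict_ext)
      fix x assume "x \<in> vertex_colours \<Delta> 0"
      then obtain i where i: "i \<in> I" "x = prod_encode (0, i)" unfolding vertex_colours_centre by blast
      show "label T (arc_image T (lift g) (inv_into (arcs_at T (cv w)) (label T) x)) = x"
        unfolding i(2) inv_label_cv[OF centre(2) i(1)] arc_image_lift[OF g centre(2) i(1)] by simp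
    qed
    then show ?thesis unfolding centre(1) tree_simps local_group_centre by simp
  next
    case (leaf u i)
    obtain p v' where p: "maps_class g p i u v'" by (rule U_class[OF g leaf(3,2,4)])
    have pP: "p \<in> P i" using p by (simp add: maps_class_def)
    have "local_action \<Delta> T v (lift g) = (\<lambda>x\<in>X i. p x)"
      unfolding leaf(1) local_action_lv[OF leaf(3,2,4)]
    proof (rule restrict_ext)
      fix x assume x: "x \<in> X i"
      show "label T (arc_image T (lift g) (ar (app i u x) i True)) = p x"
        unfolding arc_image_lift[OF g app_Y[OF leaf(3,2,4) x] leaf(3)]
        using maps_class_base(2)[OF p leaf(3) x] by simp
    qed
    also have "\<dots> = p" using Bij_imp_extensional[OF P_Bij[OF leaf(3) pP]] by (rule extensional_restrict)
    finally show ?thesis unfolding leaf(1) tree_simps local_group_leaf[OF leaf(3)] using pP by simp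
  qed
  ultimately show ?thesis unfolding universal_set_def using aut by simp
qed

text \<open>Meant as the inverse of \<open>lift\<close>: elements of the universal group permute the
  vertices over the centre, and these are the coded words.\<close>

definition word_action :: "(nat \<Rightarrow> nat) \<Rightarrow> nat list \<Rightarrow> nat list" where
  "word_action h = (\<lambda>w\<in>Y. fst (from_nat (h (cv w)) :: nat list \<times> nat))"

section \<open>Recovering a word permutation from a tree automorphism\<close>

lemma V_Bij: "h \<in> V \<Longrightarrow> h \<in> Bij (verts T)"
  by (simp add: universal_set_def tree_auts_def)

lemma V_vproj: "h \<in> V \<Longrightarrow> v \<in> verts T \<Longrightarrow> vproj T (h v) = vproj T v"
  by (simp add: universal_set_def)

lemma vproj_zero:
  assumes "v \<in> verts T" "vproj T v = 0"
  shows "\<exists>w. v = cv w \<and> w \<in> Y"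
  using assms(1)
proof (cases rule: vert_cases)
  case (leaf u i)
  then have "i = 0" using assms(2) by simp
  then show ?thesis using leaf(3) zero by simp
qed blast

lemma V_cv:
  assumes h: "h \<in> V" and w: "w \<in> Y"
  shows "h (cv w) = cv (word_action h w)" "word_action h w \<in> Y"
proof -
  have v: "h (cv w) \<in> verts T" by (rule Bij_apply[OF V_Bij[OF h] cv_T[OF w]])
  have "vproj T (h (cv w)) = 0" using h cv_T[OF w] by (simp add: universal_set_def)
  then obtain w' where w': "h (cv w) = cv w'" "w' \<in> Y"
    using vproj_zero[OF v] by blast
  have "word_action h w = w'" using w w'(1) by (simp add: word_action_def cv_def)
  then show "h (cv w) = cv (word_action h w)" "word_action h w \<in> Y" using w' by auto
qed

text \<open>A word has exactly one outgoing arc over each diagram arc at the centre, so preservation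
  of the projection determines the image arc from its origin. The other direction follows by
  reversal.\<close>

lemma V_arc:
  assumes h: "h \<in> V" and w: "w \<in> Y" and i: "i \<in> I"
  shows "arc_image T h (ar w i e) = ar (word_action h w) i e"
proof -
  obtain k where k: "graph_hom T T h k" using h by (auto simp: universal_set_def tree_auts_def)
  have ai: "arc_image T h a = k a" if "a \<in> arcs T" for a by (rule arc_image_eq[OF is_tree_T k that])
  have kF: "k (ar w i False) = ar (word_action h w) i False"
  proof -
    have a: "ar w i False \<in> arcs T" by (rule ar_T[OF w i])
    have "k (ar w i False) \<in> arcs T" using k a by (auto simp: graph_hom_def)
    then obtain w' j e' where k': "k (ar w i False) = ar w' j e'" "j \<in> I" by (rule arc_cases)
    have "aproj T (k (ar w i False)) = da i False"
      using h a ai[OF a] by (auto simp: universal_set_def)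
    then have je: "j = i" "e' = False" unfolding k'(1) by auto
    have "orig T (k (ar w i False)) = h (cv w)" using k a by (simp add: graph_hom_def)
    then have "cv w' = cv (word_action h w)" unfolding k'(1) je V_cv(1)[OF h w] by simp
    then show ?thesis unfolding k'(1) je by simp
  qed
  show ?thesis
  proof (cases e)
    case False
    then show ?thesis using ai[OF ar_T[OF w i]] kF by simp
  next
    case True
    have "arev T (k (ar w i False)) = k (arev T (ar w i False))"
      using k ar_T[OF w i, of False] by (simp add: graph_hom_def)
    then show ?thesis using ai[OF ar_T[OF w i]] True unfolding kF by simp
  qed
qed

lemma V_lv:
  assumes h: "h \<in> V" and w: "w \<in> Y" and i: "i \<in> I"
  shows "h (lv (base i w) i) = lv (base i (word_action h w)) i"
proof -
  obtain k where k: "graph_hom T T h k" using h by (auto simp: universal_set_def tree_auts_def)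
  have a: "ar w i True \<in> arcs T" by (rule ar_T[OF w i])
  have "orig T (k (ar w i True)) = h (orig T (ar w i True))" using k a by (simp add: graph_hom_def)
  moreover have "k (ar w i True) = ar (word_action h w) i True"
    using arc_image_eq[OF is_tree_T k a] V_arc[OF h w i] by simp
  ultimately show ?thesis by simp
qed

text \<open>The local action at a vertex over a leaf is read off from the colours of the images of
  the words in its class, hence it is the permutation that \<open>maps_class\<close> asks
  for.\<close>

lemma word_action_class:
  assumes h: "h \<in> V" and iu: "i \<in> I" "u \<in> Y" "\<not> ends i u"
  shows "maps_class (word_action h) (local_action \<Delta> T (lv u i) h) i u (base i (word_action h u))"
proof -
  let ?v = "base i (word_action h u)" and ?p = "local_action \<Delta> T (lv u i) h"
  note v = base_Y[OF iu(1) V_cv(2)[OF h iu(2)]]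
  have "local_action \<Delta> T (lv u i) h \<in> local_group \<Delta> (vproj T (lv u i))"
    using h lv_T[OF iu(2,1,3)] unfolding universal_set_def by blast
  then have p: "?p \<in> P i" unfolding tree_simps local_group_leaf[OF iu(1)] .
  have "word_action h (app i u x) = app i ?v (?p x)" if x: "x \<in> X i" for x
  proof -
    have aY: "app i u x \<in> Y" by (rule app_Y[OF iu x])
    have "?p x = col i (word_action h (app i u x))"
      unfolding local_action_lv[OF iu] using x V_arc[OF h aY iu(1)] by simp
    moreover have "base i (word_action h (app i u x)) = ?v"
      using V_lv[OF h aY iu(1)] V_lv[OF h iu(2,1)] unfolding base_app[OF iu(1,3) x] base_fix[OF iu(3)] by simp
    ultimately show ?thesis using base_Y(4)[OF iu(1) V_cv(2)[OF h aY]] by simp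
  qed
  then show ?thesis unfolding maps_class_def using v(1,2) p by simp
qed

lemma word_action_U:
  assumes h: "h \<in> V"
  shows "word_action h \<in> U"
proof (rule U_I)
  have inj: "inj_on (word_action h) Y"
  proof (rule inj_onI)
    fix w v assume wv: "w \<in> Y" "v \<in> Y" "word_action h w = word_action h v"
    have "h (cv w) = h (cv v)" unfolding V_cv(1)[OF h wv(1)] V_cv(1)[OF h wv(2)] wv(3) ..
    from inj_onD[OF Bij_inj[OF V_Bij[OF h]] this cv_T[OF wv(1)] cv_T[OF wv(2)]]
    show "w = v" by simp
  qed
  have "Y \<subseteq> word_action h ` Y"
  proof
    fix w assume w: "w \<in> Y"
    have "h ` verts T = verts T" using Bij_bij_betw[OF V_Bij[OF h]] by (simp add: bij_betw_def)
    then have "cv w \<in> h ` verts T" using cv_T[OF w] by simp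
    then obtain v where v: "cv w = h v" "v \<in> verts T" by (rule imageE)
    \<comment> \<open>Because \<open>h\<close> preserves the projection, the preimage of a vertex
      over the centre is again over the centre.\<close>
    have "vproj T v = 0" using V_vproj[OF h v(2)] unfolding v(1)[symmetric] by simp
    from vproj_zero[OF v(2) this] obtain w' where w': "v = cv w'" "w' \<in> Y" by blast
    have "w = word_action h w'" using v(1) unfolding w'(1) V_cv(1)[OF h w'(2)] by simp
    then show "w \<in> word_action h ` Y" using w'(2) by (rule image_eqI)
  qed
  moreover have "word_action h ` Y \<subseteq> Y" by (rule image_subsetI) (rule V_cv(2)[OF h])
  moreover have "word_action h \<in> extensional Y" by (simp add: word_action_def)
  ultimately show "word_action h \<in> Bij Y" using inj by (simp add: Bij_def bij_betw_def)
  show "\<exists>p v. maps_class (word_action h) p i u v" if "i \<in> I" "u \<in> Y" "\<not> ends i u" for i u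
    by (intro exI) (rule word_action_class[OF h that])
qed

lemma lift_word_action:
  assumes h: "h \<in> V"
  shows "lift (word_action h) = h"
proof (rule Bij_ext[OF lift_Bij[OF word_action_U[OF h]] V_Bij[OF h]])
  fix v assume "v \<in> verts T"
  then show "lift (word_action h) v = h v"
  proof (cases rule: vert_cases)
    case (centre w)
    then show ?thesis using lift_cv[OF centre(2)] V_cv(1)[OF h centre(2)] by simp
  next
    case (leaf u i)
    then show ?thesis
      using lift_lv[OF leaf(2-4)] V_lv[OF h leaf(2,3)] by (simp add: base_fix)
  qed
qed

lemma word_action_lift:
  assumes g: "g \<in> U"
  shows "word_action (lift g) = g"
proof (rule U_ext[OF word_action_U[OF lift_V[OF g]] g])
  fix w assume w: "w \<in> Y"
  have "cv (word_action (lift g) w) = cv (g w)"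
    using V_cv(1)[OF lift_V[OF g] w] lift_cv[OF w, of g] by simp
  then show "word_action (lift g) w = g w" by simp
qed

lemma lift_mult:
  assumes g: "g \<in> U" and h: "h \<in> U"
  shows "lift (g \<otimes>\<^bsub>BijGroup Y\<^esub> h) = lift g \<otimes>\<^bsub>BijGroup (verts T)\<^esub> lift h"
proof (rule Bij_ext[OF lift_Bij[OF U_mult[OF g h]]])
  show "lift g \<otimes>\<^bsub>BijGroup (verts T)\<^esub> lift h \<in> Bij (verts T)"
    using lift_Bij[OF g] lift_Bij[OF h] by (simp add: mult_BijGroup compose_Bij)
  fix v assume v: "v \<in> verts T"
  have m: "(lift g \<otimes>\<^bsub>BijGroup (verts T)\<^esub> lift h) v = lift g (lift h v)"
    by (rule mult_BijGroup_apply[OF lift_Bij[OF g] lift_Bij[OF h] v])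
  show "lift (g \<otimes>\<^bsub>BijGroup Y\<^esub> h) v = (lift g \<otimes>\<^bsub>BijGroup (verts T)\<^esub> lift h) v"
    unfolding m using v
  proof (cases rule: vert_cases)
    case (centre w)
    show "lift (g \<otimes>\<^bsub>BijGroup Y\<^esub> h) v = lift g (lift h v)"
      unfolding centre(1) lift_cv[OF centre(2)] lift_cv[OF U_Y[OF h centre(2)]]
        U_mult_apply[OF g h centre(2)] ..
  next
    case (leaf u i)
    show "lift (g \<otimes>\<^bsub>BijGroup Y\<^esub> h) v = lift g (lift h v)"
      unfolding leaf(1) lift_lv[OF leaf(2-4)] lift_lv_base[OF g leaf(3) U_Y[OF h leaf(2)]]
        U_mult_apply[OF g h leaf(2)] ..
  qed
qed

lemma V_subgroup: "subgroup V (BijGroup (verts T))"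
proof -
  have "lift \<in> hom UG (BijGroup (verts T))"
    by (rule homI) (simp_all add: lift_Bij lift_mult)
  then have gh: "group_hom UG (BijGroup (verts T)) lift"
    using subgroup.subgroup_is_group[OF U_subgroup group_BijGroup]
    by (simp add: group_hom_def group_hom_axioms_def group_BijGroup)
  have "V = lift ` carrier UG"
  proof (rule equalityI; rule subsetI)
    fix h assume h: "h \<in> V"
    show "h \<in> lift ` carrier UG"
      using word_action_U[OF h] lift_word_action[OF h] by (intro image_eqI[of _ _ "word_action h"]) simp_all
  next
    fix h assume "h \<in> lift ` carrier UG"
    then show "h \<in> V" using lift_V by auto
  qed
  then show ?thesis using group_hom.img_is_subgroup[OF gh] by simp
qed

section \<open>Topological isomorphism of the word group with the universal group\<close>

lemma universal_group_eq: "universal_group \<Delta> T = BijGroup (verts T)\<lparr>carrier := V\<rparr>"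
  by (simp add: universal_group_def)

lemma universal_topology_eq: "universal_topology \<Delta> T = subtopology (perm_topology (verts T)) V"
  by (simp add: universal_topology_def)

lemma topspace_universal: "topspace (universal_topology \<Delta> T) = V"
  unfolding universal_topology_eq using subgroup.subset[OF V_subgroup]
  by (simp add: topspace_subtopology Int_absorb1)

lemma topological_group_universal: "topological_group (universal_group \<Delta> T) (universal_topology \<Delta> T)"
  unfolding universal_group_eq universal_topology_eq by (rule topological_group_perm[OF V_subgroup])

lemma openin_UT_point:
  assumes "w \<in> Y"
  shows "openin UT {g \<in> U. g w = v}"
proof -
  have "{g \<in> U. g w = v} = {g \<in> Bij Y. g w = v} \<inter> U" using subgroup.subset[OF U_subgroup] by auto
  then show ?thesis
    unfolding openin_subtopology
    by (intro exI[of _ "{g \<in> Bij Y. g w = v}"] conjI) (rule openin_perm_topology_point[OF assms])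
qed

lemma openin_universal_point:
  assumes "x \<in> verts T"
  shows "openin (universal_topology \<Delta> T) {g \<in> V. g x = v}"
proof -
  have "{g \<in> V. g x = v} = {g \<in> Bij (verts T). g x = v} \<inter> V" using subgroup.subset[OF V_subgroup] by auto
  then show ?thesis
    unfolding universal_topology_eq openin_subtopology
    by (intro exI[of _ "{g \<in> Bij (verts T). g x = v}"] conjI) (rule openin_perm_topology_point[OF assms])
qed

lemma continuous_lift: "continuous_map UT (universal_topology \<Delta> T) lift"
  unfolding universal_topology_eq continuous_map_in_subtopology topspace_UT
proof (intro conjI)
  show "lift \<in> U \<rightarrow> V" by (rule funcsetI) (rule lift_V)
  show "continuous_map UT (perm_topology (verts T)) lift"
    unfolding continuous_map_perm_topology_iff topspace_UT
  proof (intro conjI ballI)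
    show "lift ` U \<subseteq> Bij (verts T)" by (rule image_subsetI) (rule lift_Bij)
    fix x y assume x: "x \<in> verts T" and "y \<in> verts T"
    have fib: "openin UT {g \<in> U. Q (g w)}" if w: "w \<in> Y" for w Q
    proof -
      have "{g \<in> U. Q (g w)} = (\<Union>v\<in>Collect Q. {g \<in> U. g w = v})" by blast
      moreover have "openin UT (\<Union>v\<in>Collect Q. {g \<in> U. g w = v})"
      proof (rule openin_Union)
        fix S assume "S \<in> (\<lambda>v. {g \<in> U. g w = v}) ` Collect Q"
        then obtain v where "S = {g \<in> U. g w = v}" by blast
        then show "openin UT S" using openin_UT_point[OF w, of v] by (simp only:)
      qed
      ultimately show ?thesis by (simp only:)
    qed
    show "openin UT {g \<in> U. lift g x = y}"
      using x
    proof (cases rule: vert_cases)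
      case (centre w)
      show ?thesis unfolding centre(1) lift_cv[OF centre(2)] by (rule fib[OF centre(2)])
    next
      case (leaf u i)
      show ?thesis unfolding leaf(1) lift_lv[OF leaf(2-4)] by (rule fib[OF leaf(2)])
    qed
  qed
qed

lemma continuous_word_action: "continuous_map (universal_topology \<Delta> T) UT word_action"
  unfolding continuous_map_in_subtopology topspace_universal
proof (intro conjI)
  show "word_action \<in> V \<rightarrow> U" by (rule funcsetI) (rule word_action_U)
  show "continuous_map (universal_topology \<Delta> T) (perm_topology Y) word_action"
    unfolding continuous_map_perm_topology_iff topspace_universal
  proof (intro conjI ballI)
    show "word_action ` V \<subseteq> Bij Y" by (rule image_subsetI) (rule U_Bij[OF word_action_U])
    fix w v assume w: "w \<in> Y" and "v \<in> Y"
    have "word_action h w = v \<longleftrightarrow> h (cv w) = cv v" if "h \<in> V" for h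
      using V_cv(1)[OF that w] by simp
    then have "{h \<in> V. word_action h w = v} = {h \<in> V. h (cv w) = cv v}" by blast
    then show "openin (universal_topology \<Delta> T) {h \<in> V. word_action h w = v}"
      using openin_universal_point[OF cv_T[OF w]] by (simp only:)
  qed
qed

lemma lift_iso: "topological_group_iso UG UT (universal_group \<Delta> T) (universal_topology \<Delta> T) lift"
proof -
  have "homeomorphic_maps UT (universal_topology \<Delta> T) lift word_action"
    unfolding homeomorphic_maps_def topspace_UT topspace_universal
    using continuous_lift continuous_word_action word_action_lift lift_word_action by simp
  then have "homeomorphic_map UT (universal_topology \<Delta> T) lift" by (rule homeomorphic_maps_imp_map)
  moreover have "lift \<in> hom UG (universal_group \<Delta> T)"
    unfolding universal_group_eq by (rule homI) (simp_all add: lift_V lift_mult)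
  moreover have "bij_betw lift (carrier UG) (carrier (universal_group \<Delta> T))"
    by (rule bij_betwI[where g = word_action])
      (simp_all add: universal_group_eq Pi_def lift_V word_action_U word_action_lift lift_word_action)
  ultimately show ?thesis by (simp add: topological_group_iso_def iso_def)
qed

theorem class_S_universal: "class_S (universal_group \<Delta> T) (universal_topology \<Delta> T)"
  by (rule class_S_iso[OF lift_iso class_S_U topological_group_universal])

lemma acts_continuously_universal: "acts_continuously (universal_topology \<Delta> T) (verts T)"
  unfolding acts_continuously_def continuous_map_def
proof (intro conjI allI impI)
  let ?P = "prod_topology (universal_topology \<Delta> T) (discrete_topology (verts T))"
  have tP: "topspace ?P = V \<times> verts T" by (simp add: topspace_universal)
  have cl: "g x \<in> verts T" if "g \<in> V" "x \<in> verts T" for g x by (rule Bij_apply[OF V_Bij[OF that(1)] that(2)])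
  show "(\<lambda>(g, v). g v) \<in> topspace ?P \<rightarrow> topspace (discrete_topology (verts T))"
    unfolding tP using cl by auto
  fix W assume "openin (discrete_topology (verts T)) W"
  have "{z \<in> topspace ?P. (case z of (g, v) \<Rightarrow> g v) \<in> W} = (\<Union>x\<in>verts T. \<Union>y\<in>W. {g \<in> V. g x = y} \<times> {x})"
    unfolding tP by auto
  moreover have "openin ?P (\<Union>x\<in>verts T. \<Union>y\<in>W. {g \<in> V. g x = y} \<times> {x})"
  proof (intro openin_Union ballI, elim imageE, hypsubst, intro openin_Union ballI, elim imageE, hypsubst)
    fix x y assume "x \<in> verts T" "y \<in> W"
    then show "openin ?P ({g \<in> V. g x = y} \<times> {x})"
      by (simp add: openin_prod_Times_iff openin_universal_point)
  qed
  ultimately show "openin ?P {z \<in> topspace ?P. (case z of (g, v) \<Rightarrow> g v) \<in> W}" by simp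
qed

subsection \<open>Stabilisers of leaf vertices\<close>

text \<open>The vertex \<open>lv [] i\<close> is the neighbour of the empty word over
  \<open>i\<close>; its star is the class of type \<open>i\<close> based at \<open>[]\<close>, the
  one on which \<open>sec i p\<close> acts by \<open>p\<close>.\<close>

definition leaf_stab :: "nat \<Rightarrow> (nat \<Rightarrow> nat) set" where
  "leaf_stab i = stabilizer (universal_group \<Delta> T) (\<lambda>g. g) (lv [] i)"

abbreviation leaf_action :: "nat \<Rightarrow> (nat \<Rightarrow> nat) \<Rightarrow> nat \<Rightarrow> nat" where
  "leaf_action i \<equiv> local_action \<Delta> T (lv [] i)"

lemma leaf_stab_eq: "leaf_stab i = {h \<in> V. h (lv [] i) = lv [] i}"
  by (simp add: leaf_stab_def stabilizer_def universal_group_eq)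

lemma leaf_stabD: "h \<in> leaf_stab i \<Longrightarrow> h \<in> V" "h \<in> leaf_stab i \<Longrightarrow> h (lv [] i) = lv [] i"
  by (simp_all add: leaf_stab_eq)

lemma lv_Nil_T: "i \<in> I \<Longrightarrow> lv [] i \<in> verts T"
  by (rule lv_T) simp_all

lemma leaf_stab_subgroup:
  assumes i: "i \<in> I"
  shows "subgroup (leaf_stab i) (BijGroup (verts T))"
proof (rule group.subgroupI[OF group_BijGroup])
  have VB: "h \<in> Bij (verts T)" if "h \<in> leaf_stab i" for h by (rule V_Bij[OF leaf_stabD(1)[OF that]])
  show "leaf_stab i \<subseteq> carrier (BijGroup (verts T))"
    unfolding carrier_BijGroup using VB by (rule subsetI)
  have "\<one>\<^bsub>BijGroup (verts T)\<^esub> \<in> leaf_stab i"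
    using subgroup.one_closed[OF V_subgroup] lv_Nil_T[OF i] by (simp add: leaf_stab_eq one_BijGroup)
  then show "leaf_stab i \<noteq> {}" by (metis empty_iff)
  fix g assume g: "g \<in> leaf_stab i"
  have "(inv\<^bsub>BijGroup (verts T)\<^esub> g) (lv [] i) = lv [] i"
    using inv_BijGroup_apply(1)[OF VB[OF g] lv_Nil_T[OF i]] unfolding leaf_stabD(2)[OF g] .
  then show "inv\<^bsub>BijGroup (verts T)\<^esub> g \<in> leaf_stab i"
    using subgroup.m_inv_closed[OF V_subgroup leaf_stabD(1)[OF g]] by (simp add: leaf_stab_eq)
  fix h assume h: "h \<in> leaf_stab i"
  have "(g \<otimes>\<^bsub>BijGroup (verts T)\<^esub> h) (lv [] i) = lv [] i"
    unfolding mult_BijGroup_apply[OF VB[OF g] VB[OF h] lv_Nil_T[OF i]] leaf_stabD(2)[OF h] leaf_stabD(2)[OF g] ..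
  then show "g \<otimes>\<^bsub>BijGroup (verts T)\<^esub> h \<in> leaf_stab i"
    using subgroup.m_closed[OF V_subgroup leaf_stabD(1)[OF g] leaf_stabD(1)[OF h]] by (simp add: leaf_stab_eq)
qed

lemma app_Nil_Y: "i \<in> I \<Longrightarrow> x \<in> X i \<Longrightarrow> app i [] x \<in> Y"
  by (rule app_Y) simp_all

lemma leaf_action_P:
  assumes "i \<in> I" "h \<in> V"
  shows "leaf_action i h \<in> P i"
  using word_action_class[OF assms(2,1) Nil_Y ends_Nil] by (simp add: maps_class_def)

lemma leaf_action_word:
  assumes i: "i \<in> I" and h: "h \<in> leaf_stab i" and x: "x \<in> X i"
  shows "word_action h (app i [] x) = app i [] (leaf_action i h x)"
proof -
  have "lv (base i (word_action h [])) i = lv [] i"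
    using V_lv[OF leaf_stabD(1)[OF h] Nil_Y i] leaf_stabD(2)[OF h] by (simp add: base_fix)
  then have "base i (word_action h []) = []" by simp
  then have "maps_class (word_action h) (leaf_action i h) i [] []"
    using word_action_class[OF leaf_stabD(1)[OF h] i Nil_Y ends_Nil] by simp
  then have "\<forall>x\<in>X i. word_action h (app i [] x) = app i [] (leaf_action i h x)"
    unfolding maps_class_def by (elim conjE)
  then show ?thesis using x by (rule bspec)
qed

lemma leaf_action_eqI:
  assumes i: "i \<in> I" and h: "h \<in> leaf_stab i" and p: "p \<in> P i"
    and eq: "\<And>x. x \<in> X i \<Longrightarrow> word_action h (app i [] x) = app i [] (p x)"
  shows "leaf_action i h = p"
proof (rule Bij_ext[OF P_Bij[OF i leaf_action_P[OF i leaf_stabD(1)[OF h]]] P_Bij[OF i p]])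
  fix x assume x: "x \<in> X i"
  have "app i [] (leaf_action i h x) = app i [] (p x)"
    using leaf_action_word[OF i h x] eq[OF x] by (rule trans[OF sym])
  then show "leaf_action i h x = p x"
    by (rule app_inj[OF i ends_Nil P_X[OF i leaf_action_P[OF i leaf_stabD(1)[OF h]] x] P_X[OF i p x]])
qed

lemma word_action_mult:
  assumes "g \<in> V" "h \<in> V" "w \<in> Y"
  shows "word_action (g \<otimes>\<^bsub>BijGroup (verts T)\<^esub> h) w = word_action g (word_action h w)"
proof -
  have gh: "g \<otimes>\<^bsub>BijGroup (verts T)\<^esub> h \<in> V" by (rule subgroup.m_closed[OF V_subgroup assms(1,2)])
  have "cv (word_action (g \<otimes>\<^bsub>BijGroup (verts T)\<^esub> h) w) = g (h (cv w))"
    using V_cv(1)[OF gh assms(3)] mult_BijGroup_apply[OF V_Bij[OF assms(1)] V_Bij[OF assms(2)] cv_T[OF assms(3)]]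
    by simp
  also have "\<dots> = cv (word_action g (word_action h w))"
    unfolding V_cv(1)[OF assms(2,3)] by (rule V_cv(1)[OF assms(1) V_cv(2)[OF assms(2,3)]])
  finally show ?thesis by simp
qed

lemma leaf_action_mult:
  assumes i: "i \<in> I" and g: "g \<in> leaf_stab i" and h: "h \<in> leaf_stab i"
  shows "leaf_action i (g \<otimes>\<^bsub>BijGroup (verts T)\<^esub> h) = leaf_action i g \<otimes>\<^bsub>BijGroup (X i)\<^esub> leaf_action i h"
proof (rule leaf_action_eqI[OF i subgroup.m_closed[OF leaf_stab_subgroup[OF i] g h]])
  note gP = leaf_action_P[OF i leaf_stabD(1)[OF g]] and hP = leaf_action_P[OF i leaf_stabD(1)[OF h]]
  show "leaf_action i g \<otimes>\<^bsub>BijGroup (X i)\<^esub> leaf_action i h \<in> P i"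
    by (rule subgroup.m_closed[OF P_sub[OF i] gP hP])
  fix x assume x: "x \<in> X i"
  show "word_action (g \<otimes>\<^bsub>BijGroup (verts T)\<^esub> h) (app i [] x) =
      app i [] ((leaf_action i g \<otimes>\<^bsub>BijGroup (X i)\<^esub> leaf_action i h) x)"
    unfolding word_action_mult[OF leaf_stabD(1)[OF g] leaf_stabD(1)[OF h] app_Nil_Y[OF i x]]
      leaf_action_word[OF i h x] leaf_action_word[OF i g P_X[OF i hP x]]
      mult_BijGroup_apply[OF P_Bij[OF i gP] P_Bij[OF i hP] x] ..
qed

lemma sec_app_Nil:
  assumes "i \<in> I" "x \<in> X i"
  shows "sec i p (app i [] x) = app i [] (p x)"
proof -
  have "app i [] y = cons i y []" for y by (simp add: app_def cons_def)
  then show ?thesis using sec_cons[OF assms(1) Nil_Y starts_Nil assms(2), of p] by (simp only:)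
qed

lemma lift_sec_leaf_stab:
  assumes i: "i \<in> I" and p: "p \<in> P i"
  shows "lift (sec i p) \<in> leaf_stab i"
proof -
  have "sec i p [] = app i [] (p (b i))" using sec_app_Nil[OF i b_X[OF i], of p] by simp
  then have "base i (sec i p []) = []"
    using base_app[OF i ends_Nil P_X[OF i p b_X[OF i]]] by simp
  then have "lift (sec i p) (lv [] i) = lv [] i" using lift_lv[OF Nil_Y i ends_Nil] by simp
  then show ?thesis using lift_V[OF sec_U[OF i p]] by (simp add: leaf_stab_eq)
qed

lemma leaf_action_lift_sec:
  assumes i: "i \<in> I" and p: "p \<in> P i"
  shows "leaf_action i (lift (sec i p)) = p"
  by (rule leaf_action_eqI[OF i lift_sec_leaf_stab[OF assms] p])
    (simp only: word_action_lift[OF sec_U[OF assms]] sec_app_Nil[OF i])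

text \<open>The leaf stabiliser permutes the words of the star through their colours, so acting
  trivially on colours is the same as fixing the class pointwise. Compactness of the kernel is
  thereby inherited from \<open>class_kernel\<close>.\<close>

lemma class_kernel_image:
  assumes i: "i \<in> I"
  shows "lift ` class_kernel i = {h \<in> leaf_stab i. leaf_action i h = \<one>\<^bsub>BijGroup (X i)\<^esub>}"
proof (rule equalityI; rule subsetI)
  fix h assume "h \<in> lift ` class_kernel i"
  then obtain g where g: "h = lift g" "g \<in> U" "\<forall>x\<in>X i. g (app i [] x) = app i [] x"
    by (auto simp: class_kernel_def)
  have "g [] = []" using bspec[OF g(3) b_X[OF i]] by simp
  then have "h (lv [] i) = lv [] i" unfolding g(1) using lift_lv[OF Nil_Y i ends_Nil] by (simp add: base_fix)
  then have h: "h \<in> leaf_stab i" using lift_V[OF g(2)] g(1) by (simp add: leaf_stab_eq)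
  have "leaf_action i h = (\<lambda>x\<in>X i. x)"
    by (rule leaf_action_eqI[OF i h P_id[OF i]]) (use g(3) in \<open>simp add: g(1) word_action_lift[OF g(2)]\<close>)
  then show "h \<in> {h \<in> leaf_stab i. leaf_action i h = \<one>\<^bsub>BijGroup (X i)\<^esub>}"
    using h by (simp add: one_BijGroup)
next
  fix h assume "h \<in> {h \<in> leaf_stab i. leaf_action i h = \<one>\<^bsub>BijGroup (X i)\<^esub>}"
  then have h: "h \<in> leaf_stab i" "leaf_action i h = (\<lambda>x\<in>X i. x)" by (auto simp: one_BijGroup)
  have "word_action h (app i [] x) = app i [] x" if "x \<in> X i" for x
    using leaf_action_word[OF i h(1) that] that unfolding h(2) by simp
  then have "word_action h \<in> class_kernel i"
    using word_action_U[OF leaf_stabD(1)[OF h(1)]] by (simp add: class_kernel_def)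
  then show "h \<in> lift ` class_kernel i"
    using lift_word_action[OF leaf_stabD(1)[OF h(1)]] by (metis imageI)
qed

lemma continuous_leaf_action:
  assumes i: "i \<in> I"
  shows "continuous_map (subtopology (universal_topology \<Delta> T) (leaf_stab i))
    (subtopology (perm_topology (X i)) (P i)) (leaf_action i)"
proof -
  let ?S = "subtopology (universal_topology \<Delta> T) (leaf_stab i)"
  have tS: "topspace ?S = leaf_stab i"
    using topspace_universal by (auto simp: topspace_subtopology leaf_stab_eq)
  have "openin ?S {h \<in> leaf_stab i. leaf_action i h x = y}" if xy: "x \<in> X i" "y \<in> X i" for x y
  proof -
    have "leaf_action i h x = y \<longleftrightarrow> h (cv (app i [] x)) = cv (app i [] y)" if h: "h \<in> leaf_stab i" for h
    proof -
      have "h (cv (app i [] x)) = cv (app i [] (leaf_action i h x))"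
        using V_cv(1)[OF leaf_stabD(1)[OF h] app_Nil_Y[OF i xy(1)]] leaf_action_word[OF i h xy(1)] by simp
      then show ?thesis
        using app_inj[OF i ends_Nil P_X[OF i leaf_action_P[OF i leaf_stabD(1)[OF h]] xy(1)] xy(2)] by auto
    qed
    then have "{h \<in> leaf_stab i. leaf_action i h x = y} = {h \<in> V. h (cv (app i [] x)) = cv (app i [] y)} \<inter> leaf_stab i"
      using leaf_stabD(1) by blast
    then show ?thesis
      unfolding openin_subtopology
      by (intro exI[of _ "{h \<in> V. h (cv (app i [] x)) = cv (app i [] y)}"] conjI)
        (rule openin_universal_point[OF cv_T[OF app_Nil_Y[OF i xy(1)]]])
  qed
  moreover have "leaf_action i ` leaf_stab i \<subseteq> Bij (X i)"
    by (rule image_subsetI) (rule P_Bij[OF i leaf_action_P[OF i leaf_stabD(1)]])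
  ultimately have "continuous_map ?S (perm_topology (X i)) (leaf_action i)"
    unfolding continuous_map_perm_topology_iff tS by simp
  moreover have "leaf_action i \<in> leaf_stab i \<rightarrow> P i"
    by (rule funcsetI) (rule leaf_action_P[OF i leaf_stabD(1)])
  ultimately show ?thesis unfolding continuous_map_in_subtopology tS by simp
qed

theorem leaf_splits:
  assumes i: "i \<in> I" and tG: "topological_group G \<sigma>"
    and iso: "topological_group_iso G \<sigma> (BijGroup (X i)\<lparr>carrier := P i\<rparr>) (subtopology (perm_topology (X i)) (P i)) \<phi>"
  shows "lift ` class_kernel i \<lhd> universal_group \<Delta> T\<lparr>carrier := leaf_stab i\<rparr>"
    and "compactin (universal_topology \<Delta> T) (lift ` class_kernel i)"
    and "splits_as_semidirect_product (universal_group \<Delta> T\<lparr>carrier := leaf_stab i\<rparr>)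
      (subtopology (universal_topology \<Delta> T) (leaf_stab i)) (lift ` class_kernel i) G \<sigma>"
proof -
  let ?A = "universal_group \<Delta> T\<lparr>carrier := leaf_stab i\<rparr>"
  let ?\<alpha> = "subtopology (universal_topology \<Delta> T) (leaf_stab i)"
  let ?B = "BijGroup (X i)\<lparr>carrier := P i\<rparr>"
  let ?\<beta> = "subtopology (perm_topology (X i)) (P i)"
  have A: "?A = BijGroup (verts T)\<lparr>carrier := leaf_stab i\<rparr>" by (simp add: universal_group_eq)
  have sub: "leaf_stab i \<subseteq> V" using leaf_stabD(1) by blast
  have a: "?\<alpha> = subtopology (perm_topology (verts T)) (leaf_stab i)"
    unfolding universal_topology_eq subtopology_subtopology using sub by (simp add: Int_absorb1)
  have tA: "topological_group ?A ?\<alpha>"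
    unfolding A a by (rule topological_group_perm[OF leaf_stab_subgroup[OF i]])
  interpret A: topological_grp ?A ?\<alpha> using tA by (rule topological_grpI)
  interpret G: topological_grp G \<sigma> using tG by (rule topological_grpI)
  have ph: "\<phi> \<in> hom G ?B" and pb: "bij_betw \<phi> (carrier G) (P i)" and pm: "homeomorphic_map \<sigma> ?\<beta> \<phi>"
    using iso by (auto simp: topological_group_iso_def iso_def)
  obtain \<psi> where psi: "homeomorphic_maps \<sigma> ?\<beta> \<phi> \<psi>" using pm unfolding homeomorphic_map_maps ..
  have PB: "P i \<subseteq> Bij (X i)" using subgroup.subset[OF P_sub[OF i]] by simp
  then have tb: "topspace ?\<beta> = P i" by (simp add: topspace_subtopology Int_absorb1)
  have c\<psi>: "continuous_map ?\<beta> \<sigma> \<psi>" and c\<phi>: "continuous_map \<sigma> ?\<beta> \<phi>"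
    using psi by (simp_all add: homeomorphic_maps_def)
  have \<psi>\<phi>: "\<psi> (\<phi> g) = g" if "g \<in> carrier G" for g using psi that by (simp add: homeomorphic_maps_def)
  have \<phi>\<psi>: "\<phi> (\<psi> p) = p" if "p \<in> P i" for p using psi that tb by (simp add: homeomorphic_maps_def)
  have \<psi>G: "\<psi> p \<in> carrier G" if "p \<in> P i" for p
    using continuous_map_image_subset_topspace[OF c\<psi>] that unfolding tb by auto
  have \<phi>P: "\<phi> g \<in> P i" if "g \<in> carrier G" for g using hom_in_carrier[OF ph that] by simp
  have \<phi>m: "\<phi> (g \<otimes>\<^bsub>G\<^esub> h) = \<phi> g \<otimes>\<^bsub>BijGroup (X i)\<^esub> \<phi> h" if "g \<in> carrier G" "h \<in> carrier G" for g h
    using hom_mult[OF ph that] by simp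
  have \<psi>m: "\<psi> (p \<otimes>\<^bsub>BijGroup (X i)\<^esub> q) = \<psi> p \<otimes>\<^bsub>G\<^esub> \<psi> q" if "p \<in> P i" "q \<in> P i" for p q
  proof -
    have "\<phi> (\<psi> p \<otimes>\<^bsub>G\<^esub> \<psi> q) = p \<otimes>\<^bsub>BijGroup (X i)\<^esub> q"
      unfolding \<phi>m[OF \<psi>G[OF that(1)] \<psi>G[OF that(2)]] \<phi>\<psi>[OF that(1)] \<phi>\<psi>[OF that(2)] ..
    then show ?thesis using \<psi>\<phi>[of "\<psi> p \<otimes>\<^bsub>G\<^esub> \<psi> q"] \<psi>G that by simp
  qed
  have \<psi>1: "\<psi> p = \<one>\<^bsub>G\<^esub> \<longleftrightarrow> p = \<one>\<^bsub>BijGroup (X i)\<^esub>" if p: "p \<in> P i" for p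
  proof -
    have oo: "\<one>\<^bsub>BijGroup (X i)\<^esub> \<otimes>\<^bsub>BijGroup (X i)\<^esub> \<one>\<^bsub>BijGroup (X i)\<^esub> = \<one>\<^bsub>BijGroup (X i)\<^esub>"
      by (rule monoid.r_one[OF group.is_monoid[OF group_BijGroup] monoid.one_closed[OF group.is_monoid[OF group_BijGroup]]])
    note o = subgroup.one_closed[OF P_sub[OF i]]
    have "\<psi> \<one>\<^bsub>BijGroup (X i)\<^esub> \<otimes>\<^bsub>G\<^esub> \<psi> \<one>\<^bsub>BijGroup (X i)\<^esub> = \<psi> \<one>\<^bsub>BijGroup (X i)\<^esub>"
      unfolding \<psi>m[OF o o, symmetric] oo ..
    then have 1: "\<psi> \<one>\<^bsub>BijGroup (X i)\<^esub> = \<one>\<^bsub>G\<^esub>" using \<psi>G[OF o] by (simp add: G.l_cancel_one)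
    show ?thesis
    proof
      assume "\<psi> p = \<one>\<^bsub>G\<^esub>"
      then have "\<phi> (\<psi> p) = \<phi> (\<psi> \<one>\<^bsub>BijGroup (X i)\<^esub>)" unfolding 1 by simp
      then show "p = \<one>\<^bsub>BijGroup (X i)\<^esub>" unfolding \<phi>\<psi>[OF p] \<phi>\<psi>[OF o] .
    qed (simp add: 1)
  qed
  \<comment> \<open>Since \<open>\<psi>\<close> inverts \<open>\<phi>\<close>, the map
    \<open>\<rho>\<close> is the action on the star with values in \<open>G\<close>, and
    \<open>s\<close>, the lifted action on first letters, is its section.\<close>
  define \<rho> where "\<rho> = (\<lambda>h. \<psi> (leaf_action i h))"
  define s where "s = (\<lambda>g. lift (sec i (\<phi> g)))"
  have laP: "leaf_action i h \<in> P i" if "h \<in> leaf_stab i" for h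
    by (rule leaf_action_P[OF i leaf_stabD(1)[OF that]])
  have rho: "\<rho> \<in> hom ?A G"
  proof (rule homI)
    show "\<rho> h \<in> carrier G" if "h \<in> carrier ?A" for h using that \<psi>G laP by (simp add: \<rho>_def)
    fix g h assume "g \<in> carrier ?A" "h \<in> carrier ?A"
    then have gh: "g \<in> leaf_stab i" "h \<in> leaf_stab i" by simp_all
    have "\<rho> (g \<otimes>\<^bsub>BijGroup (verts T)\<^esub> h) = \<rho> g \<otimes>\<^bsub>G\<^esub> \<rho> h"
      unfolding \<rho>_def leaf_action_mult[OF i gh] by (rule \<psi>m[OF laP[OF gh(1)] laP[OF gh(2)]])
    then show "\<rho> (g \<otimes>\<^bsub>?A\<^esub> h) = \<rho> g \<otimes>\<^bsub>G\<^esub> \<rho> h" by (simp add: universal_group_eq)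
  qed
  have rhoc: "continuous_map ?\<alpha> \<sigma> \<rho>"
    using continuous_map_compose[OF continuous_leaf_action[OF i] c\<psi>] by (simp add: \<rho>_def o_def)
  have sA: "s g \<in> leaf_stab i" if "g \<in> carrier G" for g
    unfolding s_def by (rule lift_sec_leaf_stab[OF i \<phi>P[OF that]])
  have sh: "s \<in> hom G ?A"
  proof (rule homI)
    show "s g \<in> carrier ?A" if "g \<in> carrier G" for g using sA[OF that] by simp
    fix g h assume gh: "g \<in> carrier G" "h \<in> carrier G"
    have "s (g \<otimes>\<^bsub>G\<^esub> h) = s g \<otimes>\<^bsub>BijGroup (verts T)\<^esub> s h"
      unfolding s_def \<phi>m[OF gh] sec_mult[OF i \<phi>P[OF gh(1)] \<phi>P[OF gh(2)]]
      by (rule lift_mult[OF sec_U[OF i \<phi>P[OF gh(1)]] sec_U[OF i \<phi>P[OF gh(2)]]])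
    then show "s (g \<otimes>\<^bsub>G\<^esub> h) = s g \<otimes>\<^bsub>?A\<^esub> s h" by (simp add: universal_group_eq)
  qed
  have sc: "continuous_map \<sigma> ?\<alpha> s"
  proof -
    have "continuous_map ?\<beta> UT (sec i)"
      unfolding continuous_map_in_subtopology tb
      using continuous_sec[OF i] sec_U[OF i] by (simp add: Pi_def)
    then have "continuous_map \<sigma> (universal_topology \<Delta> T) s"
      using continuous_map_compose[OF continuous_map_compose[OF c\<phi>] continuous_lift] by (simp add: s_def o_def)
    then show ?thesis unfolding continuous_map_in_subtopology using sA by (simp add: Pi_def)
  qed
  have rs: "\<rho> (s g) = g" if "g \<in> carrier G" for g
    unfolding \<rho>_def s_def leaf_action_lift_sec[OF i \<phi>P[OF that]] by (rule \<psi>\<phi>[OF that])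
  have K: "lift ` class_kernel i = {a \<in> carrier ?A. \<rho> a = \<one>\<^bsub>G\<^esub>}"
    unfolding class_kernel_image[OF i] \<rho>_def using \<psi>1 laP by auto
  show "splits_as_semidirect_product ?A ?\<alpha> (lift ` class_kernel i) G \<sigma>"
    by (rule splits_as_semidirect_productI[OF tA tG rho rhoc sh sc rs K])
  have "group_hom ?A G \<rho>"
    using rho A.is_group G.is_group by (simp add: group_hom_def group_hom_axioms_def)
  from group_hom.normal_kernel[OF this] show "lift ` class_kernel i \<lhd> ?A"
    unfolding kernel_def K .
  show "compactin (universal_topology \<Delta> T) (lift ` class_kernel i)"
  proof (rule image_compactin[OF _ continuous_lift])
    show "compactin UT (class_kernel i)"
      by (rule compactin_UT[OF compact_class_kernel[OF i]]) (auto simp: class_kernel_def)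
  qed
qed

end

section \<open>Permutation models of the given groups\<close>

text \<open>Bundles the output of \<open>coset_representation\<close> with a base point, so that
  \<open>X\<close>, \<open>P\<close>, \<open>b\<close> and \<open>\<phi>\<close> can be chosen
  simultaneously for all indices.\<close>

definition permutation_model ::
    "nat \<Rightarrow> ('g, 'm) monoid_scheme \<Rightarrow> 'g topology \<Rightarrow> nat set \<Rightarrow> (nat \<Rightarrow> nat) set \<Rightarrow> nat \<Rightarrow> ('g \<Rightarrow> nat \<Rightarrow> nat) \<Rightarrow> bool" where
  "permutation_model i G \<tau> X P b \<phi> \<longleftrightarrow>
     b \<in> X \<and> (\<forall>x\<in>X. fst (prod_decode x) = i) \<and> subgroup P (BijGroup X) \<and> closedin (perm_topology X) P \<and>
     (\<forall>x\<in>X. \<forall>y\<in>X. \<exists>p\<in>P. p x = y) \<and> (\<forall>x\<in>X. compactin (perm_topology X) {p \<in> P. p x = x}) \<and>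
     generate (BijGroup X) (\<Union>x\<in>X. {p \<in> P. p x = x}) = P \<and>
     (\<exists>p\<in>P. p b = b \<and> p \<noteq> \<one>\<^bsub>BijGroup X\<^esub>) \<and>
     (\<exists>C. compactin (perm_topology X) C \<and> generate (BijGroup X) C = P) \<and>
     topological_group_iso G \<tau> (BijGroup X\<lparr>carrier := P\<rparr>) (subtopology (perm_topology X) P) \<phi>"

lemma exists_permutation_model:
  assumes "tdlc_group G \<tau>" "compactly_generated G \<tau>" "carrier G \<noteq> {\<one>\<^bsub>G\<^esub>}"
    "compact_open_subgroup G \<tau> U"
    "generate G (\<Union>g\<in>carrier G. conjugate_set G U g) = carrier G"
    "(\<Inter>g\<in>carrier G. conjugate_set G U g) = {\<one>\<^bsub>G\<^esub>}"
  shows "\<exists>X P b \<phi>. permutation_model i G \<tau> X P b \<phi>"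
proof -
  have tg: "topological_group G \<tau>" and T2: "Hausdorff_space \<tau>"
    using assms(1) by (auto simp: tdlc_group_def)
  interpret topological_grp G \<tau> using tg by (rule topological_grpI)
  have U: "subgroup U G" "compactin \<tau> U" "openin \<tau> U"
    using assms(4) by (auto simp: compact_open_subgroup_def)
  show ?thesis
  proof (rule coset_representation[OF U assms(2) T2 assms(3,5,6), of i])
    fix P X \<phi>
    assume 1: "subgroup P (BijGroup X)" and 2: "closedin (perm_topology X) P"
      and 3: "\<And>x y. x \<in> X \<Longrightarrow> y \<in> X \<Longrightarrow> \<exists>p\<in>P. p x = y"
      and 4: "\<And>x. x \<in> X \<Longrightarrow> compactin (perm_topology X) {p \<in> P. p x = x}"
      and 5: "generate (BijGroup X) (\<Union>x\<in>X. {p \<in> P. p x = x}) = P"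
      and 6: "\<exists>x\<in>X. \<exists>p\<in>P. p x = x \<and> p \<noteq> \<one>\<^bsub>BijGroup X\<^esub>"
      and 7: "\<exists>C. compactin (perm_topology X) C \<and> generate (BijGroup X) C = P"
      and 8: "topological_group_iso G \<tau> (BijGroup X\<lparr>carrier := P\<rparr>) (subtopology (perm_topology X) P) \<phi>"
      and 9: "\<And>x. x \<in> X \<Longrightarrow> fst (prod_decode x) = i"
    from 6 obtain b where b: "b \<in> X" "\<exists>p\<in>P. p b = b \<and> p \<noteq> \<one>\<^bsub>BijGroup X\<^esub>" ..
    have trans: "\<forall>x\<in>X. \<forall>y\<in>X. \<exists>p\<in>P. p x = y" by (intro ballI) (rule 3)
    have comp: "\<forall>x\<in>X. compactin (perm_topology X) {p \<in> P. p x = x}" by (rule ballI) (rule 4)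
    have enc: "\<forall>x\<in>X. fst (prod_decode x) = i" by (rule ballI) (rule 9)
    have "permutation_model i G \<tau> X P b \<phi>"
      unfolding permutation_model_def by (intro conjI b(1) enc 1 2 trans comp 5 b(2) 7 8)
    then show ?thesis by (intro exI)
  qed
qed

lemma diagram_group_of_models:
  assumes I: "finite I" "0 \<notin> I" "I \<noteq> {}" "\<And>i. i \<in> I \<Longrightarrow> \<exists>j\<in>I. j \<noteq> i"
    and M: "\<forall>i\<in>I. permutation_model i (G i) (\<tau> i) (X i) (P i) (b i) (\<phi> i)"
  shows "diagram_group I X P b"
proof -
  note m = bspec[OF M, unfolded permutation_model_def]
  have b: "b i \<in> X i" and sub: "subgroup (P i) (BijGroup (X i))"
    and cl: "closedin (perm_topology (X i)) (P i)"
    and gen: "generate (BijGroup (X i)) (\<Union>x\<in>X i. {p \<in> P i. p x = x}) = P i"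
    and nt: "\<exists>p\<in>P i. p (b i) = b i \<and> p \<noteq> \<one>\<^bsub>BijGroup (X i)\<^esub>"
    and cg: "\<exists>C. compactin (perm_topology (X i)) C \<and> generate (BijGroup (X i)) C = P i"
    and tp: "\<forall>x\<in>X i. fst (prod_decode x) = i"
    and comp: "\<forall>x\<in>X i. compactin (perm_topology (X i)) {p \<in> P i. p x = x}"
    and trans: "\<forall>x\<in>X i. \<forall>y\<in>X i. \<exists>p\<in>P i. p x = y" if "i \<in> I" for i
    using m[OF that] by - (elim conjE, assumption)+
  show ?thesis
    by (intro diagram_group.intro word_group.intro reduced_words.intro word_group_axioms.intro
        diagram_group_axioms.intro)
      (rule b sub I bspec[OF tp] bspec[OF bspec[OF trans]] cl bspec[OF comp] gen nt cg; assumption)+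
qed

text \<open>The second conjunct is the parenthetical example about groups in the class. For the
  first, the vertices are the neighbours of the empty word over \<open>1\<close> to
  \<open>n\<close>; the additional leaf serves to make the tree unbounded.\<close>

theorem theorem1p12:
  fixes n :: nat
    and G :: "nat \<Rightarrow> ('g, 'm) monoid_scheme"
    and \<tau> :: "nat \<Rightarrow> 'g topology"
    and H :: "('h, 'k) monoid_scheme"
    and \<sigma> :: "'h topology"
    and W :: "'h set"
  shows
    "(1 \<le> n \<and>
      (\<forall>i\<in>{1..n}.
         tdlc_group (G i) (\<tau> i) \<and> compactly_generated (G i) (\<tau> i) \<and>
         carrier (G i) \<noteq> {\<one>\<^bsub>G i\<^esub>} \<and>
         (\<exists>U. compact_open_subgroup (G i) (\<tau> i) U \<and>
              generate (G i) (\<Union>g\<in>carrier (G i). conjugate_set (G i) U g) = carrier (G i) \<and>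
              (\<Inter>g\<in>carrier (G i). conjugate_set (G i) U g) = {\<one>\<^bsub>G i\<^esub>}))
      \<longrightarrow>
      (\<exists>(\<Delta> :: (nat, nat, nat) action_diagram) (T :: (nat, nat, nat, nat, nat) labelled_tree).
         local_action_diagram \<Delta> \<and> diagram_tree \<Delta> T \<and>
         countable (verts T) \<and> countable (arcs T) \<and>
         class_S (universal_group \<Delta> T) (universal_topology \<Delta> T) \<and>
         acts_continuously (universal_topology \<Delta> T) (verts T) \<and>
         (\<exists>(v :: nat \<Rightarrow> nat) Op K.
            \<forall>i\<in>{1..n}.
              v i \<in> verts T \<and>
              Op i = stabilizer (universal_group \<Delta> T) (\<lambda>g. g) (v i) \<and>
              K i \<lhd> (universal_group \<Delta> T)\<lparr>carrier := Op i\<rparr> \<and>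
              compactin (universal_topology \<Delta> T) (K i) \<and>
              splits_as_semidirect_product
                ((universal_group \<Delta> T)\<lparr>carrier := Op i\<rparr>)
                (subtopology (universal_topology \<Delta> T) (Op i))
                (K i) (G i) (\<tau> i))))
     \<and>
     (class_S H \<sigma> \<and> compact_open_subgroup H \<sigma> W
      \<longrightarrow>
      tdlc_group H \<sigma> \<and> compactly_generated H \<sigma> \<and> carrier H \<noteq> {\<one>\<^bsub>H\<^esub>} \<and>
      generate H (\<Union>g\<in>carrier H. conjugate_set H W g) = carrier H \<and>
      (\<Inter>g\<in>carrier H. conjugate_set H W g) = {\<one>\<^bsub>H\<^esub>})"
proof (rule conjI; rule impI)
  assume hyp: "1 \<le> n \<and>
      (\<forall>i\<in>{1..n}.
         tdlc_group (G i) (\<tau> i) \<and> compactly_generated (G i) (\<tau> i) \<and>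
         carrier (G i) \<noteq> {\<one>\<^bsub>G i\<^esub>} \<and>
         (\<exists>U. compact_open_subgroup (G i) (\<tau> i) U \<and>
              generate (G i) (\<Union>g\<in>carrier (G i). conjugate_set (G i) U g) = carrier (G i) \<and>
              (\<Inter>g\<in>carrier (G i). conjugate_set (G i) U g) = {\<one>\<^bsub>G i\<^esub>}))"
  define I where "I = {1..Suc n}"
  \<comment> \<open>The index \<open>Suc n\<close> repeats \<open>G 1\<close>, so that the diagram has at least two leaves even if \<open>n = 1\<close>.\<close>
  define r where "r = (\<lambda>i. if i = Suc n then 1 else i)"
  have n1: "1 \<le> n" using hyp by (rule conjunct1)
  have r: "r i \<in> {1..n}" if "i \<in> I" for i using that n1 by (auto simp: r_def I_def)
  have ex: "\<exists>X P b \<phi>. permutation_model i (G (r i)) (\<tau> (r i)) X P b \<phi>" if i: "i \<in> I" for i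
  proof -
    note h = bspec[OF conjunct2[OF hyp] r[OF i]]
    from h obtain U where U: "compact_open_subgroup (G (r i)) (\<tau> (r i)) U"
      "generate (G (r i)) (\<Union>g\<in>carrier (G (r i)). conjugate_set (G (r i)) U g) = carrier (G (r i))"
      "(\<Inter>g\<in>carrier (G (r i)). conjugate_set (G (r i)) U g) = {\<one>\<^bsub>G (r i)\<^esub>}"
      by (elim conjE exE)
    have "tdlc_group (G (r i)) (\<tau> (r i))" "compactly_generated (G (r i)) (\<tau> (r i))"
      "carrier (G (r i)) \<noteq> {\<one>\<^bsub>G (r i)\<^esub>}"
      using h by - (elim conjE, assumption)+
    then show ?thesis using U by (rule exists_permutation_model)
  qed
  define M where "M = (\<lambda>i. permutation_model i (G (r i)) (\<tau> (r i)))"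
  have "\<forall>i. \<exists>X P b \<phi>. i \<in> I \<longrightarrow> M i X P b \<phi>" using ex unfolding M_def by metis
  then obtain X P b \<phi> where "\<forall>i. i \<in> I \<longrightarrow> M i (X i) (P i) (b i) (\<phi> i)" by metis
  then have model: "\<forall>i\<in>I. permutation_model i (G (r i)) (\<tau> (r i)) (X i) (P i) (b i) (\<phi> i)"
    unfolding M_def by (intro ballI) (elim allE, erule mp)
  have dg: "diagram_group I X P b"
  proof (rule diagram_group_of_models[OF _ _ _ _ model])
    show "\<exists>j\<in>I. j \<noteq> i" if "i \<in> I" for i
      using n1 by (cases "i = 1") (auto simp: I_def)
  qed (auto simp: I_def)
  interpret diagram_group I X P b by (rule dg)
  have leaf: "lv [] i \<in> verts T \<and>
      leaf_stab i = stabilizer (universal_group \<Delta> T) (\<lambda>g. g) (lv [] i) \<and>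
      lift ` class_kernel i \<lhd> (universal_group \<Delta> T)\<lparr>carrier := leaf_stab i\<rparr> \<and>
      compactin (universal_topology \<Delta> T) (lift ` class_kernel i) \<and>
      splits_as_semidirect_product ((universal_group \<Delta> T)\<lparr>carrier := leaf_stab i\<rparr>)
        (subtopology (universal_topology \<Delta> T) (leaf_stab i)) (lift ` class_kernel i) (G i) (\<tau> i)"
    if i: "i \<in> {1..n}" for i
  proof -
    have iI: "i \<in> I" and ri: "r i = i" using i by (auto simp: I_def r_def)
    have tG: "topological_group (G i) (\<tau> i)"
      using bspec[OF conjunct2[OF hyp] i] by (simp add: tdlc_group_def)
    have iso: "topological_group_iso (G i) (\<tau> i) (BijGroup (X i)\<lparr>carrier := P i\<rparr>)
        (subtopology (perm_topology (X i)) (P i)) (\<phi> i)"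
      using bspec[OF model iI] unfolding ri permutation_model_def by (elim conjE)
    show ?thesis
      by (intro conjI lv_Nil_T[OF iI] leaf_stab_def leaf_splits[OF iI tG iso])
  qed
  show "\<exists>(\<Delta> :: (nat, nat, nat) action_diagram) (T :: (nat, nat, nat, nat, nat) labelled_tree).
         local_action_diagram \<Delta> \<and> diagram_tree \<Delta> T \<and>
         countable (verts T) \<and> countable (arcs T) \<and>
         class_S (universal_group \<Delta> T) (universal_topology \<Delta> T) \<and>
         acts_continuously (universal_topology \<Delta> T) (verts T) \<and>
         (\<exists>(v :: nat \<Rightarrow> nat) Op K.
            \<forall>i\<in>{1..n}.
              v i \<in> verts T \<and>
              Op i = stabilizer (universal_group \<Delta> T) (\<lambda>g. g) (v i) \<and>
              K i \<lhd> (universal_group \<Delta> T)\<lparr>carrier := Op i\<rparr> \<and>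
              compactin (universal_topology \<Delta> T) (K i) \<and>
              splits_as_semidirect_product
                ((universal_group \<Delta> T)\<lparr>carrier := Op i\<rparr>)
                (subtopology (universal_topology \<Delta> T) (Op i))
                (K i) (G i) (\<tau> i))"
  proof (rule exI[of _ \<Delta>], rule exI[of _ T], intro conjI)
    show "\<exists>(v :: nat \<Rightarrow> nat) Op K.
            \<forall>i\<in>{1..n}.
              v i \<in> verts T \<and>
              Op i = stabilizer (universal_group \<Delta> T) (\<lambda>g. g) (v i) \<and>
              K i \<lhd> (universal_group \<Delta> T)\<lparr>carrier := Op i\<rparr> \<and>
              compactin (universal_topology \<Delta> T) (K i) \<and>
              splits_as_semidirect_product
                ((universal_group \<Delta> T)\<lparr>carrier := Op i\<rparr>)
                (subtopology (universal_topology \<Delta> T) (Op i))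
                (K i) (G i) (\<tau> i)"
      by (rule exI[of _ "lv []"], rule exI[of _ leaf_stab],
          rule exI[of _ "\<lambda>i. lift ` class_kernel i"], rule ballI, rule leaf)
  qed (rule local_action_diagram diagram_tree countableI_type class_S_universal acts_continuously_universal)+
next
  assume hyp: "class_S H \<sigma> \<and> compact_open_subgroup H \<sigma> W"
  then have S: "class_S H \<sigma>" and W: "compact_open_subgroup H \<sigma> W" by auto
  show "tdlc_group H \<sigma> \<and> compactly_generated H \<sigma> \<and> carrier H \<noteq> {\<one>\<^bsub>H\<^esub>} \<and>
      generate H (\<Union>g\<in>carrier H. conjugate_set H W g) = carrier H \<and>
      (\<Inter>g\<in>carrier H. conjugate_set H W g) = {\<one>\<^bsub>H\<^esub>}"
    using class_S_compact_open_subgroup[OF S W] S by (simp add: class_S_def topologically_simple_def)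
qed

end
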